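(* Consider the Hurwitz space of genus one double coverings $\rho^2=(\lambda-v_1)(\lambda-v_2)(\lambda-v_3)(\lambda-v_4)$ with the diagonal metric $$\eta=\sum_{i=1}^4\eta_i\,dv_i^2,\qquad \eta_i=\frac{2}{\Omega_1^2\prod_{j\ne i}(v_i-v_j)},\qquad \Omega_1=\oint_a\frac{d\lambda}{\rho},$$ and let $W=(W_{ij})$ be the matrix $W_{ij}=(v_j-v_i)\frac1{\sqrt{\eta_i}}\frac{\partial\sqrt{\eta_j}}{\partial v_i}$ for $i\ne j$, $W_{ii}=0$. Then (for suitable branches of the square roots) $$W(v_1,v_2,v_3,v_4)=\begin{pmatrix}0&-c(s)&b(s)&-a(s)\\ c(s)&0&-a(s)&-b(s)\\ -b(s)&a(s)&0&-c(s)\\ a(s)&b(s)&c(s)&0\end{pmatrix},\qquad s=\frac{(v_3-v_1)(v_4-v_2)}{(v_2-v_1)(v_4-v_3)},$$ where $$a(s)=\frac{\bar I(s)}{2\sqrt{-s}},\qquad b(s)=-\frac{\bar I(s)-1}{2\sqrt{s-1}},\qquad c(s)=\frac{\bar I(s)-s}{2\sqrt{s(1-s)}},\qquad \bar I(s)=\frac{s+1}3-\frac{2\bar\eta_1}{\bar\omega_1}$$ are the functions giving the corresponding $3\times3$ matrix for the Hurwitz space of genus one double coverings $\rho^2=(\lambda-u_1)(\lambda-u_2)(\lambda-u_3)$.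
   Context: The $v_i$ are pairwise distinct complex numbers, and $a$ is a cycle on the elliptic curve $\rho^2=\prod_{i=1}^4(\lambda-v_i)$ encircling, on one sheet, a cut from $v_1$ to $v_2$. The metric above is $\eta_i=\mathrm{Res}_{P_i}\,\phi^2/d\lambda$, where $P_i$ is the branch point over $\lambda=v_i$ and $\phi=\frac{d\lambda}{\Omega_1\rho}$ is the normalized holomorphic differential. For $s\ne0,1$: $\bar\omega_1=\oint_a\frac{d\lambda}{2\sqrt{\lambda(\lambda-1)(\lambda-s)}}$, where $a$ is the corresponding cycle encircling a cut from $0$ to $1$ on the curve $\bar\rho^2=\bar\lambda(\bar\lambda-1)(\bar\lambda-s)$; $\bar\omega_1,\bar\omega_2$ are the (full) periods of the Weierstrass function in the uniformization $\bar\lambda=\wp(z;\bar\omega_1,\bar\omega_2)+\frac{s+1}3$, $\bar\rho=\frac12\frac{d\bar\lambda}{dz}$; and $\bar\eta_1=\zeta(\bar\omega_1/2;\bar\omega_1,\bar\omega_2)$ with $\zeta$ the Weierstrass zeta function. *)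

theory Defs
  imports "HOL-Analysis.Analysis"
begin

section \<open>Cycles and periods\<close>

text \<open>
  \<open>\<gamma>\<close> is the projection to the \<open>\<lambda>\<close>-plane of a cycle that encircles, on one sheet, a cut from
  \<open>p\<close> to \<open>q\<close>; the remaining finite branch points \<open>E\<close> are on the other side of \<open>\<gamma>\<close>.  The
  orientation is left open: reversing it changes the signs of the periods only, which enter
  below through \<open>\<Omega>\<^sub>1\<^sup>2\<close> and through the even function \<open>\<omega>\<^sub>1 \<mapsto> \<zeta>(\<omega>\<^sub>1/2)/\<omega>\<^sub>1\<close>.
\<close>

definition encircles_cut :: "(real \<Rightarrow> complex) \<Rightarrow> complex \<Rightarrow> complex \<Rightarrow> complex set \<Rightarrow> bool" where
  "encircles_cut \<gamma> p q E \<longleftrightarrow>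
     valid_path \<gamma> \<and> simple_path \<gamma> \<and> pathfinish \<gamma> = pathstart \<gamma> \<and>
     (\<exists>cut. arc cut \<and> pathstart cut = p \<and> pathfinish cut = q \<and>
        path_image cut \<subseteq> inside (path_image \<gamma>)) \<and>
     E \<subseteq> outside (path_image \<gamma>)"

text \<open>
  \<open>t \<mapsto> (\<gamma> t, \<rho> t)\<close> is a closed path on the curve \<open>\<rho>\<^sup>2 = P(\<lambda>)\<close>.
\<close>

definition lifts_to_curve ::
    "(complex \<Rightarrow> complex) \<Rightarrow> (real \<Rightarrow> complex) \<Rightarrow> (real \<Rightarrow> complex) \<Rightarrow> bool" where
  "lifts_to_curve P \<gamma> \<rho> \<longleftrightarrow>
     path \<rho> \<and> pathfinish \<rho> = pathstart \<rho> \<and> (\<forall>t\<in>{0..1}. \<rho> t ^ 2 = P (\<gamma> t))"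

text \<open>
  The period of \<open>d\<lambda>/\<rho>\<close> over the cycle above \<open>\<gamma>\<close>.  There are two lifts, \<open>\<rho>\<close> and \<open>-\<rho>\<close> (one on
  each sheet), so the period is determined up to its sign, which is immaterial below.
\<close>

definition cycle_period :: "(complex \<Rightarrow> complex) \<Rightarrow> (real \<Rightarrow> complex) \<Rightarrow> complex" where
  "cycle_period P \<gamma> =
     (let \<rho> = (SOME \<rho>. lifts_to_curve P \<gamma> \<rho>)
      in integral {0..1} (\<lambda>t. vector_derivative \<gamma> (at t within {0..1}) / \<rho> t))"


section \<open>The metric and the matrix of rescaled rotation coefficients\<close>

definition \<Omega>\<^sub>1 :: "(real \<Rightarrow> complex) \<Rightarrow> complex ^ 'n \<Rightarrow> complex" where
  "\<Omega>\<^sub>1 \<gamma> v = cycle_period (\<lambda>x. \<Prod>i\<in>UNIV. (x - v $ i)) \<gamma>"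

definition metric_coeff :: "(real \<Rightarrow> complex) \<Rightarrow> 'n \<Rightarrow> complex ^ 'n \<Rightarrow> complex" where
  "metric_coeff \<gamma> i v = 2 / ((\<Omega>\<^sub>1 \<gamma> v)\<^sup>2 * (\<Prod>j\<in>UNIV - {i}. (v $ i - v $ j)))"

definition sqrt_branch ::
    "'a::topological_space set \<Rightarrow> ('a \<Rightarrow> complex) \<Rightarrow> ('a \<Rightarrow> complex) \<Rightarrow> bool" where
  "sqrt_branch U f r \<longleftrightarrow> continuous_on U r \<and> (\<forall>x\<in>U. r x ^ 2 = f x)"

definition partial_deriv ::
    "'n \<Rightarrow> (complex ^ 'n \<Rightarrow> complex) \<Rightarrow> complex ^ 'n \<Rightarrow> complex" where
  "partial_deriv i f v = deriv (\<lambda>z. f (\<chi> k. if k = i then z else v $ k)) (v $ i)"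

text \<open>\<open>R i\<close> plays the role of the branch of the square root of \<open>metric_coeff \<gamma> i\<close>.\<close>

definition W_matrix ::
    "('n \<Rightarrow> complex ^ 'n \<Rightarrow> complex) \<Rightarrow> complex ^ 'n \<Rightarrow> complex ^ 'n ^ 'n" where
  "W_matrix R v =
     (\<chi> i j. if i = j then 0 else (v $ j - v $ i) * (1 / R i v) * partial_deriv i (R j) v)"


section \<open>The Weierstrass functions\<close>

definition period_lattice :: "complex \<Rightarrow> complex \<Rightarrow> complex set" where
  "period_lattice \<omega>\<^sub>1 \<omega>\<^sub>2 = {of_int m * \<omega>\<^sub>1 + of_int n * \<omega>\<^sub>2 | m n. True}"

definition weierstrass_p :: "complex \<Rightarrow> complex \<Rightarrow> complex \<Rightarrow> complex" where
  "weierstrass_p \<omega>\<^sub>1 \<omega>\<^sub>2 z =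
     1 / z\<^sup>2 + (\<Sum>\<^sub>\<infinity>w\<in>period_lattice \<omega>\<^sub>1 \<omega>\<^sub>2 - {0}. 1 / (z - w)\<^sup>2 - 1 / w\<^sup>2)"

definition weierstrass_zeta :: "complex \<Rightarrow> complex \<Rightarrow> complex \<Rightarrow> complex" where
  "weierstrass_zeta \<omega>\<^sub>1 \<omega>\<^sub>2 z =
     1 / z + (\<Sum>\<^sub>\<infinity>w\<in>period_lattice \<omega>\<^sub>1 \<omega>\<^sub>2 - {0}. 1 / (z - w) + 1 / w + z / w\<^sup>2)"


section \<open>The reduced curve\<close>

definition reduced_cubic :: "complex \<Rightarrow> complex \<Rightarrow> complex" where
  "reduced_cubic s x = x * (x - 1) * (x - s)"

definition \<omega>\<^sub>1_bar :: "complex \<Rightarrow> (real \<Rightarrow> complex) \<Rightarrow> complex" where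
  "\<omega>\<^sub>1_bar s \<delta> = cycle_period (reduced_cubic s) \<delta> / 2"

text \<open>
  \<open>\<omega>\<^sub>1, \<omega>\<^sub>2\<close> are full periods such that \<open>\<lambda> = \<wp>(z) + (s + 1)/3\<close>, \<open>\<rho> = \<wp>'(z)/2\<close> uniformizes the
  curve \<open>\<rho>\<^sup>2 = \<lambda>(\<lambda> - 1)(\<lambda> - s)\<close>.
\<close>

definition uniformizing_periods :: "complex \<Rightarrow> complex \<Rightarrow> complex \<Rightarrow> bool" where
  "uniformizing_periods s \<omega>\<^sub>1 \<omega>\<^sub>2 \<longleftrightarrow>
     Im (\<omega>\<^sub>2 / \<omega>\<^sub>1) \<noteq> 0 \<and>
     (\<forall>z. z \<notin> period_lattice \<omega>\<^sub>1 \<omega>\<^sub>2 \<longrightarrow>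
        (deriv (weierstrass_p \<omega>\<^sub>1 \<omega>\<^sub>2) z / 2)\<^sup>2 =
          reduced_cubic s (weierstrass_p \<omega>\<^sub>1 \<omega>\<^sub>2 z + (s + 1) / 3))"

definition I_bar :: "complex \<Rightarrow> complex \<Rightarrow> complex \<Rightarrow> complex" where
  "I_bar s \<omega>\<^sub>1 \<omega>\<^sub>2 = (s + 1) / 3 - 2 * weierstrass_zeta \<omega>\<^sub>1 \<omega>\<^sub>2 (\<omega>\<^sub>1 / 2) / \<omega>\<^sub>1"

text \<open>
  The cycle \<open>\<gamma>\<close> corresponds to the cycle \<open>\<delta>\<close> on the reduced curve with parameter \<open>s\<close> under the
  map \<open>f\<close> of \<open>\<lambda>\<close>-planes that sends the branch points of the given curve to \<open>0, 1, s, \<infinity>\<close>.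
\<close>

definition corresponds_via ::
    "(complex \<Rightarrow> complex) \<Rightarrow> complex \<Rightarrow> (real \<Rightarrow> complex) \<Rightarrow> (real \<Rightarrow> complex) \<Rightarrow> bool" where
  "corresponds_via f s \<gamma> \<delta> \<longleftrightarrow> homotopic_loops (- {0, 1, s}) (f \<circ> \<gamma>) \<delta>"

text \<open>
  \<open>normalize4 v\<close> sends \<open>v\<^sub>1, v\<^sub>2, v\<^sub>3, v\<^sub>4\<close> to \<open>0, 1, s, \<infinity>\<close>, and \<open>normalize3 u\<close> sends
  \<open>u\<^sub>1, u\<^sub>2, u\<^sub>3, \<infinity>\<close> to \<open>0, 1, s, \<infinity>\<close>.
\<close>

definition cross_ratio4 :: "complex ^ 4 \<Rightarrow> complex" where
  "cross_ratio4 v = ((v $ 3 - v $ 1) * (v $ 4 - v $ 2)) / ((v $ 2 - v $ 1) * (v $ 4 - v $ 3))"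

definition normalize4 :: "complex ^ 4 \<Rightarrow> complex \<Rightarrow> complex" where
  "normalize4 v x = ((x - v $ 1) * (v $ 4 - v $ 2)) / ((v $ 2 - v $ 1) * (v $ 4 - x))"

definition cross_ratio3 :: "complex ^ 3 \<Rightarrow> complex" where
  "cross_ratio3 u = (u $ 3 - u $ 1) / (u $ 2 - u $ 1)"

definition normalize3 :: "complex ^ 3 \<Rightarrow> complex \<Rightarrow> complex" where
  "normalize3 u x = (x - u $ 1) / (u $ 2 - u $ 1)"

end

theory Submission
  imports Defs "HOL-Complex_Analysis.Riemann_Mapping"
begin

text \<open>
  The Moebius map sending the branch points to \<open>0, 1, s, \<infinity>\<close> turns \<open>\<Omega>\<^sub>1\<^sup>2\<close> into
  \<open>- (2 \<omega>\<^sub>1(s))\<^sup>2 / ((v\<^sub>2 - v\<^sub>1) (v\<^sub>4 - v\<^sub>3))\<close>, respectively \<open>(2 \<omega>\<^sub>1(s))\<^sup>2 / (u\<^sub>2 - u\<^sub>1)\<close>, because the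
  squared period of the reduced curve depends only on the homotopy class of the cycle off \<open>{0, 1, s}\<close>.
  So every entry of \<open>W\<close> is a ratio of square roots of rational functions times an affine
  expression in the logarithmic derivative of \<open>\<omega>\<^sub>1\<close> with respect to \<open>s\<close>.
  Integrating the exact form \<open>d (\<rho> / (\<lambda> - s))\<close> over the cycle expresses that derivative by
  the quotient of the periods of \<open>\<lambda> d\<lambda> / \<rho>\<close> and \<open>d\<lambda> / \<rho>\<close>. The cycle lifts through
  \<open>\<lambda> = \<wp>(z) + (s + 1) / 3\<close> to a path from \<open>z\<close> to \<open>z \<plusminus> \<omega>\<^sub>1\<close>, and \<open>\<zeta>' = - \<wp>\<close> together with
  \<open>\<zeta>(z + \<omega>\<^sub>1) - \<zeta>(z) = 2 \<zeta>(\<omega>\<^sub>1 / 2)\<close> shows that the quotient is the function \<open>I\<close> of the statement.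
  With \<open>A\<close>, \<open>B\<close>, \<open>C\<close> denoting the branches of the square roots of \<open>-s\<close>, \<open>s - 1\<close>, \<open>s (1 - s)\<close>, the
  signs of all entries agree when \<open>A = - s B / C\<close>.
\<close>

section \<open>The Weierstrass functions of a lattice\<close>

text \<open>Two sign ambiguities shape the proof. \<open>cycle_period\<close> picks one of two lifts
  by \<open>SOME\<close>, so its sign may jump as the branch points move and it cannot be
  differentiated as it stands. Hence the given cycles enter through squared periods only, and
  \<open>reduced_period\<close> builds a holomorphic \<open>F\<close> of \<open>s\<close> with the
  right square. Likewise, roots of the metric coefficients chosen independently would leave the
  signs of the entries open; one root is chosen and the others are explicit multiples of it, with
  factors read off from the first row of the target matrix.

  The form d\<lambda>/\<rho> is two-valued on the punctured plane, so Cauchy's theorem does not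
  apply directly; cycles are deformed by means of local primitives on small discs. This also
  replaces the given cycle by a polynomial loop, along which the period can be differentiated under
  the integral sign for all nearby \<open>s\<close> at once. The differential equation of
  \<open>wp\<close> is part of \<open>uniformizing_periods\<close>; what remains is the existence of
  the lift of the cycle through \<open>wp\<close>, which rests on surjectivity of \<open>wp\<close>
  and on its poles.\<close>

lemma summable_on_int_powr:
  fixes a :: real
  assumes "a < -1"
  shows "(\<lambda>n::int. (1 + \<bar>of_int n\<bar>) powr a) summable_on UNIV"
proof -
  have "summable (\<lambda>n. of_nat n powr a)"
    using assms by (simp add: summable_real_powr_iff)
  then have "summable (\<lambda>n::nat. (1 + real n) powr a)"
    using summable_ignore_initial_segment[of "\<lambda>n. of_nat n powr a" 1] by (simp add: add.commute)
  then have *: "(\<lambda>n::nat. (1 + real n) powr a) summable_on UNIV"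
    by (simp add: summable_on_UNIV_nonneg_real_iff)
  have 1: "(\<lambda>n::int. (1 + \<bar>of_int n\<bar>) powr a) summable_on range int"
    using * by (subst summable_on_reindex) (auto simp: o_def)
  have 2: "(\<lambda>n::int. (1 + \<bar>of_int n\<bar>) powr a) summable_on range (\<lambda>n. - int n)"
    using * by (subst summable_on_reindex) (auto simp: o_def inj_on_def)
  have "(UNIV :: int set) = range int \<union> range (\<lambda>n. - int n)"
    by (auto simp: image_iff) (metis int_cases2)
  then show ?thesis
    using summable_on_union[OF 1 2] by simp
qed

lemma inverse_square_derivative:
  "u \<noteq> 0 \<Longrightarrow> ((\<lambda>u. 1 / u\<^sup>2) has_field_derivative - 2 / u ^ 3) (at (u::complex))"
  by (auto intro!: derivative_eq_intros simp: divide_simps power_numeral_reduce)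

lemma constant_on_connected_derivative_zero:
  fixes f :: "complex \<Rightarrow> complex"
  assumes "open S" "connected S" "\<And>z. z \<in> S \<Longrightarrow> (f has_field_derivative 0) (at z)" "x \<in> S" "y \<in> S"
  shows "f x = f y"
proof -
  have "f constant_on S"
    by (rule has_field_derivative_0_imp_constant_on) (use assms in auto)
  then show ?thesis using assms by (auto simp: constant_on_def)
qed

section \<open>Lattices and the convergence of sums over them\<close>

locale complex_lattice =
  fixes \<omega>\<^sub>1 \<omega>\<^sub>2 :: complex
  assumes Im_ratio: "Im (\<omega>\<^sub>2 / \<omega>\<^sub>1) \<noteq> 0"
begin

abbreviation L :: "complex set" where "L \<equiv> period_lattice \<omega>\<^sub>1 \<omega>\<^sub>2"
abbreviation wp :: "complex \<Rightarrow> complex" where "wp \<equiv> weierstrass_p \<omega>\<^sub>1 \<omega>\<^sub>2"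
abbreviation \<zeta> :: "complex \<Rightarrow> complex" where "\<zeta> \<equiv> weierstrass_zeta \<omega>\<^sub>1 \<omega>\<^sub>2"

lemma period_nonzero: "\<omega>\<^sub>1 \<noteq> 0"
  using Im_ratio by auto

text \<open>After division by the first period, the second coordinate is the imaginary part divided
  by that of the period ratio, and the triangle inequality then controls the first. Independence of
  the periods, summability and discreteness of the lattice all come from this one estimate.\<close>

lemma lattice_coords_bound:
  "\<exists>K>0. \<forall>x y :: real. \<bar>x\<bar> + \<bar>y\<bar> \<le> K * norm (of_real x * \<omega>\<^sub>1 + of_real y * \<omega>\<^sub>2)"
proof -
  define \<tau> where "\<tau> = \<omega>\<^sub>2 / \<omega>\<^sub>1"
  define K where "K = 1 + (1 + norm \<tau>) / \<bar>Im \<tau>\<bar>"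
  have \<tau>: "\<bar>Im \<tau>\<bar> > 0" using Im_ratio by (simp add: \<tau>_def)
  have K: "K > 0" using \<tau> by (auto simp: K_def intro!: add_pos_nonneg)
  have bd: "\<bar>x\<bar> + \<bar>y\<bar> \<le> K * norm (of_real x + of_real y * \<tau>)" for x y :: real
  proof -
    let ?z = "of_real x + of_real y * \<tau>"
    have "\<bar>y\<bar> * \<bar>Im \<tau>\<bar> = \<bar>Im ?z\<bar>" by (simp add: abs_mult)
    also have "\<dots> \<le> norm ?z" by (rule abs_Im_le_cmod)
    finally have y: "\<bar>y\<bar> \<le> norm ?z / \<bar>Im \<tau>\<bar>" using \<tau> by (simp add: field_simps)
    have "norm (of_real x :: complex) \<le> norm ?z + norm (of_real y * \<tau>)"
      using norm_triangle_ineq4[of ?z "of_real y * \<tau>"] by simp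
    then have "\<bar>x\<bar> + \<bar>y\<bar> \<le> norm ?z + \<bar>y\<bar> * (1 + norm \<tau>)"
      by (simp add: norm_mult algebra_simps)
    also have "\<dots> \<le> norm ?z + norm ?z / \<bar>Im \<tau>\<bar> * (1 + norm \<tau>)"
      by (intro add_left_mono mult_right_mono y) auto
    also have "\<dots> = K * norm ?z" by (simp add: K_def field_simps)
    finally show ?thesis .
  qed
  show ?thesis
  proof (intro exI[of _ "K / norm \<omega>\<^sub>1"] conjI allI)
    show "K / norm \<omega>\<^sub>1 > 0" using K period_nonzero by simp
    fix x y :: real
    have "of_real x * \<omega>\<^sub>1 + of_real y * \<omega>\<^sub>2 = \<omega>\<^sub>1 * (of_real x + of_real y * \<tau>)"
      using period_nonzero by (simp add: \<tau>_def field_simps)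
    then show "\<bar>x\<bar> + \<bar>y\<bar> \<le> K / norm \<omega>\<^sub>1 * norm (of_real x * \<omega>\<^sub>1 + of_real y * \<omega>\<^sub>2)"
      using bd[of x y] period_nonzero by (simp add: norm_mult)
  qed
qed

lemma lattice_eq_image: "L = (\<lambda>(m, n). of_int m * \<omega>\<^sub>1 + of_int n * \<omega>\<^sub>2) ` UNIV"
  by (auto simp: period_lattice_def)

lemma inj_lattice: "inj (\<lambda>(m, n). of_int m * \<omega>\<^sub>1 + of_int n * \<omega>\<^sub>2)"
proof (rule injI, clarify)
  fix m n m' n' :: int
  assume eq: "of_int m * \<omega>\<^sub>1 + of_int n * \<omega>\<^sub>2 = of_int m' * \<omega>\<^sub>1 + of_int n' * \<omega>\<^sub>2"
  obtain K where K: "K > 0" "\<And>x y :: real. \<bar>x\<bar> + \<bar>y\<bar> \<le> K * norm (of_real x * \<omega>\<^sub>1 + of_real y * \<omega>\<^sub>2)"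
    using lattice_coords_bound by metis
  have "of_real (of_int (m - m')) * \<omega>\<^sub>1 + of_real (of_int (n - n')) * \<omega>\<^sub>2 = 0"
    using eq by (simp add: algebra_simps)
  then have "\<bar>real_of_int (m - m')\<bar> + \<bar>real_of_int (n - n')\<bar> \<le> 0"
    using K(2)[of "of_int (m - m')" "of_int (n - n')"] by simp
  then show "m = m' \<and> n = n'" by linarith
qed

text \<open>For N = |m| + |n| >= 1 both 1 + |m| and 1 + |n| are at most 2N, and N is at most K times
  the norm of the lattice point. Splitting the exponent 3 evenly as 3/2 + 3/2 therefore dominates
  the sum by a product of two convergent one-variable series.\<close>

lemma summable_lattice: "(\<lambda>w. 1 / norm w ^ 3) summable_on (L - {0})"
proof -
  let ?f = "\<lambda>(m::int, n::int). of_int m * \<omega>\<^sub>1 + of_int n * \<omega>\<^sub>2"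
  let ?g = "\<lambda>n::int. (1 + \<bar>of_int n\<bar>) powr (-3/2) :: real"
  obtain K where K: "K > 0" "\<And>x y :: real. \<bar>x\<bar> + \<bar>y\<bar> \<le> K * norm (of_real x * \<omega>\<^sub>1 + of_real y * \<omega>\<^sub>2)"
    using lattice_coords_bound by metis
  have g: "?g summable_on UNIV" by (rule summable_on_int_powr) simp
  have "(\<lambda>(m, n). ?g m * ?g n) summable_on (UNIV \<times> UNIV)"
  proof (rule summable_on_SigmaI)
    fix m :: int
    show "((\<lambda>n. case (m, n) of (m, n) \<Rightarrow> ?g m * ?g n) has_sum ?g m * infsum ?g UNIV) UNIV"
      using has_sum_cmult_right[OF has_sum_infsum[OF g]] by simp
  next
    show "(\<lambda>m. ?g m * infsum ?g UNIV) summable_on UNIV"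
      using g by (rule summable_on_cmult_left)
  qed auto
  then have "(\<lambda>(m, n). ?g m * ?g n) summable_on (UNIV - {(0,0)})"
    by (rule summable_on_subset_banach) auto
  then have s: "(\<lambda>x. 8 * K ^ 3 * (case x of (m, n) \<Rightarrow> ?g m * ?g n)) summable_on (UNIV - {(0,0)})"
    by (rule summable_on_cmult_right)
  have "(\<lambda>x. 1 / norm (?f x) ^ 3) summable_on (UNIV - {(0,0)})"
  proof (rule summable_on_comparison_test[OF s])
    fix x :: "int \<times> int" assume x: "x \<in> UNIV - {(0,0)}"
    obtain m n where mn: "x = (m, n)" by force
    define N where "N = \<bar>real_of_int m\<bar> + \<bar>real_of_int n\<bar>"
    have "\<bar>m\<bar> + \<bar>n\<bar> \<ge> 1" using x mn by auto
    then have N: "N \<ge> 1" unfolding N_def by linarith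
    have KN: "N \<le> K * norm (?f x)" using K(2)[of "of_int m" "of_int n"] by (simp add: N_def mn)
    then have pos: "norm (?f x) > 0" using N by (cases "?f x = 0") auto
    have "(1 + \<bar>real_of_int m\<bar>) powr (3/2) * (1 + \<bar>real_of_int n\<bar>) powr (3/2) \<le> (2 * N) powr (3/2) * (2 * N) powr (3/2)"
      by (intro mult_mono powr_mono2) (use N in \<open>auto simp: N_def\<close>)
    also have "\<dots> = (2 * N) powr 3" by (simp flip: powr_add)
    also have "\<dots> = 8 * N ^ 3" using N by (simp add: powr_numeral power_mult_distrib)
    also have "\<dots> \<le> 8 * (K * norm (?f x)) ^ 3"
      by (intro mult_left_mono power_mono KN) (use N in auto)
    finally have "(1 + \<bar>real_of_int m\<bar>) powr (3/2) * (1 + \<bar>real_of_int n\<bar>) powr (3/2) \<le> 8 * K ^ 3 * norm (?f x) ^ 3"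
      by (simp add: power_mult_distrib)
    then show "1 / norm (?f x) ^ 3 \<le> 8 * K ^ 3 * (case x of (m, n) \<Rightarrow> ?g m * ?g n)"
      using pos by (simp add: mn powr_minus divide_simps split: prod.splits)
  qed (auto)
  then have "((\<lambda>w. 1 / norm w ^ 3) \<circ> ?f) summable_on (UNIV - {(0,0)})"
    by (simp add: o_def)
  then have "(\<lambda>w. 1 / norm w ^ 3) summable_on ?f ` (UNIV - {(0,0)})"
    by (subst summable_on_reindex) (auto intro: inj_on_subset[OF inj_lattice])
  moreover have "?f ` (UNIV - {(0,0)}) = L - {0}"
    unfolding lattice_eq_image using inj_lattice by (subst image_set_diff) auto
  ultimately show ?thesis by simp
qed

lemma zero_in_lattice: "0 \<in> L"
  by (auto simp: period_lattice_def intro: exI[of _ 0])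

lemma periods_in_lattice: "\<omega>\<^sub>1 \<in> L" "\<omega>\<^sub>2 \<in> L"
  using exI[of "\<lambda>m. \<exists>n. \<omega>\<^sub>1 = of_int m * \<omega>\<^sub>1 + of_int n * \<omega>\<^sub>2" 1] exI[of "\<lambda>n. \<omega>\<^sub>1 = of_int 1 * \<omega>\<^sub>1 + of_int n * \<omega>\<^sub>2" 0]
    exI[of "\<lambda>m. \<exists>n. \<omega>\<^sub>2 = of_int m * \<omega>\<^sub>1 + of_int n * \<omega>\<^sub>2" 0] exI[of "\<lambda>n. \<omega>\<^sub>2 = of_int 0 * \<omega>\<^sub>1 + of_int n * \<omega>\<^sub>2" 1]
  by (auto simp: period_lattice_def)

lemma lattice_add: "w \<in> L \<Longrightarrow> w' \<in> L \<Longrightarrow> w + w' \<in> L"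
proof -
  assume "w \<in> L" "w' \<in> L"
  then obtain m n m' n' where "w = of_int m * \<omega>\<^sub>1 + of_int n * \<omega>\<^sub>2" "w' = of_int m' * \<omega>\<^sub>1 + of_int n' * \<omega>\<^sub>2"
    by (auto simp: period_lattice_def)
  then have "w + w' = of_int (m + m') * \<omega>\<^sub>1 + of_int (n + n') * \<omega>\<^sub>2" by (simp add: algebra_simps)
  then show ?thesis unfolding period_lattice_def by blast
qed

lemma lattice_uminus: "w \<in> L \<Longrightarrow> - w \<in> L"
proof -
  assume "w \<in> L"
  then obtain m n where "w = of_int m * \<omega>\<^sub>1 + of_int n * \<omega>\<^sub>2"
    by (auto simp: period_lattice_def)
  then have "- w = of_int (- m) * \<omega>\<^sub>1 + of_int (- n) * \<omega>\<^sub>2" by (simp add: algebra_simps)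
  then show ?thesis unfolding period_lattice_def by blast
qed

lemma lattice_uminus_iff [simp]: "- w \<in> L \<longleftrightarrow> w \<in> L"
  using lattice_uminus[of w] lattice_uminus[of "- w"] by auto

lemma lattice_add_iff: "w' \<in> L \<Longrightarrow> w + w' \<in> L \<longleftrightarrow> w \<in> L"
  using lattice_add[of w w'] lattice_add[of "w + w'" "- w'"] by auto

text \<open>Otherwise uniqueness of coordinates would make an odd integer even. The case
  \<open>- \<omega>\<^sub>1\<close> is carried along because a cycle may be traversed in either
  direction.\<close>

lemma half_period_notin:
  assumes "\<omega> = \<omega>\<^sub>1 \<or> \<omega> = \<omega>\<^sub>2 \<or> \<omega> = - \<omega>\<^sub>1"
  shows "\<omega> / 2 \<notin> L"
proof
  assume "\<omega> / 2 \<in> L"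
  then obtain m n where "\<omega> / 2 = of_int m * \<omega>\<^sub>1 + of_int n * \<omega>\<^sub>2"
    by (auto simp: period_lattice_def)
  then have "\<omega> = of_int (2 * m) * \<omega>\<^sub>1 + of_int (2 * n) * \<omega>\<^sub>2"
    by (simp add: field_simps)
  with assms have "(\<lambda>(m, n). of_int m * \<omega>\<^sub>1 + of_int n * \<omega>\<^sub>2) (2 * m, 2 * n) \<in>
     (\<lambda>(m, n). of_int m * \<omega>\<^sub>1 + of_int n * \<omega>\<^sub>2) ` {(1, 0), (0, 1), (-1, 0)}"
    by auto
  then have "(2 * m, 2 * n) \<in> {(1, 0), (0, 1), (-1, 0)}"
    using inj_lattice by (subst (asm) inj_image_mem_iff) auto
  then show False by auto presburger+
qed

lemma finite_lattice_cball: "finite (L \<inter> cball z r)"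
proof -
  obtain K where K: "K > 0" "\<And>x y :: real. \<bar>x\<bar> + \<bar>y\<bar> \<le> K * norm (of_real x * \<omega>\<^sub>1 + of_real y * \<omega>\<^sub>2)"
    using lattice_coords_bound by metis
  define N where "N = \<lceil>K * (norm z + r)\<rceil>"
  have "L \<inter> cball z r \<subseteq> (\<lambda>(m, n). of_int m * \<omega>\<^sub>1 + of_int n * \<omega>\<^sub>2) ` ({-N..N} \<times> {-N..N})"
  proof
    fix w assume w: "w \<in> L \<inter> cball z r"
    then obtain m n where mn: "w = of_int m * \<omega>\<^sub>1 + of_int n * \<omega>\<^sub>2"
      by (auto simp: period_lattice_def)
    have "norm w \<le> norm z + r" using w norm_triangle_ineq4[of z "z - w"] by (simp add: dist_norm)
    then have "K * norm w \<le> K * (norm z + r)" using K(1) by simp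
    then have "\<bar>real_of_int m\<bar> + \<bar>real_of_int n\<bar> \<le> of_int N"
      using K(2)[of "of_int m" "of_int n"] by (simp add: mn N_def) linarith
    then have "m \<in> {-N..N}" "n \<in> {-N..N}" by auto
    then show "w \<in> (\<lambda>(m, n). of_int m * \<omega>\<^sub>1 + of_int n * \<omega>\<^sub>2) ` ({-N..N} \<times> {-N..N})"
      using mn by auto
  qed
  then show ?thesis by (rule finite_subset) auto
qed


text \<open>Stated for all subsets because arguments around a single pole \<open>w\<close> use the
  open set \<open>- (L - {w})\<close>.\<close>

lemma closed_subset_lattice:
  assumes "A \<subseteq> L" shows "closed A"
proof -
  have "finite (A \<inter> cball z 1)" for z
    by (rule finite_subset[OF _ finite_lattice_cball[of z 1]]) (use assms in auto)
  then have "\<not> z islimpt A" for z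
    unfolding islimpt_eq_infinite_cball using zero_less_one by blast
  then show ?thesis by (simp add: closed_limpt)
qed


text \<open>Locally uniform limits of holomorphic functions may be differentiated termwise, so a
  majorant is asked only of the terms themselves. Summability of the differentiated series comes out
  as a by-product.\<close>

lemma infsum_field_derivative:
  fixes f f' :: "'b \<Rightarrow> complex \<Rightarrow> complex" and M :: "'b \<Rightarrow> real"
  assumes D: "open D"
    and d: "\<And>w z. w \<in> X \<Longrightarrow> z \<in> D \<Longrightarrow> (f w has_field_derivative f' w z) (at z)"
    and M: "\<And>z. z \<in> D \<Longrightarrow> \<exists>r>0. \<exists>M. cball z r \<subseteq> D \<and> M summable_on X \<and> (\<forall>w\<in>X. \<forall>y\<in>cball z r. norm (f w y) \<le> M w)"
    and z: "z \<in> D"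
  shows "((\<lambda>y. \<Sum>\<^sub>\<infinity>w\<in>X. f w y) has_field_derivative (\<Sum>\<^sub>\<infinity>w\<in>X. f' w z)) (at z)"
    "(\<lambda>w. f' w z) summable_on X"
proof -
  obtain r M where r: "r > 0" "cball z r \<subseteq> D" and M: "M summable_on X" "\<And>w y. w \<in> X \<Longrightarrow> y \<in> cball z r \<Longrightarrow> norm (f w y) \<le> M w"
    using M[OF z] by blast
  have ul: "uniform_limit (cball z r) (\<lambda>A y. \<Sum>w\<in>A. f w y) (\<lambda>y. \<Sum>\<^sub>\<infinity>w\<in>X. f w y) (finite_subsets_at_top X)"
    by (rule Weierstrass_m_test_general[OF M(2) M(1)])
  have ev: "\<forall>\<^sub>F A in finite_subsets_at_top X. continuous_on (cball z r) (\<lambda>y. \<Sum>w\<in>A. f w y) \<and>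
      (\<forall>y\<in>ball z r. ((\<lambda>y. \<Sum>w\<in>A. f w y) has_field_derivative (\<Sum>w\<in>A. f' w y)) (at y))"
  proof (rule eventually_mono[OF eventually_finite_subsets_at_top_weakI])
    fix A assume A: "finite A" "A \<subseteq> X"
    have d': "((\<lambda>y. \<Sum>w\<in>A. f w y) has_field_derivative (\<Sum>w\<in>A. f' w y)) (at y)" if "y \<in> D" for y
      using that A by (intro DERIV_sum d) auto
    then have "continuous_on (cball z r) (\<lambda>y. \<Sum>w\<in>A. f w y)"
      using r by (intro continuous_at_imp_continuous_on ballI DERIV_isCont) blast
    moreover have "ball z r \<subseteq> D" using r by (meson ball_subset_cball order_trans)
    ultimately show "continuous_on (cball z r) (\<lambda>y. \<Sum>w\<in>A. f w y) \<and>
      (\<forall>y\<in>ball z r. ((\<lambda>y. \<Sum>w\<in>A. f w y) has_field_derivative (\<Sum>w\<in>A. f' w y)) (at y))"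
      using d' by blast
  qed
  obtain g' where g': "\<And>y. y \<in> ball z r \<Longrightarrow> ((\<lambda>y. \<Sum>\<^sub>\<infinity>w\<in>X. f w y) has_field_derivative g' y) (at y) \<and>
      ((\<lambda>A. \<Sum>w\<in>A. f' w y) \<longlongrightarrow> g' y) (finite_subsets_at_top X)"
    using has_complex_derivative_uniform_limit[OF ev ul _ r(1)] by (metis finite_subsets_at_top_neq_bot)
  have "((\<lambda>w. f' w z) has_sum g' z) X" using g'[of z] r(1) by (simp add: has_sum_def)
  then show "((\<lambda>y. \<Sum>\<^sub>\<infinity>w\<in>X. f w y) has_field_derivative (\<Sum>\<^sub>\<infinity>w\<in>X. f' w z)) (at z)"
      "(\<lambda>w. f' w z) summable_on X"
    using g'[of z] r(1) by (simp_all add: infsumI has_sum_imp_summable)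
qed

definition zeta_reg :: "complex \<Rightarrow> complex" where
  "zeta_reg z = (\<Sum>\<^sub>\<infinity>w\<in>L - {0}. 1 / (z - w) + 1 / w + z / w\<^sup>2)"

definition p_reg :: "complex \<Rightarrow> complex" where
  "p_reg z = (\<Sum>\<^sub>\<infinity>w\<in>L - {0}. 1 / (z - w)\<^sup>2 - 1 / w\<^sup>2)"

text \<open>Supplies the denominators of the majorants. Lattice points of norm at most 2R stay at
  distance at least \<open>r\<close> from the disc, where R bounds the norm on the disc; for the
  others |y| <= |w| / 2. The constant \<open>c\<close> is the smaller of the two resulting
  ratios.\<close>

lemma lattice_separation:
  assumes "z \<notin> L - {0}"
  obtains r c where "r > 0" "c > 0" "cball z r \<subseteq> - (L - {0})" "\<And>w y. w \<in> L - {0} \<Longrightarrow> y \<in> cball z r \<Longrightarrow> norm (y - w) \<ge> c * norm w"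
    "\<And>y. y \<in> cball z r \<Longrightarrow> norm y \<le> norm z + r"
proof -
  have "open (- (L - {0}))" by (intro open_Compl closed_subset_lattice) auto
  then obtain e where e: "e > 0" "ball z e \<subseteq> - (L - {0})"
    using assms open_contains_ball by (metis ComplI)
  define r where "r = e / 2"
  have r: "r > 0" using e by (simp add: r_def)
  define R where "R = norm z + r"
  have R: "R > 0" using r by (simp add: R_def add_nonneg_pos)
  define c where "c = min (1 / 2) (r / (2 * R))"
  have c: "c > 0" "c \<le> 1/2" "c \<le> r / (2 * R)" using r R by (auto simp: c_def)
  have bd: "norm y \<le> R" if "y \<in> cball z r" for y
    using that norm_triangle_ineq2[of y z] by (simp add: R_def dist_norm norm_minus_commute)
  show thesis
  proof (rule that[OF r c(1)])
    show "cball z r \<subseteq> - (L - {0})"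
      using e r by (intro order_trans[OF _ e(2)]) (auto simp: r_def)
    fix w y assume w: "w \<in> L - {0}" and y: "y \<in> cball z r"
    show "norm (y - w) \<ge> c * norm w"
    proof (cases "norm w \<le> 2 * R")
      case True
      have "e \<le> dist z w" using w e(2) by (meson ComplD in_mono linorder_not_le mem_ball)
      then have "r \<le> dist y w" using y dist_triangle[of z w y] by (simp add: r_def)
      moreover have "c * norm w \<le> r / (2 * R) * (2 * R)" using True c R r by (intro mult_mono) auto
      ultimately show ?thesis using R by (simp add: dist_norm)
    next
      case False
      then have "norm y \<le> norm w / 2" using bd[OF y] by simp
      then have "norm w / 2 \<le> norm (y - w)" using norm_triangle_ineq2[of w y] by (simp add: norm_minus_commute)
      moreover have "c * norm w \<le> 1/2 * norm w" using c by (intro mult_right_mono) auto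
      ultimately show ?thesis by simp
    qed
  qed (use bd in \<open>simp add: R_def\<close>)
qed

lemma zeta_reg_derivative:
  assumes z: "z \<notin> L - {0}"
  shows "(zeta_reg has_field_derivative - p_reg z) (at z)"
proof -
  have D: "open (- (L - {0}))" by (intro open_Compl closed_subset_lattice) auto
  have der: "((\<lambda>z. 1 / (z - w) + 1 / w + z / w\<^sup>2) has_field_derivative - (1 / (z - w)\<^sup>2 - 1 / w\<^sup>2)) (at z)"
    if "w \<in> L - {0}" "z \<in> - (L - {0})" for w z
    using that by (auto intro!: derivative_eq_intros simp: field_simps power2_eq_square)
  have M: "\<exists>r>0. \<exists>M. cball z r \<subseteq> - (L - {0}) \<and> M summable_on (L - {0}) \<and>
       (\<forall>w\<in>L - {0}. \<forall>y\<in>cball z r. norm (1 / (y - w) + 1 / w + y / w\<^sup>2) \<le> M w)" if z: "z \<in> - (L - {0})" for z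
  proof -
    from z have "z \<notin> L - {0}" by blast
    then obtain r c where rc: "r > 0" "c > 0" "cball z r \<subseteq> - (L - {0})" "\<And>w y. w \<in> L - {0} \<Longrightarrow> y \<in> cball z r \<Longrightarrow> norm (y - w) \<ge> c * norm w"
      "\<And>y. y \<in> cball z r \<Longrightarrow> norm y \<le> norm z + r" using lattice_separation by metis
    show ?thesis
    proof (intro exI conjI ballI)
      show "(\<lambda>w. (norm z + r)\<^sup>2 / c * (1 / norm w ^ 3)) summable_on (L - {0})"
        by (intro summable_on_cmult_right summable_lattice)
      fix w y assume w: "w \<in> L - {0}" and y: "y \<in> cball z r"
      have nz: "y - w \<noteq> 0" "w \<noteq> 0" "norm w > 0" using w y rc(3) by auto
      \<comment> \<open>The correction terms cancel the two leading orders in 1/w; what is left is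
        of order |w|^(-3), the exponent for which the lattice sum converges.\<close>
      have "1 / (y - w) + 1 / w + y / w\<^sup>2 = y\<^sup>2 / (w\<^sup>2 * (y - w))"
        using nz by (simp add: field_simps power2_eq_square)
      also have "norm \<dots> = (norm y)\<^sup>2 / ((norm w)\<^sup>2 * norm (y - w))"
        by (simp add: norm_divide norm_mult norm_power)
      also have "\<dots> \<le> (norm z + r)\<^sup>2 / ((norm w)\<^sup>2 * (c * norm w))"
        using rc w y nz by (intro frac_le mult_left_mono power_mono mult_pos_pos) auto
      also have "\<dots> = (norm z + r)\<^sup>2 / c * (1 / norm w ^ 3)"
        by (simp add: power2_eq_square power3_eq_cube)
      finally show "norm (1 / (y - w) + 1 / w + y / w\<^sup>2) \<le> (norm z + r)\<^sup>2 / c * (1 / norm w ^ 3)" .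
    qed (use rc in auto)
  qed
  note * = infsum_field_derivative[OF D der M, of z, simplified]
  have "(zeta_reg has_field_derivative (\<Sum>\<^sub>\<infinity>w\<in>L - {0}. - (1 / (z - w)\<^sup>2 - 1 / w\<^sup>2))) (at z)"
    using *(1) z unfolding zeta_reg_def[abs_def] by auto
  then show "(zeta_reg has_field_derivative - p_reg z) (at z)"
    unfolding p_reg_def by (subst (asm) infsum_uminus)
qed

lemma p_reg_derivative:
  assumes z: "z \<notin> L - {0}"
  shows "(p_reg has_field_derivative (\<Sum>\<^sub>\<infinity>w\<in>L - {0}. - 2 / (z - w) ^ 3)) (at z)"
    and "(\<lambda>w. - 2 / (z - w) ^ 3) summable_on (L - {0})"
proof -
  have D: "open (- (L - {0}))" by (intro open_Compl closed_subset_lattice) auto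
  have der: "((\<lambda>z. 1 / (z - w)\<^sup>2 - 1 / w\<^sup>2) has_field_derivative - 2 / (z - w) ^ 3) (at z)"
    if "w \<in> L - {0}" "z \<in> - (L - {0})" for w z
  proof -
    have "((\<lambda>u. 1 / u\<^sup>2) has_field_derivative - 2 / (z - w) ^ 3) (at (z - w))"
      using that by (intro inverse_square_derivative) auto
    then have "((\<lambda>z. 1 / (z - w)\<^sup>2) has_field_derivative - 2 / (z - w) ^ 3 * 1) (at z)"
      by (rule DERIV_chain2) (auto intro!: derivative_eq_intros)
    from DERIV_diff[OF this DERIV_const[of "1 / w\<^sup>2"]] show ?thesis by simp
  qed
  have M: "\<exists>r>0. \<exists>M. cball z r \<subseteq> - (L - {0}) \<and> M summable_on (L - {0}) \<and>
       (\<forall>w\<in>L - {0}. \<forall>y\<in>cball z r. norm (1 / (y - w)\<^sup>2 - 1 / w\<^sup>2) \<le> M w)" if z: "z \<in> - (L - {0})" for z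
  proof -
    from z have "z \<notin> L - {0}" by blast
    then obtain r c where rc: "r > 0" "c > 0" "cball z r \<subseteq> - (L - {0})" "\<And>w y. w \<in> L - {0} \<Longrightarrow> y \<in> cball z r \<Longrightarrow> norm (y - w) \<ge> c * norm w"
      "\<And>y. y \<in> cball z r \<Longrightarrow> norm y \<le> norm z + r" using lattice_separation by metis
    show ?thesis
    proof (intro exI conjI ballI)
      show "(\<lambda>w. (norm z + r) / c * (1 + 1 / c) * (1 / norm w ^ 3)) summable_on (L - {0})"
        by (intro summable_on_cmult_right summable_lattice)
      fix w y assume w: "w \<in> L - {0}" and y: "y \<in> cball z r"
      have nz: "y - w \<noteq> 0" "w \<noteq> 0" "norm w > 0" using w y rc(3) by auto
      \<comment> \<open>A difference of two squares, with the factor 1/(y - w) + 1/w already brought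
        to a common denominator; this exposes the decay |w|^(-3).\<close>
      have "1 / (y - w)\<^sup>2 - 1 / w\<^sup>2 = y / (w * (y - w)) * (1 / (y - w) - 1 / w)"
        using nz by (simp add: divide_simps) (simp add: power2_eq_square algebra_simps)
      also have "norm \<dots> \<le> norm y / (norm w * norm (y - w)) * (1 / norm w + 1 / norm (y - w))"
        unfolding norm_mult norm_divide
        by (intro mult_left_mono order_trans[OF norm_triangle_ineq4]) (auto simp: norm_divide)
      also have "\<dots> \<le> (norm z + r) / (norm w * (c * norm w)) * (1 / norm w + 1 / (c * norm w))"
        using rc w y nz by (intro frac_le mult_left_mono mult_mono add_left_mono mult_pos_pos) auto
      also have "\<dots> = (norm z + r) / c * (1 + 1 / c) * (1 / norm w ^ 3)"
        using nz rc by (simp add: divide_simps power3_eq_cube)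
      finally show "norm (1 / (y - w)\<^sup>2 - 1 / w\<^sup>2) \<le> (norm z + r) / c * (1 + 1 / c) * (1 / norm w ^ 3)" .
    qed (use rc in auto)
  qed
  note * = infsum_field_derivative[OF D der M, of z, simplified]
  show "(\<lambda>w. - 2 / (z - w) ^ 3) summable_on (L - {0})"
    using *(2) z by auto
  show "(p_reg has_field_derivative (\<Sum>\<^sub>\<infinity>w\<in>L - {0}. - 2 / (z - w) ^ 3)) (at z)"
    using *(1) z unfolding p_reg_def[abs_def] by auto
qed


lemma weierstrass_zeta_eq: "\<zeta> z = 1 / z + zeta_reg z"
  by (simp add: weierstrass_zeta_def zeta_reg_def)

lemma weierstrass_p_eq: "wp z = 1 / z\<^sup>2 + p_reg z"
  by (simp add: weierstrass_p_def p_reg_def)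

text \<open>The derivative of \<open>wp\<close> as a sum over the whole lattice, without correction
  terms. In this form translation by a lattice vector is a mere reindexing, which fails for the
  series of \<open>wp\<close> itself.\<close>

definition p_deriv :: "complex \<Rightarrow> complex" where
  "p_deriv z = (\<Sum>\<^sub>\<infinity>w\<in>L. - 2 / (z - w) ^ 3)"

lemma weierstrass_zeta_derivative: "z \<notin> L \<Longrightarrow> (\<zeta> has_field_derivative - wp z) (at z)"
  unfolding weierstrass_zeta_eq[abs_def] weierstrass_p_eq
  using zero_in_lattice by (auto intro!: derivative_eq_intros zeta_reg_derivative simp: power2_eq_square)

lemma weierstrass_p_derivative: "z \<notin> L \<Longrightarrow> (wp has_field_derivative p_deriv z) (at z)"
proof -
  assume z: "z \<notin> L"
  have "((\<lambda>z. 1 / z\<^sup>2 + p_reg z) has_field_derivative - 2 / z ^ 3 + (\<Sum>\<^sub>\<infinity>w\<in>L - {0}. - 2 / (z - w) ^ 3)) (at z)"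
    using z zero_in_lattice by (intro derivative_intros p_reg_derivative inverse_square_derivative) auto
  moreover have "p_deriv z = - 2 / z ^ 3 + (\<Sum>\<^sub>\<infinity>w\<in>L - {0}. - 2 / (z - w) ^ 3)"
  proof -
    have "(\<lambda>w. - 2 / (z - w) ^ 3) summable_on (L - {0})"
      using z by (intro p_reg_derivative) auto
    from infsum_insert[OF this, of 0] show ?thesis
      using zero_in_lattice by (simp add: p_deriv_def insert_absorb)
  qed
  ultimately show ?thesis by (simp add: weierstrass_p_eq[abs_def])
qed

section \<open>Parity and (quasi-)periodicity\<close>

lemma bij_uminus_lattice: "bij_betw uminus (L - {0}) (L - {0})"
  by (rule bij_betwI[of _ _ _ uminus]) auto

lemma weierstrass_zeta_minus: "\<zeta> (- z) = - \<zeta> z"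
proof -
  have "zeta_reg (- z) = (\<Sum>\<^sub>\<infinity>w\<in>L - {0}. 1 / (- z - (- w)) + 1 / (- w) + (- z) / (- w)\<^sup>2)"
    unfolding zeta_reg_def by (rule infsum_reindex_bij_betw[OF bij_uminus_lattice, symmetric])
  also have "\<dots> = (\<Sum>\<^sub>\<infinity>w\<in>L - {0}. - (1 / (z - w) + 1 / w + z / w\<^sup>2))"
  proof (rule infsum_cong)
    fix w
    have "- z - (- w) = - (z - w)" by simp
    then show "1 / (- z - (- w)) + 1 / (- w) + (- z) / (- w)\<^sup>2 = - (1 / (z - w) + 1 / w + z / w\<^sup>2)"
      by (simp only: divide_minus_right) simp
  qed
  also have "\<dots> = - zeta_reg z" unfolding zeta_reg_def by (rule infsum_uminus)
  finally show ?thesis by (simp add: weierstrass_zeta_eq)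
qed

lemma weierstrass_p_minus: "wp (- z) = wp z"
proof -
  have "p_reg (- z) = (\<Sum>\<^sub>\<infinity>w\<in>L - {0}. 1 / (- z - (- w))\<^sup>2 - 1 / (- w)\<^sup>2)"
    unfolding p_reg_def by (rule infsum_reindex_bij_betw[OF bij_uminus_lattice, symmetric])
  also have "\<dots> = p_reg z"
    unfolding p_reg_def by (rule infsum_cong) (simp add: power2_commute)
  finally show ?thesis by (simp add: weierstrass_p_eq)
qed

lemma p_deriv_minus: "p_deriv (- z) = - p_deriv z"
proof -
  have "p_deriv (- z) = (\<Sum>\<^sub>\<infinity>w\<in>L. - 2 / (- z - (- w)) ^ 3)"
    unfolding p_deriv_def
    by (rule infsum_reindex_bij_betw[symmetric], rule bij_betwI[of _ _ _ uminus]) auto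
  also have "\<dots> = (\<Sum>\<^sub>\<infinity>w\<in>L. - (- 2 / (z - w) ^ 3))"
  proof (rule infsum_cong)
    fix w
    have "(- z - (- w)) ^ 3 = - ((z - w) ^ 3)" by (simp add: power3_eq_cube algebra_simps)
    then show "- 2 / (- z - (- w)) ^ 3 = - (- 2 / (z - w) ^ 3)" by simp
  qed
  also have "\<dots> = - p_deriv z" unfolding p_deriv_def by (rule infsum_uminus)
  finally show ?thesis .
qed

lemma p_deriv_periodic:
  assumes "\<omega> \<in> L" shows "p_deriv (z + \<omega>) = p_deriv z"
proof -
  have "p_deriv (z + \<omega>) = (\<Sum>\<^sub>\<infinity>w\<in>L. - 2 / (z + \<omega> - (w + \<omega>)) ^ 3)"
    unfolding p_deriv_def
    by (rule infsum_reindex_bij_betw[symmetric], rule bij_betwI[of _ _ _ "\<lambda>w. w - \<omega>"])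
       (use assms lattice_add_iff[OF assms] lattice_add_iff[OF lattice_uminus[OF assms]] in auto)
  then show ?thesis by (simp add: p_deriv_def)
qed

lemma open_compl_lattice: "open (- L)"
  by (intro open_Compl closed_subset_lattice) auto

lemma connected_compl_lattice: "connected (- L)"
  unfolding Compl_eq_Diff_UNIV
  by (rule connected_open_diff_countable) (auto simp: lattice_eq_image)

text \<open>Periodicity of \<open>p_deriv\<close> makes the difference constant on the connected
  complement of the lattice. At z = -\<omega>/2 the difference vanishes because \<open>wp\<close> is
  even; the choice of this point requires the half period to lie off the lattice.\<close>

lemma weierstrass_p_periodic_generator:
  assumes \<omega>: "\<omega> = \<omega>\<^sub>1 \<or> \<omega> = \<omega>\<^sub>2 \<or> \<omega> = - \<omega>\<^sub>1" and z: "z \<notin> L"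
  shows "wp (z + \<omega>) = wp z"
proof -
  have \<omega>L: "\<omega> \<in> L" using \<omega> periods_in_lattice by auto
  have h: "\<omega> / 2 \<notin> L" using half_period_notin[OF \<omega>] .
  have "wp (z + \<omega>) - wp z = wp (- (\<omega> / 2) + \<omega>) - wp (- (\<omega> / 2))"
  proof (rule constant_on_connected_derivative_zero[where f = "\<lambda>z. wp (z + \<omega>) - wp z", OF open_compl_lattice connected_compl_lattice])
    fix y assume "y \<in> - L"
    then have "((\<lambda>z. wp (z + \<omega>) - wp z) has_field_derivative p_deriv (y + \<omega>) - p_deriv y) (at y)"
      using lattice_add_iff[OF \<omega>L]
      by (intro DERIV_diff[OF DERIV_shift[THEN iffD1]] weierstrass_p_derivative) auto
    then show "((\<lambda>z. wp (z + \<omega>) - wp z) has_field_derivative 0) (at y)"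
      using p_deriv_periodic[OF \<omega>L] by simp
  qed (use z h in \<open>auto simp del: minus_divide_left\<close>)
  also have "- (\<omega> / 2) + \<omega> = \<omega> / 2" by simp
  finally show ?thesis by (simp add: weierstrass_p_minus del: minus_divide_left)
qed

text \<open>The same evaluation at -\<omega>/2, now with an odd function: the two terms add up to
  twice the value at \<omega>/2 instead of cancelling.\<close>

lemma weierstrass_zeta_quasiperiodic:
  assumes \<omega>: "\<omega> = \<omega>\<^sub>1 \<or> \<omega> = - \<omega>\<^sub>1" and z: "z \<notin> L"
  shows "\<zeta> (z + \<omega>) - \<zeta> z = 2 * \<zeta> (\<omega> / 2)"
proof -
  have \<omega>L: "\<omega> \<in> L" using \<omega> periods_in_lattice by auto
  have h: "\<omega> / 2 \<notin> L" using half_period_notin \<omega> by blast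
  have "\<zeta> (z + \<omega>) - \<zeta> z = \<zeta> (- (\<omega> / 2) + \<omega>) - \<zeta> (- (\<omega> / 2))"
  proof (rule constant_on_connected_derivative_zero[where f = "\<lambda>z. \<zeta> (z + \<omega>) - \<zeta> z", OF open_compl_lattice connected_compl_lattice])
    fix y assume y: "y \<in> - L"
    then have "((\<lambda>z. \<zeta> (z + \<omega>) - \<zeta> z) has_field_derivative - wp (y + \<omega>) - (- wp y)) (at y)"
      using lattice_add_iff[OF \<omega>L]
      by (intro DERIV_diff[OF DERIV_shift[THEN iffD1]] weierstrass_zeta_derivative) auto
    then show "((\<lambda>z. \<zeta> (z + \<omega>) - \<zeta> z) has_field_derivative 0) (at y)"
      using weierstrass_p_periodic_generator[of \<omega> y] \<omega> y by auto
  qed (use z h in \<open>auto simp del: minus_divide_left\<close>)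
  also have "- (\<omega> / 2) + \<omega> = \<omega> / 2" by simp
  finally show ?thesis by (simp add: weierstrass_zeta_minus del: minus_divide_left)
qed

lemma weierstrass_p_periodic:
  assumes "w \<in> L" "z \<notin> L" shows "wp (z + w) = wp z"
proof -
  have nat: "wp (y + of_nat n * \<omega>) = wp y" if "\<omega> = \<omega>\<^sub>1 \<or> \<omega> = \<omega>\<^sub>2" "y \<notin> L" for n \<omega> y
  proof (induction n)
    case (Suc n)
    have "of_nat n * \<omega> \<in> L"
      using that(1) zero_in_lattice periods_in_lattice by (induction n) (auto simp: algebra_simps intro: lattice_add)
    then have "y + of_nat n * \<omega> \<notin> L" using that(2) lattice_add_iff by auto
    then show ?case using weierstrass_p_periodic_generator[of \<omega> "y + of_nat n * \<omega>"] that Suc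
      by (auto simp: algebra_simps)
  qed auto
  have int: "wp (y + of_int n * \<omega>) = wp y" if \<omega>: "\<omega> = \<omega>\<^sub>1 \<or> \<omega> = \<omega>\<^sub>2" and y: "y \<notin> L" for n \<omega> y
  proof (cases n rule: int_cases2)
    case (nonneg k)
    then show ?thesis using nat[OF that] by simp
  next
    case (nonpos k)
    have "of_nat k * \<omega> \<in> L"
      using \<omega> zero_in_lattice periods_in_lattice by (induction k) (auto simp: algebra_simps intro: lattice_add)
    then have "y - of_nat k * \<omega> \<notin> L" using y lattice_add_iff[OF lattice_uminus, of "of_nat k * \<omega>" y] by auto
    from nat[OF \<omega> this, of k] show ?thesis using nonpos by simp
  qed
  obtain m n where w: "w = of_int m * \<omega>\<^sub>1 + of_int n * \<omega>\<^sub>2"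
    using assms(1) by (auto simp: period_lattice_def)
  have "of_int m * \<omega>\<^sub>1 = of_int m * \<omega>\<^sub>1 + of_int 0 * \<omega>\<^sub>2" by simp
  then have "of_int m * \<omega>\<^sub>1 \<in> L" unfolding period_lattice_def by blast
  then have "z + of_int m * \<omega>\<^sub>1 \<notin> L" using assms(2) lattice_add_iff by auto
  then show ?thesis
    using int[of \<omega>\<^sub>2 "z + of_int m * \<omega>\<^sub>1" n] int[of \<omega>\<^sub>1 z m] assms(2) by (simp add: w add.assoc)
qed

text \<open>At the origin the summand \<open>p_reg\<close> stays bounded and cannot compensate
  1/u^2; periodicity moves the statement to the other lattice points. It later prevents a lifted
  path from running into the lattice.\<close>

lemma weierstrass_p_pole:
  assumes "w \<in> L" shows "filterlim wp at_infinity (at w)"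
proof -
  have "isCont p_reg 0" using p_reg_derivative(1)[of 0] by (auto intro: DERIV_isCont)
  then have "filterlim (\<lambda>u. 1 / u\<^sup>2 + p_reg u) at_infinity (at 0)"
    by (intro tendsto_add_filterlim_at_infinity'[where c = "p_reg 0"])
       (auto simp: isCont_def intro!: filterlim_divide_at_infinity[where c = 1] filterlim_atI tendsto_eq_intros eventually_at_filter[THEN iffD2])
  then have "filterlim wp at_infinity (at 0)" by (simp add: weierstrass_p_eq[abs_def])
  then have "filterlim (\<lambda>z. wp (z - w)) at_infinity (at w)"
    by (subst filterlim_at_to_0) simp
  then show ?thesis
  proof (rule filterlim_cong[OF refl refl, THEN iffD1, rotated])
    have "open (- (L - {w}))" by (intro open_Compl closed_subset_lattice) auto
    then have "\<forall>\<^sub>F z in at w. z \<notin> L"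
      unfolding eventually_at_topological by (intro exI[of _ "- (L - {w})"]) auto
    then show "\<forall>\<^sub>F z in at w. wp (z - w) = wp z"
    proof (rule eventually_mono)
      fix z assume "z \<notin> L"
      then show "wp (z - w) = wp z" using weierstrass_p_periodic[OF lattice_uminus[OF assms]] by auto
    qed
  qed
qed

lemma lattice_reduction:
  obtains w where "w \<in> L" "norm (z - w) \<le> norm \<omega>\<^sub>1 + norm \<omega>\<^sub>2"
proof -
  define \<tau> where "\<tau> = \<omega>\<^sub>2 / \<omega>\<^sub>1"
  define y where "y = Im (z / \<omega>\<^sub>1) / Im \<tau>"
  define x where "x = Re (z / \<omega>\<^sub>1) - y * Re \<tau>"
  have "y * Im \<tau> = Im (z / \<omega>\<^sub>1)" "Re (z / \<omega>\<^sub>1) = x + y * Re \<tau>"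
    using Im_ratio by (simp_all add: x_def y_def \<tau>_def)
  then have "z / \<omega>\<^sub>1 = of_real x + of_real y * \<tau>"
    by (simp add: complex_eq_iff)
  then have z: "z = of_real x * \<omega>\<^sub>1 + of_real y * \<omega>\<^sub>2"
    using period_nonzero by (simp add: \<tau>_def field_simps)
  define w where "w = of_int \<lfloor>x\<rfloor> * \<omega>\<^sub>1 + of_int \<lfloor>y\<rfloor> * \<omega>\<^sub>2"
  have "z - w = of_real (frac x) * \<omega>\<^sub>1 + of_real (frac y) * \<omega>\<^sub>2"
    by (simp add: z w_def frac_def algebra_simps)
  also have "norm \<dots> \<le> frac x * norm \<omega>\<^sub>1 + frac y * norm \<omega>\<^sub>2"
    by (rule order_trans[OF norm_triangle_ineq]) (simp add: norm_mult)
  also have "\<dots> \<le> 1 * norm \<omega>\<^sub>1 + 1 * norm \<omega>\<^sub>2"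
    by (intro add_mono mult_right_mono) (auto intro: less_imp_le frac_lt_1)
  finally show thesis using that[of w] by (auto simp: w_def period_lattice_def)
qed

text \<open>If the value \<open>d\<close> were omitted, 1/(wp - d), extended by 0 to the lattice,
  would be entire and periodic, hence bounded and constant by Liouville; but it vanishes on the
  lattice and nowhere else.\<close>

lemma weierstrass_p_surj: "\<exists>z. z \<notin> L \<and> wp z = d"
proof (rule ccontr)
  assume "\<not> ?thesis"
  then have ne: "wp z \<noteq> d" if "z \<notin> L" for z using that by blast
  define G where "G z = (if z \<in> L then 0 else 1 / (wp z - d))" for z
  have G_cong: "(G has_field_derivative D) (at z)" if "(f has_field_derivative D) (at z)" "open T" "z \<in> T" "\<And>y. y \<in> T \<Longrightarrow> f y = G y" for f D z T
    using has_field_derivative_transform_within_open[OF that] .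
  have "G field_differentiable at z" for z
  proof (cases "z \<in> L")
    case False
    then have "((\<lambda>z. 1 / (wp z - d)) has_field_derivative - p_deriv z / (wp z - d)\<^sup>2) (at z)"
      using ne[of z] by (auto intro!: derivative_eq_intros weierstrass_p_derivative simp: power2_eq_square)
    then have "(G has_field_derivative - p_deriv z / (wp z - d)\<^sup>2) (at z)"
      by (rule G_cong[OF _ open_compl_lattice]) (use False in \<open>auto simp: G_def\<close>)
    then show ?thesis by (auto simp: field_differentiable_def)
  next
    case True
    \<comment> \<open>Near a lattice point the quotient is multiplied through by u^2, which gives an
      expression visibly holomorphic at u = 0 with a double zero there.\<close>
    let ?g = "\<lambda>u. u\<^sup>2 / (1 + u\<^sup>2 * (p_reg u - d))"
    obtain D where D: "(p_reg has_field_derivative D) (at 0)" using p_reg_derivative(1)[of 0] by auto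
    have "(?g has_field_derivative 0) (at (z - z))"
      by (auto intro!: derivative_eq_intros D)
    then have "((\<lambda>y. ?g (y - z)) has_field_derivative 0 * 1) (at z)"
      by (rule DERIV_chain2) (auto intro!: derivative_eq_intros)
    then have "(G has_field_derivative 0 * 1) (at z)"
    proof (rule G_cong)
      show "open (- (L - {z}))" by (intro open_Compl closed_subset_lattice) auto
      fix y assume y: "y \<in> - (L - {z})"
      show "?g (y - z) = G y"
      proof (cases "y = z")
        case False
        then have yL: "y \<notin> L" using y by auto
        then have "wp y = wp (y - z)" using weierstrass_p_periodic[OF lattice_uminus[OF True] yL] by simp
        then have "G y = 1 / (1 / (y - z)\<^sup>2 + (p_reg (y - z) - d))" using yL by (simp add: G_def weierstrass_p_eq)
        also have "1 / (y - z)\<^sup>2 + (p_reg (y - z) - d) = (1 + (y - z)\<^sup>2 * (p_reg (y - z) - d)) / (y - z)\<^sup>2"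
          using False by (simp add: add_divide_distrib)
        finally show ?thesis by simp
      qed (use True in \<open>auto simp: G_def\<close>)
    qed auto
    then show ?thesis by (auto simp: field_differentiable_def)
  qed
  then have hol: "G holomorphic_on UNIV" by (simp add: holomorphic_on_def)
  have per: "G (z - w) = G z" if "w \<in> L" for z w
  proof (cases "z \<in> L")
    case True
    then show ?thesis using lattice_add[OF True lattice_uminus[OF that]] by (simp add: G_def)
  next
    case False
    then show ?thesis using lattice_add_iff[OF lattice_uminus[OF that], of z]
      weierstrass_p_periodic[OF lattice_uminus[OF that] False] by (simp add: G_def)
  qed
  have "compact (G ` cball 0 (norm \<omega>\<^sub>1 + norm \<omega>\<^sub>2))"
    by (intro compact_continuous_image holomorphic_on_imp_continuous_on holomorphic_on_subset[OF hol]) auto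
  moreover have "range G \<subseteq> G ` cball 0 (norm \<omega>\<^sub>1 + norm \<omega>\<^sub>2)"
  proof clarify
    fix z
    obtain w where "w \<in> L" "norm (z - w) \<le> norm \<omega>\<^sub>1 + norm \<omega>\<^sub>2" by (rule lattice_reduction)
    then show "G z \<in> G ` cball 0 (norm \<omega>\<^sub>1 + norm \<omega>\<^sub>2)"
      using per[of w z] by (metis imageI mem_cball_0)
  qed
  ultimately have "bounded (range G)" by (metis bounded_subset compact_imp_bounded)
  then have "G constant_on UNIV" using Liouville_theorem hol by blast
  then have "G (\<omega>\<^sub>1 / 2) = G 0" by (auto simp: constant_on_def)
  then show False using half_period_notin[of \<omega>\<^sub>1] zero_in_lattice ne[of "\<omega>\<^sub>1 / 2"] by (simp add: G_def)
qed

end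

section \<open>Periods over lifted loops\<close>

text \<open>The quotient is continuous with values in {1, -1}, hence constant on a connected set.
  Every comparison of branches and sheets below goes through this lemma.\<close>

lemma square_roots_agree:
  fixes a b :: "'a::topological_space \<Rightarrow> complex"
  assumes "connected X" "continuous_on X a" "continuous_on X b"
    and sq: "\<And>x. x \<in> X \<Longrightarrow> a x ^ 2 = b x ^ 2" and nz: "\<And>x. x \<in> X \<Longrightarrow> b x \<noteq> 0"
    and "x\<^sub>0 \<in> X" "a x\<^sub>0 = b x\<^sub>0" "x \<in> X"
  shows "a x = b x"
proof -
  have sg: "a x / b x \<in> {1, -1}" if "x \<in> X" for x
    using sq[OF that] nz[OF that] by (auto simp: power2_eq_iff)
  have "\<exists>c. \<forall>x\<in>X. a x / b x = c"
    unfolding constant_on_def[symmetric]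
  proof (rule continuous_finite_range_constant)
    show "continuous_on X (\<lambda>x. a x / b x)" using assms by (intro continuous_intros) auto
    show "finite ((\<lambda>x. a x / b x) ` X)" by (rule finite_subset[of _ "{1, -1}"]) (use sg in blast, simp)
  qed fact
  then obtain c where c: "\<And>x. x \<in> X \<Longrightarrow> a x / b x = c" by blast
  from c[OF assms(6)] c[OF assms(8)] have "a x / b x = a x\<^sub>0 / b x\<^sub>0" by (rule trans[OF _ sym, rotated])
  moreover have "a x\<^sub>0 / b x\<^sub>0 = 1" using assms(6,7) nz by simp
  ultimately show ?thesis using nz[of x] assms(8) by simp
qed

text \<open>On a disc without branch points the two-valued form d\<lambda>/\<rho> splits into two
  holomorphic forms, each with a primitive. The value \<open>w\<close> over the centre selects the
  sheet.\<close>

lemma local_branch_primitive: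
  assumes "P holomorphic_on ball z e" "\<And>x. x \<in> ball z e \<Longrightarrow> P x \<noteq> 0" "w ^ 2 = P z" "e > 0"
  obtains \<sigma> \<Psi> where "\<sigma> holomorphic_on ball z e" "\<And>x. x \<in> ball z e \<Longrightarrow> \<sigma> x ^ 2 = P x" "\<sigma> z = w"
    "\<And>x. x \<in> ball z e \<Longrightarrow> (\<Psi> has_field_derivative 1 / \<sigma> x) (at x)"
proof -
  obtain g where g: "g holomorphic_on ball z e" "\<And>x. x \<in> ball z e \<Longrightarrow> P x = g x ^ 2"
    using contractible_imp_holomorphic_sqrt[OF assms(1) convex_imp_contractible[OF convex_ball] assms(2)] by metis
  have "g z ^ 2 = w ^ 2" using g(2)[of z] assms by simp
  then consider "g z = w" | "- g z = w" by (auto simp: power2_eq_iff)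
  then obtain \<sigma> where \<sigma>: "\<sigma> holomorphic_on ball z e" "\<And>x. x \<in> ball z e \<Longrightarrow> \<sigma> x ^ 2 = P x" "\<sigma> z = w"
  proof cases
    case 1
    show ?thesis by (rule that[of g]) (use g 1 in auto)
  next
    case 2
    show ?thesis by (rule that[of "\<lambda>x. - g x"]) (use g 2 in \<open>auto intro: holomorphic_intros\<close>)
  qed
  have nz: "\<sigma> x \<noteq> 0" if "x \<in> ball z e" for x
    using \<sigma>(2)[OF that] assms(2)[OF that] by auto
  have "(\<lambda>x. 1 / \<sigma> x) holomorphic_on ball z e"
    by (intro holomorphic_intros \<sigma> nz)
  then obtain \<Psi> where "\<And>x. x \<in> ball z e \<Longrightarrow> (\<Psi> has_field_derivative 1 / \<sigma> x) (at x within ball z e)"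
    using holomorphic_convex_primitive'[of "ball z e" "\<lambda>x. 1 / \<sigma> x"] by auto
  then have "\<And>x. x \<in> ball z e \<Longrightarrow> (\<Psi> has_field_derivative 1 / \<sigma> x) (at x)"
    by (metis at_within_open open_ball)
  then show thesis using that \<sigma> by blast
qed

lemma lift_agrees_locally:
  assumes "continuous_on {0..1} g" "continuous_on {0..1} \<rho>" "\<And>t. t \<in> {0..1} \<Longrightarrow> \<rho> t ^ 2 = P (g t)"
    and \<sigma>: "\<sigma> holomorphic_on ball (g t\<^sub>0) e" "\<And>x. x \<in> ball (g t\<^sub>0) e \<Longrightarrow> \<sigma> x ^ 2 = P x" "\<sigma> (g t\<^sub>0) = \<rho> t\<^sub>0"
      "\<And>x. x \<in> ball (g t\<^sub>0) e \<Longrightarrow> P x \<noteq> 0"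
    and "t\<^sub>0 \<in> {0..1::real}" "e > 0"
  shows "\<exists>d>0. \<forall>t\<in>{0..1}. dist t t\<^sub>0 < d \<longrightarrow> g t \<in> ball (g t\<^sub>0) e \<and> \<sigma> (g t) = \<rho> t"
proof -
  obtain d where d: "d > 0" "\<And>t. t \<in> {0..1} \<Longrightarrow> dist t t\<^sub>0 < d \<Longrightarrow> dist (g t) (g t\<^sub>0) < e"
    using assms(1,8,9) unfolding continuous_on_iff by blast
  let ?X = "{0..1} \<inter> ball t\<^sub>0 d"
  have gX: "g t \<in> ball (g t\<^sub>0) e" if "t \<in> ?X" for t
    using d(2)[of t] that by (auto simp: dist_commute)
  have "\<sigma> (g t) = \<rho> t" if "t \<in> ?X" for t
  proof (rule square_roots_agree[where X = ?X and x\<^sub>0 = t\<^sub>0])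
    show "connected ?X" by (intro convex_connected convex_Int) auto
    have "continuous_on ?X g" using assms(1) by (rule continuous_on_subset) auto
    then show "continuous_on ?X (\<lambda>t. \<sigma> (g t))"
      using gX by (intro continuous_on_compose2[OF holomorphic_on_imp_continuous_on[OF \<sigma>(1)]]) auto
    show "continuous_on ?X \<rho>" using assms(2) by (rule continuous_on_subset) auto
    show "\<sigma> (g t) ^ 2 = \<rho> t ^ 2" if "t \<in> ?X" for t
      using \<sigma>(2)[OF gX[OF that]] assms(3)[of t] that by auto
    show "\<rho> t \<noteq> 0" if "t \<in> ?X" for t
      using \<sigma>(4)[OF gX[OF that]] assms(3)[of t] that by auto
  qed (use that d assms in auto)
  then show ?thesis using d(1) gX by (intro exI[of _ d]) (auto simp: dist_commute)
qed

lemma valid_path_has_derivative: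
  assumes "valid_path g"
  obtains S where "finite S"
    "\<And>t. t \<in> {0<..<1} - S \<Longrightarrow> (g has_vector_derivative vector_derivative g (at t within {0..1})) (at t)"
proof -
  obtain S where S: "finite S" "g C1_differentiable_on {0..1} - S"
    using assms unfolding valid_path_def piecewise_C1_differentiable_on_def by auto
  show thesis
  proof (rule that[OF S(1)])
    fix t assume t: "t \<in> {0<..<1} - S"
    then have "g differentiable at t" using S(2) unfolding C1_differentiable_on_eq by auto
    then have *: "(g has_vector_derivative vector_derivative g (at t)) (at t)"
      by (simp add: vector_derivative_works)
    then have "vector_derivative g (at t within {0..1}) = vector_derivative g (at t)"
      using t by (intro vector_derivative_at_within_ivl) auto
    then show "(g has_vector_derivative vector_derivative g (at t within {0..1})) (at t)"
      using * by simp
  qed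
qed

text \<open>The integral inside \<open>cycle_period\<close> with the lift as an argument, so that
  lifts can be followed through a deformation before the choice by \<open>SOME\<close> is dealt
  with.\<close>

definition lift_integral :: "(real \<Rightarrow> complex) \<Rightarrow> (real \<Rightarrow> complex) \<Rightarrow> complex" where
  "lift_integral g \<rho> = integral {0..1} (\<lambda>t. vector_derivative g (at t within {0..1}) / \<rho> t)"

text \<open>The derivative of a valid path may be unbounded near the exceptional points, so
  integrability comes from local primitives.\<close>

lemma lift_integrable:
  assumes g: "valid_path g" "path_image g \<subseteq> D" and \<rho>: "lifts_to_curve P g \<rho>"
    and D: "open D" "P holomorphic_on D" "\<And>x. x \<in> D \<Longrightarrow> P x \<noteq> 0"
  shows "(\<lambda>t. vector_derivative g (at t within {0..1}) / \<rho> t) integrable_on {0..1}"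
proof -
  obtain S where S: "finite S"
    "\<And>t. t \<in> {0<..<1} - S \<Longrightarrow> (g has_vector_derivative vector_derivative g (at t within {0..1})) (at t)"
    using valid_path_has_derivative[OF g(1)] by metis
  have cg: "continuous_on {0..1} g" using valid_path_imp_path[OF g(1)] by (simp add: path_def)
  have c\<rho>: "continuous_on {0..1} \<rho>" and sq: "\<And>t. t \<in> {0..1} \<Longrightarrow> \<rho> t ^ 2 = P (g t)"
    using \<rho> by (auto simp: lifts_to_curve_def path_def)
  let ?f = "\<lambda>t. vector_derivative g (at t within {0..1}) / \<rho> t"
  have "\<exists>d>0. \<forall>u v. t\<^sub>0 \<in> cbox u v \<and> cbox u v \<subseteq> ball t\<^sub>0 d \<and> cbox u v \<subseteq> cbox 0 1 \<longrightarrow> ?f integrable_on cbox u v"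
    if t0: "t\<^sub>0 \<in> cbox 0 1" for t\<^sub>0
  proof -
    have "g t\<^sub>0 \<in> D" using g(2) t0 by (auto simp: path_image_def)
    then obtain e where e: "e > 0" "ball (g t\<^sub>0) e \<subseteq> D" using D(1) open_contains_ball by blast
    obtain \<sigma> \<Psi> where \<sigma>: "\<sigma> holomorphic_on ball (g t\<^sub>0) e" "\<And>x. x \<in> ball (g t\<^sub>0) e \<Longrightarrow> \<sigma> x ^ 2 = P x" "\<sigma> (g t\<^sub>0) = \<rho> t\<^sub>0"
      "\<And>x. x \<in> ball (g t\<^sub>0) e \<Longrightarrow> (\<Psi> has_field_derivative 1 / \<sigma> x) (at x)"
      using local_branch_primitive[of P "g t\<^sub>0" e "\<rho> t\<^sub>0"] e D sq[of t\<^sub>0] t0 holomorphic_on_subset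
      by (metis (no_types, lifting) box_real(2) subsetD)
    have "\<exists>d>0. \<forall>t\<in>{0..1}. dist t t\<^sub>0 < d \<longrightarrow> g t \<in> ball (g t\<^sub>0) e \<and> \<sigma> (g t) = \<rho> t"
      by (rule lift_agrees_locally[OF cg c\<rho> sq \<sigma>(1-3)]) (use e D t0 in auto)
    then obtain d where d: "d > 0" "\<forall>t\<in>{0..1}. dist t t\<^sub>0 < d \<longrightarrow> g t \<in> ball (g t\<^sub>0) e \<and> \<sigma> (g t) = \<rho> t"
      by blast
    show ?thesis
    proof (intro exI[of _ d] conjI allI impI d(1), elim conjE)
      fix u v assume uv: "t\<^sub>0 \<in> cbox u v" "cbox u v \<subseteq> ball t\<^sub>0 d" "cbox u v \<subseteq> cbox 0 1"
      have t: "g t \<in> ball (g t\<^sub>0) e" "\<sigma> (g t) = \<rho> t" if "t \<in> {u..v}" for t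
        using d(2) uv that by (auto simp: subset_iff dist_commute)
      have uv': "u \<le> v" "0 \<le> u" "v \<le> 1" using uv by auto
      have "(?f has_integral (\<Psi> (g v) - \<Psi> (g u))) {u..v}"
      proof (rule fundamental_theorem_of_calculus_interior_strong[OF S(1) uv'(1), of "\<lambda>t. \<Psi> (g t)"])
        fix t assume t': "t \<in> {u<..<v} - S"
        then have "((\<Psi> \<circ> g) has_vector_derivative vector_derivative g (at t within {0..1}) * (1 / \<sigma> (g t))) (at t)"
          using uv' by (intro field_vector_diff_chain_at S \<sigma>(4) t) auto
        then show "((\<lambda>t. \<Psi> (g t)) has_vector_derivative ?f t) (at t)"
          using t(2)[of t] t' by (simp add: o_def)
      next
        have "continuous_on (ball (g t\<^sub>0) e) \<Psi>"
          by (rule DERIV_continuous_on) (use \<sigma>(4) has_field_derivative_at_within in blast)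
        then show "continuous_on {u..v} (\<lambda>t. \<Psi> (g t))"
          using t(1) uv' by (intro continuous_on_compose2[of _ \<Psi> _ g] continuous_on_subset[OF cg]) auto
      qed
      then show "?f integrable_on cbox u v" by (auto simp: integrable_on_def)
    qed
  qed
  then show ?thesis using integrable_on_little_subintervals[of 0 1 ?f] by simp
qed

text \<open>Over the disc around \<open>g t\<close> the lift extends to a branch
  \<open>\<sigma> t\<close> with primitive \<open>\<Psi> t\<close>. The new lift is this branch at
  \<open>h t\<close>, and \<open>E t\<close> is the integral of the form from \<open>g t\<close> to
  \<open>h t\<close> inside the disc, independent of the additive constant in
  \<open>\<Psi> t\<close>. The derivative of \<open>E\<close> is the difference of the two
  integrands, and \<open>E\<close> takes equal values at 0 and 1 because the loops and the lift
  close up.\<close>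

lemma lift_nearby_loop:
  assumes g: "valid_path g" "pathfinish g = pathstart g" and h: "valid_path h" "pathfinish h = pathstart h"
    and \<rho>: "lifts_to_curve P g \<rho>"
    and D: "open D" "P holomorphic_on D" "\<And>x. x \<in> D \<Longrightarrow> P x \<noteq> 0"
    and e: "e > 0" "\<And>t. t \<in> {0..1} \<Longrightarrow> ball (g t) e \<subseteq> D" "\<And>t. t \<in> {0..1} \<Longrightarrow> dist (g t) (h t) < e"
  obtains \<rho>' where "lifts_to_curve P h \<rho>'" "lift_integral h \<rho>' = lift_integral g \<rho>"
proof -
  have cg: "continuous_on {0..1} g" using valid_path_imp_path[OF g(1)] by (simp add: path_def)
  have ch: "continuous_on {0..1} h" using valid_path_imp_path[OF h(1)] by (simp add: path_def)
  have c\<rho>: "continuous_on {0..1} \<rho>" and sq: "\<And>t. t \<in> {0..1} \<Longrightarrow> \<rho> t ^ 2 = P (g t)" and closed: "\<rho> 1 = \<rho> 0"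
    using \<rho> by (auto simp: lifts_to_curve_def path_def pathstart_def pathfinish_def)
  have ends: "g 1 = g 0" "h 1 = h 0" using g(2) h(2) by (auto simp: pathstart_def pathfinish_def)
  have PD: "P holomorphic_on ball (g t) e" "\<And>x. x \<in> ball (g t) e \<Longrightarrow> P x \<noteq> 0" if "t \<in> {0..1}" for t
    using D e(2)[OF that] holomorphic_on_subset by blast+
  have "\<forall>t\<in>{0..1}. \<exists>\<sigma> \<Psi>. \<sigma> holomorphic_on ball (g t) e \<and> (\<forall>x \<in> ball (g t) e. \<sigma> x ^ 2 = P x) \<and> \<sigma> (g t) = \<rho> t \<and>
      (\<forall>x\<in>ball (g t) e. (\<Psi> has_field_derivative 1 / \<sigma> x) (at x))"
  proof
    fix t :: real assume t: "t \<in> {0..1}"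
    show "\<exists>\<sigma> \<Psi>. \<sigma> holomorphic_on ball (g t) e \<and> (\<forall>x \<in> ball (g t) e. \<sigma> x ^ 2 = P x) \<and> \<sigma> (g t) = \<rho> t \<and>
      (\<forall>x\<in>ball (g t) e. (\<Psi> has_field_derivative 1 / \<sigma> x) (at x))"
      using local_branch_primitive[OF PD(1)[OF t] PD(2)[OF t] sq[OF t] e(1)] by metis
  qed
  then obtain \<sigma> \<Psi> where "\<And>t. t \<in> {0..1} \<Longrightarrow> \<sigma> t holomorphic_on ball (g t) e \<and> (\<forall>x \<in> ball (g t) e. \<sigma> t x ^ 2 = P x) \<and> \<sigma> t (g t) = \<rho> t \<and>
      (\<forall>x\<in>ball (g t) e. (\<Psi> t has_field_derivative 1 / \<sigma> t x) (at x))"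
    by metis
  then have \<sigma>: "\<And>t. t \<in> {0..1} \<Longrightarrow> \<sigma> t holomorphic_on ball (g t) e"
    "\<And>t x. t \<in> {0..1} \<Longrightarrow> x \<in> ball (g t) e \<Longrightarrow> \<sigma> t x ^ 2 = P x" "\<And>t. t \<in> {0..1} \<Longrightarrow> \<sigma> t (g t) = \<rho> t"
    "\<And>t x. t \<in> {0..1} \<Longrightarrow> x \<in> ball (g t) e \<Longrightarrow> (\<Psi> t has_field_derivative 1 / \<sigma> t x) (at x)"
    by auto
  define \<rho>' where "\<rho>' t = \<sigma> t (h t)" for t
  define E where "E t = \<Psi> t (h t) - \<Psi> t (g t)" for t
  \<comment> \<open>The branches and primitives were picked for each t separately, with no
    continuity in t. On the convex intersection of two discs the branches coincide and the
    primitives differ by a constant, so near \<open>s\<close> the choice made at \<open>s\<close>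
    may be used throughout.\<close>
  have agree: "\<sigma> s (h t) = \<rho>' t \<and> E t = \<Psi> s (h t) - \<Psi> s (g t)"
    if st: "s \<in> {0..1}" "t \<in> {0..1}" and gt: "g t \<in> ball (g s) e" "\<sigma> s (g t) = \<rho> t" and ht: "h t \<in> ball (g s) e" for s t
  proof -
    let ?X = "ball (g s) e \<inter> ball (g t) e"
    have cX: "convex ?X" by (intro convex_Int) auto
    have in_X: "g t \<in> ?X" "h t \<in> ?X" using gt ht e st by auto
    have eq: "\<sigma> s x = \<sigma> t x" if "x \<in> ?X" for x
    proof (rule square_roots_agree[where X = ?X and x\<^sub>0 = "g t" and a = "\<sigma> s" and b = "\<sigma> t"])
      show "continuous_on ?X (\<sigma> s)" "continuous_on ?X (\<sigma> t)"
        using \<sigma>(1)[OF st(1)] \<sigma>(1)[OF st(2)] by (meson Int_lower1 Int_lower2 continuous_on_subset holomorphic_on_imp_continuous_on)+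
      show "\<sigma> s x ^ 2 = \<sigma> t x ^ 2" if "x \<in> ?X" for x using \<sigma>(2) st that by auto
      show "\<sigma> t x \<noteq> 0" if "x \<in> ?X" for x using \<sigma>(2)[OF st(2), of x] PD(2)[OF st(2), of x] that by auto
    qed (use in_X that gt \<sigma>(3)[OF st(2)] cX in \<open>auto intro: convex_connected\<close>)
    have "((\<lambda>x. \<Psi> t x - \<Psi> s x) has_field_derivative 0) (at x within ?X)" if "x \<in> ?X" for x
    proof -
      have "((\<lambda>x. \<Psi> t x - \<Psi> s x) has_field_derivative 1 / \<sigma> t x - 1 / \<sigma> s x) (at x within ?X)"
        using \<sigma>(4)[OF st(1), of x] \<sigma>(4)[OF st(2), of x] that
        by (intro DERIV_diff) (auto intro: has_field_derivative_at_within)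
      then show ?thesis using eq[OF that] by simp
    qed
    then obtain c where "\<And>x. x \<in> ?X \<Longrightarrow> \<Psi> t x - \<Psi> s x = c"
      using has_field_derivative_zero_constant[OF cX] by metis
    from this[OF in_X(1)] this[OF in_X(2)] show ?thesis
      using eq[OF in_X(2)] by (auto simp: \<rho>'_def E_def algebra_simps)
  qed
  have local: "\<exists>d>0. \<forall>t\<in>{0..1}. dist t s < d \<longrightarrow> g t \<in> ball (g s) e \<and> h t \<in> ball (g s) e \<and> \<sigma> s (g t) = \<rho> t \<and>
      \<sigma> s (h t) = \<rho>' t \<and> E t = \<Psi> s (h t) - \<Psi> s (g t)" if s: "s \<in> {0..1}" for s
  proof -
    have "\<exists>d>0. \<forall>t\<in>{0..1}. dist t s < d \<longrightarrow> g t \<in> ball (g s) e \<and> \<sigma> s (g t) = \<rho> t"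
      by (rule lift_agrees_locally[OF cg c\<rho> sq \<sigma>(1)[OF s] \<sigma>(2)[OF s] \<sigma>(3)[OF s] PD(2)[OF s] s e(1)])
    then obtain d where d: "d > 0" "\<forall>t\<in>{0..1}. dist t s < d \<longrightarrow> g t \<in> ball (g s) e \<and> \<sigma> s (g t) = \<rho> t"
      by blast
    have "e - dist (g s) (h s) > 0" using e(3)[OF s] by simp
    then obtain d' where d': "d' > 0" "\<And>t. t \<in> {0..1} \<Longrightarrow> dist t s < d' \<Longrightarrow> dist (h t) (h s) < e - dist (g s) (h s)"
      using ch s unfolding continuous_on_iff by blast
    show ?thesis
    proof (intro exI[of _ "min d d'"] conjI ballI impI)
      fix t assume t: "t \<in> {0..1}" "dist t s < min d d'"
      show gt: "g t \<in> ball (g s) e" "\<sigma> s (g t) = \<rho> t" using d(2) t by auto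
      have "dist (g s) (h t) \<le> dist (g s) (h s) + dist (h t) (h s)" by (metis dist_commute dist_triangle)
      then show ht: "h t \<in> ball (g s) e" using d'(2)[of t] t by auto
      show "\<sigma> s (h t) = \<rho>' t" "E t = \<Psi> s (h t) - \<Psi> s (g t)" using agree[OF s t(1) gt ht] by auto
    qed (use d d' in auto)
  qed
  have cl: "continuous_on {0..1} F" if F: "\<And>s. s \<in> {0..1} \<Longrightarrow> \<exists>d>0. \<exists>f. continuous (at s within {0..1}) f \<and> (\<forall>t\<in>{0..1}. dist t s < d \<longrightarrow> F t = f t)"
    for F :: "real \<Rightarrow> complex"
    unfolding continuous_on_eq_continuous_within
  proof
    fix s :: real assume s: "s \<in> {0..1}"
    then obtain d f where df: "d > 0" "continuous (at s within {0..1}) f" "\<And>t. t\<in>{0..1} \<Longrightarrow> dist t s < d \<Longrightarrow> F t = f t"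
      using F by blast
    show "continuous (at s within {0..1}) F"
      by (rule continuous_transform_within[OF df(2,1) s]) (use df(3) in auto)
  qed
  have cont_h: "continuous (at s within {0..1}) (\<lambda>t. f (h t))" "continuous (at s within {0..1}) (\<lambda>t. f (g t))"
    if "s \<in> {0..1}" "continuous_on (ball (g s) e) f" for s and f :: "complex \<Rightarrow> complex"
  proof -
    have "isCont f (h s)" "isCont f (g s)"
      using that e by (auto simp: continuous_on_eq_continuous_at)
    moreover have "continuous (at s within {0..1}) h" "continuous (at s within {0..1}) g"
      using ch cg that(1) by (auto simp: continuous_on_eq_continuous_within)
    ultimately show "continuous (at s within {0..1}) (\<lambda>t. f (h t))" "continuous (at s within {0..1}) (\<lambda>t. f (g t))"
      using continuous_within_compose3 by blast+
  qed
  have c\<rho>': "continuous_on {0..1} \<rho>'"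
  proof (rule cl)
    fix s :: real assume s: "s \<in> {0..1}"
    obtain d where "d > 0" "\<forall>t\<in>{0..1}. dist t s < d \<longrightarrow> \<sigma> s (h t) = \<rho>' t"
      using local[OF s] by (elim exE conjE) (rule that, auto)
    then show "\<exists>d>0. \<exists>f. continuous (at s within {0..1}) f \<and> (\<forall>t\<in>{0..1}. dist t s < d \<longrightarrow> \<rho>' t = f t)"
      using cont_h(1)[OF s holomorphic_on_imp_continuous_on[OF \<sigma>(1)[OF s]]]
      by (intro exI[of _ d] conjI exI[of _ "\<lambda>t. \<sigma> s (h t)"]) auto
  qed
  have c\<Psi>: "continuous_on (ball (g s) e) (\<Psi> s)" if "s \<in> {0..1}" for s
    by (rule DERIV_continuous_on) (use \<sigma>(4)[OF that] has_field_derivative_at_within in blast)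
  have cE: "continuous_on {0..1} E"
  proof (rule cl)
    fix s :: real assume s: "s \<in> {0..1}"
    have c: "continuous (at s within {0..1}) (\<lambda>t. \<Psi> s (h t) - \<Psi> s (g t))"
      by (intro continuous_diff cont_h s c\<Psi>)
    obtain d where "d > 0" "\<forall>t\<in>{0..1}. dist t s < d \<longrightarrow> E t = \<Psi> s (h t) - \<Psi> s (g t)"
      using local[OF s] by (elim exE conjE) (rule that, auto)
    then show "\<exists>d>0. \<exists>f. continuous (at s within {0..1}) f \<and> (\<forall>t\<in>{0..1}. dist t s < d \<longrightarrow> E t = f t)"
      using c by (intro exI[of _ d] conjI exI[of _ "\<lambda>t. \<Psi> s (h t) - \<Psi> s (g t)"]) auto
  qed
  have lifts: "lifts_to_curve P h \<rho>'"
    unfolding lifts_to_curve_def path_def pathstart_def pathfinish_def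
  proof (intro conjI ballI c\<rho>')
    show "\<rho>' 1 = \<rho>' 0" using agree[of 0 1] ends closed \<sigma>(3)[of 0] e(1) e(3)[of 0] by (simp add: \<rho>'_def)
    show "\<rho>' t ^ 2 = P (h t)" if "t \<in> {0..1}" for t using \<sigma>(2)[OF that] e(3)[OF that] by (simp add: \<rho>'_def)
  qed
  \<comment> \<open>The discs at the two ends have the same centre, and the closed lift selects the
    same sheet there.\<close>
  have "E 1 = E 0" using agree[of 0 1] ends closed \<sigma>(3)[of 0] e(1) e(3)[of 0] by (simp add: E_def)
  obtain S where S: "finite S"
    "\<And>t. t \<in> {0<..<1} - S \<Longrightarrow> (g has_vector_derivative vector_derivative g (at t within {0..1})) (at t)"
    using valid_path_has_derivative[OF g(1)] by metis
  obtain S' where S': "finite S'"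
    "\<And>t. t \<in> {0<..<1} - S' \<Longrightarrow> (h has_vector_derivative vector_derivative h (at t within {0..1})) (at t)"
    using valid_path_has_derivative[OF h(1)] by metis
  let ?g = "\<lambda>t. vector_derivative g (at t within {0..1}) / \<rho> t"
  let ?h = "\<lambda>t. vector_derivative h (at t within {0..1}) / \<rho>' t"
  have "((\<lambda>t. ?h t - ?g t) has_integral (E 1 - E 0)) {0..1}"
  proof (rule fundamental_theorem_of_calculus_interior_strong[of "S \<union> S'"])
    fix s assume s: "s \<in> {0<..<1} - (S \<union> S')"
    then have s01: "s \<in> {0..1}" by auto
    obtain d where d: "d > 0" "\<forall>t\<in>{0..1}. dist t s < d \<longrightarrow> E t = \<Psi> s (h t) - \<Psi> s (g t)"
      using local[OF s01] by (elim exE conjE) (rule that, auto)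
    have \<rho>'s: "\<sigma> s (h s) = \<rho>' s" by (simp add: \<rho>'_def)
    have "((\<Psi> s \<circ> h) has_vector_derivative vector_derivative h (at s within {0..1}) * (1 / \<sigma> s (h s))) (at s)"
      using s e(3)[OF s01] by (intro field_vector_diff_chain_at S' \<sigma>(4)) auto
    moreover have "((\<Psi> s \<circ> g) has_vector_derivative vector_derivative g (at s within {0..1}) * (1 / \<sigma> s (g s))) (at s)"
      using s e(1) by (intro field_vector_diff_chain_at S \<sigma>(4)) auto
    ultimately have "((\<lambda>t. \<Psi> s (h t) - \<Psi> s (g t)) has_vector_derivative ?h s - ?g s) (at s)"
      using \<rho>'s \<sigma>(3)[OF s01] by (auto dest: has_vector_derivative_diff simp: o_def)
    then show "(E has_vector_derivative ?h s - ?g s) (at s)"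
      by (rule has_vector_derivative_transform_within_open[of _ _ _ "{0<..<1} \<inter> ball s d"])
         (use s d in \<open>auto simp: dist_commute\<close>)
  qed (use S S' cE in auto)
  moreover have "path_image g \<subseteq> D" "path_image h \<subseteq> D"
    using e by (fastforce simp: path_image_def)+
  then have "?g integrable_on {0..1}" "?h integrable_on {0..1}"
    using lift_integrable[OF g(1) _ \<rho> D] lift_integrable[OF h(1) _ lifts D] by auto
  ultimately have "lift_integral h \<rho>' - lift_integral g \<rho> = E 1 - E 0"
    unfolding lift_integral_def by (simp add: integral_diff[symmetric] integral_unique)
  then show thesis using that[OF lifts] \<open>E 1 = E 0\<close> by simp
qed

section \<open>Invariance of the squared period\<close>

lemma lifts_unique:
  assumes "lifts_to_curve P g \<rho>" "lifts_to_curve P g \<rho>'" "\<And>t. t \<in> {0..1} \<Longrightarrow> P (g t) \<noteq> 0"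
  shows "(\<forall>t\<in>{0..1}. \<rho>' t = \<rho> t) \<or> (\<forall>t\<in>{0..1}. \<rho>' t = - \<rho> t)"
proof -
  have c: "continuous_on {0..1} \<rho>" "continuous_on {0..1} \<rho>'"
    and sq: "\<And>t. t \<in> {0..1} \<Longrightarrow> \<rho>' t ^ 2 = \<rho> t ^ 2"
    and nz: "\<And>t. t \<in> {0..1} \<Longrightarrow> \<rho> t \<noteq> 0"
    using assms unfolding lifts_to_curve_def path_def by fastforce+
  consider "\<rho>' 0 = \<rho> 0" | "\<rho>' 0 = - \<rho> 0" using sq[of 0] by (auto simp: power2_eq_iff)
  then show ?thesis
  proof cases
    case 1
    have "\<rho>' t = \<rho> t" if "t \<in> {0..1}" for t
      by (rule square_roots_agree[of "{0..1}" _ _ 0]) (use c sq nz 1 that in auto)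
    then show ?thesis by blast
  next
    case 2
    have "\<rho>' t = - \<rho> t" if "t \<in> {0..1}" for t
      by (rule square_roots_agree[of "{0..1}" _ _ 0]) (use c sq nz 2 that in \<open>auto intro: continuous_intros\<close>)
    then show ?thesis by blast
  qed
qed

text \<open>The lift picked by \<open>SOME\<close> is \<rho> or -\<rho>, and squaring removes the
  difference.\<close>

lemma cycle_period_square:
  assumes "lifts_to_curve P g \<rho>" "\<And>t. t \<in> {0..1} \<Longrightarrow> P (g t) \<noteq> 0"
  shows "(cycle_period P g)\<^sup>2 = (lift_integral g \<rho>)\<^sup>2"
proof -
  define \<rho>' where "\<rho>' = (SOME \<rho>. lifts_to_curve P g \<rho>)"
  have \<rho>': "lifts_to_curve P g \<rho>'" unfolding \<rho>'_def using assms(1) by (rule someI[of "lifts_to_curve P g"])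
  have cp: "cycle_period P g = lift_integral g \<rho>'"
    by (simp add: cycle_period_def lift_integral_def \<rho>'_def)
  from lifts_unique[OF assms(1) \<rho>' assms(2)] show ?thesis
  proof
    assume "\<forall>t\<in>{0..1}. \<rho>' t = \<rho> t"
    then have "lift_integral g \<rho>' = lift_integral g \<rho>"
      unfolding lift_integral_def by (intro integral_cong) auto
    then show ?thesis using cp by simp
  next
    assume *: "\<forall>t\<in>{0..1}. \<rho>' t = - \<rho> t"
    have "lift_integral g \<rho>' = integral {0..1} (\<lambda>t. - (vector_derivative g (at t within {0..1}) / \<rho> t))"
      unfolding lift_integral_def by (intro integral_cong) (use * in auto)
    then have "lift_integral g \<rho>' = - lift_integral g \<rho>"
      unfolding lift_integral_def by simp
    then show ?thesis using cp by simp
  qed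
qed

text \<open>The homotopy is cut into finitely many loops, each close to the next. They are only
  continuous, so they are replaced by polynomial loops, and \<open>lift_nearby_loop\<close> is
  applied from one to the next. Existence of a lift has to travel along with the squared period,
  since for a loop without lift \<open>cycle_period\<close> is meaningless.\<close>

lemma cycle_period_homotopic:
  assumes g: "valid_path g" and h: "valid_path h" and hom: "homotopic_loops D g h"
    and \<rho>: "lifts_to_curve P g \<rho>"
    and D: "open D" "P holomorphic_on D" "\<And>x. x \<in> D \<Longrightarrow> P x \<noteq> 0"
  shows "\<exists>\<rho>'. lifts_to_curve P h \<rho>'" "(cycle_period P h)\<^sup>2 = (cycle_period P g)\<^sup>2"
proof -
  obtain H where H: "continuous_on ({0..1::real} \<times> {0..1}) H" "H \<in> ({0..1} \<times> {0..1}) \<rightarrow> D"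
     "\<And>x. x \<in> {0..1} \<Longrightarrow> H (0,x) = g x" "\<And>x. x \<in> {0..1} \<Longrightarrow> H (1,x) = h x"
     "\<And>t. t \<in> {0..1} \<Longrightarrow> pathfinish (H \<circ> Pair t) = pathstart (H \<circ> Pair t)"
    using hom unfolding homotopic_loops by blast
  have loops: "pathfinish g = pathstart g" "pathfinish h = pathstart h"
    using hom homotopic_loops_imp_loop by auto
  let ?K = "{0..1::real} \<times> {0..1::real}"
  have "compact (H ` ?K)" by (intro compact_continuous_image H compact_Times) auto
  then obtain \<epsilon> where \<epsilon>: "\<epsilon> > 0" "(\<Union>x\<in>H ` ?K. ball x \<epsilon>) \<subseteq> D"
    using compact_subset_open_imp_ball_epsilon_subset[of "H ` ?K" D] D(1) H(2) by auto
  have "uniformly_continuous_on ?K H"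
    by (rule compact_uniformly_continuous) (auto intro: H compact_Times)
  then obtain d where d: "d > 0" "\<And>p q. p \<in> ?K \<Longrightarrow> q \<in> ?K \<Longrightarrow> dist q p < d \<Longrightarrow> dist (H q) (H p) < \<epsilon> / 4"
    unfolding uniformly_continuous_on_def using \<epsilon>(1) by (metis zero_less_divide_iff zero_less_numeral)
  obtain N :: nat where N: "inverse (Suc N) < d" using d(1) reals_Archimedean by blast
  define n where "n = Suc N"
  define u where "u k = real k / real n" for k
  have u: "u k \<in> {0..1}" if "k \<le> n" for k using that by (auto simp: u_def n_def)
  have "\<exists>p. polynomial_function p \<and> pathfinish p = pathstart p \<and> (\<forall>t\<in>{0..1}. norm (p t - H (u k, t)) < \<epsilon> / 4)" if k: "k \<le> n" for k
  proof -
    have "path (H \<circ> Pair (u k))" unfolding path_def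
      by (intro continuous_on_compose continuous_intros continuous_on_subset[OF H(1)]) (use u[OF k] in auto)
    then obtain p where "polynomial_function p" "pathstart p = pathstart (H \<circ> Pair (u k))" "pathfinish p = pathfinish (H \<circ> Pair (u k))"
      "\<And>t. t \<in> {0..1} \<Longrightarrow> norm (p t - (H \<circ> Pair (u k)) t) < \<epsilon> / 4"
      using path_approx_polynomial_function[of "H \<circ> Pair (u k)" "\<epsilon> / 4"] \<epsilon>(1) by auto
    then show ?thesis using H(5)[OF u[OF k]] by auto
  qed
  then obtain p where p: "\<And>k. k \<le> n \<Longrightarrow> polynomial_function (p k)" "\<And>k. k \<le> n \<Longrightarrow> pathfinish (p k) = pathstart (p k)"
    "\<And>k t. k \<le> n \<Longrightarrow> t \<in> {0..1} \<Longrightarrow> dist (p k t) (H (u k, t)) < \<epsilon> / 4"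
    unfolding dist_norm by metis
  define good where "good q \<longleftrightarrow> (\<exists>\<rho>. lifts_to_curve P q \<rho>) \<and> (cycle_period P q)\<^sup>2 = (cycle_period P g)\<^sup>2" for q
  \<comment> \<open>Of the margin \<epsilon> around the image of the homotopy, one quarter pays for
    the polynomial approximation of \<open>q\<close>. Consecutive loops differ by at most two
    approximation errors and one step of the homotopy, and the discs of radius 3\<epsilon>/4 around
    \<open>q\<close> are still inside \<open>D\<close>.\<close>
  have step: "good r" if q: "valid_path q" "pathfinish q = pathstart q" "good q"
    and r: "valid_path r" "pathfinish r = pathstart r" and t: "t \<in> {0..1}"
    and near: "\<And>x. x \<in> {0..1} \<Longrightarrow> dist (q x) (H (t, x)) \<le> \<epsilon> / 4" "\<And>x. x \<in> {0..1} \<Longrightarrow> dist (q x) (r x) < 3 * \<epsilon> / 4" for q r t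
  proof -
    obtain \<rho> where \<rho>: "lifts_to_curve P q \<rho>" using q(3) good_def by blast
    have ball: "ball (q x) (3 * \<epsilon> / 4) \<subseteq> D" if "x \<in> {0..1}" for x
    proof -
      have "ball (q x) (3 * \<epsilon> / 4) \<subseteq> ball (H (t, x)) \<epsilon>"
      proof
        fix y assume "y \<in> ball (q x) (3 * \<epsilon> / 4)"
        then show "y \<in> ball (H (t, x)) \<epsilon>"
          using near(1)[OF that] dist_triangle[of "H (t, x)" y "q x"] by (simp add: dist_commute)
      qed
      then show ?thesis using \<epsilon>(2) t that by fastforce
    qed
    obtain \<rho>' where \<rho>': "lifts_to_curve P r \<rho>'" "lift_integral r \<rho>' = lift_integral q \<rho>"
      by (rule lift_nearby_loop[OF q(1,2) r \<rho> D _ ball near(2)]) (use \<epsilon>(1) in auto)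
    have "q x \<in> D" "r x \<in> D" if "x \<in> {0..1}" for x
      using ball[OF that] near(2)[OF that] \<epsilon>(1) by auto
    then have "(cycle_period P r)\<^sup>2 = (cycle_period P q)\<^sup>2"
      using cycle_period_square[OF \<rho>] cycle_period_square[OF \<rho>'(1)] \<rho>'(2) D(3) by metis
    then show ?thesis using q(3) \<rho>' unfolding good_def by auto
  qed
  have "good g" unfolding good_def using \<rho> by blast
  have pv: "valid_path (p k)" if "k \<le> n" for k using p(1)[OF that] by (simp add: valid_path_polynomial_function)
  have all: "good (p k)" if "k \<le> n" for k
    using that
  proof (induction k)
    case 0
    show ?case
      by (rule step[OF g loops(1) \<open>good g\<close> pv p(2), of _ 0])
         (use p(3)[of 0] H(3) \<epsilon>(1) in \<open>fastforce simp: u_def dist_commute\<close>)+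
  next
    case (Suc k)
    have "dist (p k x) (p (Suc k) x) < 3 * \<epsilon> / 4" if x: "x \<in> {0..1}" for x
    proof -
      have "dist (u (Suc k), x) (u k, x) = inverse n"
        by (simp add: dist_Pair_Pair u_def dist_real_def diff_divide_distrib[symmetric] inverse_eq_divide)
      then have "dist (H (u (Suc k), x)) (H (u k, x)) < \<epsilon> / 4"
        using x u[of k] u[of "Suc k"] Suc.prems N by (intro d) (auto simp: n_def)
      then show ?thesis using p(3)[of k x] p(3)[of "Suc k" x] x Suc.prems
         dist_triangle[of "p k x" "p (Suc k) x" "H (u k, x)"] dist_triangle[of "H (u k, x)" "p (Suc k) x" "H (u (Suc k), x)"]
        by (simp add: dist_commute)
    qed
    moreover have "dist (p k x) (H (u k, x)) \<le> \<epsilon> / 4" if "x \<in> {0..1}" for x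
      using p(3)[of k x] that Suc.prems by simp
    ultimately show ?case
      by (intro step[of "p k" "p (Suc k)" "u k"]) (use Suc pv p(2) u[of k] in auto)
  qed
  have "good h"
  proof (rule step[of "p n" h "u n"])
    fix x :: real assume x: "x \<in> {0..1}"
    show "dist (p n x) (H (u n, x)) \<le> \<epsilon> / 4" using p(3)[of n x] x by simp
    have "u n = 1" by (simp add: u_def n_def)
    then show "dist (p n x) (h x) < 3 * \<epsilon> / 4" using p(3)[of n x] x H(4)[OF x] \<epsilon>(1) by simp
  qed (use all[of n] pv[of n] p(2)[of n] h loops u[of n] in auto)
  then show "\<exists>\<rho>'. lifts_to_curve P h \<rho>'" "(cycle_period P h)\<^sup>2 = (cycle_period P g)\<^sup>2"
    by (auto simp: good_def)
qed

text \<open>If \<rho> lifts f o g to the curve of \<open>Q\<close>, then \<rho> m lifts g to the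
  curve of \<open>P\<close>, and the pulled back form f' dx / \<rho> equals f' m dx / (\<rho> m).
  For the fractional linear maps used below f' m is a constant \<open>k\<close>.\<close>

lemma cycle_period_change_of_variable:
  assumes g: "valid_path g" "path_image g \<subseteq> T" and f: "open T" "f holomorphic_on T"
    and m: "continuous_on (path_image g) m" "\<And>x. x \<in> path_image g \<Longrightarrow> m x \<noteq> 0"
    and Q: "\<And>x. x \<in> path_image g \<Longrightarrow> Q (f x) * (m x)\<^sup>2 = P x" "\<And>x. x \<in> path_image g \<Longrightarrow> Q (f x) \<noteq> 0"
    and k: "\<And>x. x \<in> path_image g \<Longrightarrow> deriv f x * m x = k"
    and loop: "pathfinish g = pathstart g" and \<rho>: "lifts_to_curve Q (f \<circ> g) \<rho>"
  shows "(cycle_period Q (f \<circ> g))\<^sup>2 = k\<^sup>2 * (cycle_period P g)\<^sup>2"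
proof -
  define \<rho>' where "\<rho>' t = \<rho> t * m (g t)" for t
  have pi: "g t \<in> path_image g" if "t \<in> {0..1}" for t using that by (auto simp: path_image_def)
  have cg: "continuous_on {0..1} g" using valid_path_imp_path[OF g(1)] by (simp add: path_def)
  have lift: "lifts_to_curve P g \<rho>'"
    unfolding lifts_to_curve_def path_def
  proof (intro conjI ballI)
    show "continuous_on {0..1} \<rho>'" unfolding \<rho>'_def
      using \<rho> by (intro continuous_intros continuous_on_compose2[OF m(1) cg])
        (auto simp: lifts_to_curve_def path_def path_image_def)
    show "pathfinish \<rho>' = pathstart \<rho>'" using \<rho> loop
      by (auto simp: \<rho>'_def lifts_to_curve_def pathstart_def pathfinish_def)
    fix t :: real assume t: "t \<in> {0..1}"
    show "\<rho>' t ^ 2 = P (g t)"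
      using \<rho> t Q(1)[OF pi[OF t]] by (auto simp: \<rho>'_def lifts_to_curve_def power_mult_distrib)
  qed
  obtain S where S: "finite S"
    "\<And>t. t \<in> {0<..<1} - S \<Longrightarrow> (g has_vector_derivative vector_derivative g (at t within {0..1})) (at t)"
    using valid_path_has_derivative[OF g(1)] by metis
  have "lift_integral (f \<circ> g) \<rho> = integral {0..1} (\<lambda>t. k * (vector_derivative g (at t within {0..1}) / \<rho>' t))"
    unfolding lift_integral_def
  proof (rule integral_spike[of "S \<union> {0, 1}"])
    show "negligible (S \<union> {0, 1})" using S(1) by (intro negligible_finite) auto
    fix t :: real assume t: "t \<in> {0..1} - (S \<union> {0, 1})"
    then have t': "t \<in> {0..1}" "t \<in> {0<..<1} - S" by auto
    have "(f has_field_derivative deriv f (g t)) (at (g t))"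
      using f g(2) pi[OF t'(1)] by (meson holomorphic_derivI subsetD)
    then have "((f \<circ> g) has_vector_derivative vector_derivative g (at t within {0..1}) * deriv f (g t)) (at t)"
      by (intro field_vector_diff_chain_at S t')
    then have "vector_derivative (f \<circ> g) (at t within {0..1}) = vector_derivative g (at t within {0..1}) * deriv f (g t)"
      using t' by (intro vector_derivative_at_within_ivl) auto
    then show "k * (vector_derivative g (at t within {0..1}) / \<rho>' t) = vector_derivative (f \<circ> g) (at t within {0..1}) / \<rho> t"
      using m(2)[OF pi[OF t'(1)]] by (simp add: \<rho>'_def k[OF pi[OF t'(1)], symmetric])
  qed
  then have "lift_integral (f \<circ> g) \<rho> = k * lift_integral g \<rho>'"
    by (simp only: lift_integral_def integral_mult_right)
  moreover have "(cycle_period Q (f \<circ> g))\<^sup>2 = (lift_integral (f \<circ> g) \<rho>)\<^sup>2"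
    by (rule cycle_period_square[OF \<rho>]) (use Q(2) pi in auto)
  moreover have "(cycle_period P g)\<^sup>2 = (lift_integral g \<rho>')\<^sup>2"
    by (rule cycle_period_square[OF lift]) (use Q m(2) pi in \<open>metis mult_eq_0_iff power_not_zero\<close>)
  ultimately show ?thesis by (simp add: power_mult_distrib)
qed

section \<open>The period of the reduced curve\<close>

text \<open>The quotient x/w lies in the unit disc around 1, hence in the right half plane, where
  the principal root inverts squaring. Thus rescaling by \<open>w\<close> turns \<open>csqrt\<close>
  into the branch of the root through \<open>w\<close>.\<close>

lemma csqrt_square_quotient:
  fixes w :: complex
  assumes "dist x w < norm w"
  shows "x = w * csqrt (x\<^sup>2 / w\<^sup>2)"
proof -
  have w: "w \<noteq> 0" using assms by auto
  have "norm (x / w - 1) = dist x w / norm w"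
    using w by (simp add: dist_norm norm_divide[symmetric] diff_divide_distrib)
  also have "\<dots> < 1" using assms w by simp
  finally have "norm (1 - x / w) < 1" by (simp add: norm_minus_commute)
  then have "Re (x / w) > 0" using complex_Re_le_cmod[of "1 - x / w"] by simp
  then have "csqrt ((x / w)\<^sup>2) = x / w" by (intro csqrt_square) auto
  then show ?thesis using w by (simp add: power_divide)
qed

lemma csqrt_scaled_derivative:
  fixes w :: complex
  assumes "w \<noteq> 0"
  shows "((\<lambda>x. w * csqrt (x / w\<^sup>2)) has_field_derivative 1 / (2 * w)) (at (w\<^sup>2))"
proof -
  have "(csqrt has_field_derivative inverse (2 * csqrt 1)) (at (w\<^sup>2 / w\<^sup>2))"
    using assms has_field_derivative_csqrt[of 1] by (simp add: complex_nonpos_Reals_iff)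
  then have "((\<lambda>x. csqrt (x / w\<^sup>2)) has_field_derivative inverse (2 * csqrt 1) * (1 / w\<^sup>2)) (at (w\<^sup>2))"
    by (rule DERIV_chain2) (rule DERIV_cdivide[OF DERIV_ident])
  then have "((\<lambda>x. w * csqrt (x / w\<^sup>2)) has_field_derivative w * (inverse (2 * csqrt 1) * (1 / w\<^sup>2))) (at (w\<^sup>2))"
    by (rule DERIV_cmult)
  moreover have "w * (inverse (2 * csqrt 1) * (1 / w\<^sup>2)) = 1 / (2 * w)"
    using assms by (simp add: power2_eq_square)
  ultimately show ?thesis by simp
qed

text \<open>A root that is merely continuous coincides near x with the principal root rescaled by
  its value at x, and so inherits differentiability.\<close>

lemma sqrt_field_derivative:
  fixes \<rho> q :: "complex \<Rightarrow> complex"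
  assumes q: "(q has_field_derivative q') (at x)" and \<rho>: "isCont \<rho> x" "\<forall>\<^sub>F y in nhds x. \<rho> y ^ 2 = q y" "\<rho> x \<noteq> 0"
  shows "(\<rho> has_field_derivative q' / (2 * \<rho> x)) (at x)"
proof -
  let ?w = "\<rho> x"
  have qx: "q x = ?w\<^sup>2" using \<rho>(2) eventually_nhds_x_imp_x by fastforce
  have "((\<lambda>y. ?w * csqrt (q y / ?w\<^sup>2)) has_field_derivative 1 / (2 * ?w) * q') (at x)"
    using csqrt_scaled_derivative[OF \<rho>(3)] q unfolding qx[symmetric] by (rule DERIV_chain2)
  moreover have "(\<rho> \<longlongrightarrow> \<rho> x) (nhds x)" using \<rho>(1) by (simp add: continuous_at tendsto_at_iff_tendsto_nhds)
  then have "\<forall>\<^sub>F y in nhds x. dist (\<rho> y) (\<rho> x) < norm ?w"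
    using \<rho>(3) by (intro tendstoD) auto
  then have "\<forall>\<^sub>F y in nhds x. ?w * csqrt (q y / ?w\<^sup>2) = \<rho> y"
    using \<rho>(2) by eventually_elim (metis csqrt_square_quotient)
  ultimately show ?thesis by (subst (asm) DERIV_cong_ev[OF refl _ refl]) (auto simp: mult.commute)
qed

lemma sqrt_vector_derivative:
  fixes \<rho> q :: "real \<Rightarrow> complex"
  assumes q: "(q has_vector_derivative q') (at t within S)" and \<rho>: "continuous (at t within S) \<rho>"
    "\<And>u. u \<in> S \<Longrightarrow> \<rho> u ^ 2 = q u" "\<rho> t \<noteq> 0" and t: "t \<in> S"
  shows "(\<rho> has_vector_derivative q' / (2 * \<rho> t)) (at t within S)"
proof -
  let ?w = "\<rho> t"
  have qx: "q t = ?w\<^sup>2" using \<rho>(2) t by simp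
  have "((\<lambda>x. ?w * csqrt (x / ?w\<^sup>2)) has_field_derivative 1 / (2 * ?w)) (at (q t) within q ` S)"
    using csqrt_scaled_derivative[OF \<rho>(3)] by (metis qx has_field_derivative_at_within)
  then have "(((\<lambda>x. ?w * csqrt (x / ?w\<^sup>2)) \<circ> q) has_vector_derivative q' * (1 / (2 * ?w))) (at t within S)"
    by (rule field_vector_diff_chain_within[OF q])
  then have *: "((\<lambda>u. ?w * csqrt (q u / ?w\<^sup>2)) has_vector_derivative q' / (2 * ?w)) (at t within S)"
    by (simp add: o_def)
  obtain d where d: "d > 0" "\<And>u. u \<in> S \<Longrightarrow> dist u t < d \<Longrightarrow> dist (\<rho> u) (\<rho> t) < norm ?w"
    using \<rho>(1,3) unfolding continuous_within_eps_delta by (metis zero_less_norm_iff)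
  show ?thesis
  proof (rule has_vector_derivative_transform_within[OF * d(1) t])
    fix u assume "u \<in> S" "dist u t < d"
    then show "?w * csqrt (q u / ?w\<^sup>2) = \<rho> u"
      using csqrt_square_quotient[OF d(2)] \<rho>(2) by metis
  qed
qed

text \<open>The cut joins 0 to 1 off the loop, so both have the same winding number n, while that of
  \<open>s\<close> is 0. Continuous logarithms of \<lambda>, \<lambda> - 1, \<lambda> - s along the
  loop grow by 2 pi i n, 2 pi i n and 0. Half their sum grows by 2 pi i n, so its exponential is a
  closed square root of the cubic.\<close>

lemma encircled_cut_lifts:
  assumes "encircles_cut \<delta> 0 1 {s}"
  shows "\<exists>\<rho>. lifts_to_curve (reduced_cubic s) \<delta> \<rho>" "path_image \<delta> \<subseteq> - {0, 1, s}"
    "valid_path \<delta>" "pathfinish \<delta> = pathstart \<delta>"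
proof -
  obtain cut where \<delta>: "valid_path \<delta>" "pathfinish \<delta> = pathstart \<delta>"
    and cut: "arc cut" "pathstart cut = 0" "pathfinish cut = 1" "path_image cut \<subseteq> inside (path_image \<delta>)"
    and s: "s \<in> outside (path_image \<delta>)"
    using assms by (auto simp: encircles_cut_def)
  have p: "path \<delta>" using \<delta>(1) by (rule valid_path_imp_path)
  have disj: "path_image cut \<inter> path_image \<delta> = {}" using cut(4) inside_no_overlap by blast
  have in_cut: "0 \<in> path_image cut" "1 \<in> path_image cut"
    using cut(2,3) pathstart_in_path_image[of cut] pathfinish_in_path_image[of cut] by auto
  have sn: "s \<notin> path_image \<delta>" using s outside_no_overlap by blast
  show pi: "path_image \<delta> \<subseteq> - {0, 1, s}" using disj in_cut sn by auto
  show "valid_path \<delta>" "pathfinish \<delta> = pathstart \<delta>" by fact+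
  have w01: "winding_number \<delta> 0 = winding_number \<delta> 1"
    using p \<delta>(2) in_cut connected_path_image[OF arc_imp_path[OF cut(1)]] disj by (rule winding_number_eq)
  have ws: "winding_number \<delta> s = 0" by (rule winding_number_zero_in_outside[OF p \<delta>(2) s])
  have "winding_number \<delta> 0 \<in> \<int>" using pi by (intro integer_winding_number p \<delta>(2)) auto
  then obtain n where n: "winding_number \<delta> 0 = of_int n" by (auto elim: Ints_cases)
  have log: "\<exists>q. path q \<and> pathfinish q - pathstart q = 2 * of_real pi * \<i> * winding_number \<delta> x \<and> (\<forall>t\<in>{0..1}. \<delta> t = x + exp (q t))"
    if "x \<notin> path_image \<delta>" for x
    using winding_number_as_continuous_log[OF p that] by metis
  obtain q0 where q0: "path q0" "pathfinish q0 - pathstart q0 = 2 * of_real pi * \<i> * of_int n" "\<And>t. t \<in> {0..1} \<Longrightarrow> \<delta> t = 0 + exp (q0 t)"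
    using log[of 0] pi unfolding n by blast
  obtain q1 where q1: "path q1" "pathfinish q1 - pathstart q1 = 2 * of_real pi * \<i> * of_int n" "\<And>t. t \<in> {0..1} \<Longrightarrow> \<delta> t = 1 + exp (q1 t)"
    using log[of 1] pi unfolding w01[symmetric] n by blast
  obtain qs where qs: "path qs" "pathfinish qs - pathstart qs = 2 * of_real pi * \<i> * 0" "\<And>t. t \<in> {0..1} \<Longrightarrow> \<delta> t = s + exp (qs t)"
    using log[of s] pi unfolding ws by blast
  define \<rho> where "\<rho> t = exp ((q0 t + q1 t + qs t) / 2)" for t
  have "lifts_to_curve (reduced_cubic s) \<delta> \<rho>"
    unfolding lifts_to_curve_def path_def
  proof (intro conjI ballI)
    show "continuous_on {0..1} \<rho>" using q0(1) q1(1) qs(1) unfolding \<rho>_def path_def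
      by (intro continuous_intros) auto
    have "q0 1 = q0 0 + 2 * of_real pi * \<i> * of_int n" "q1 1 = q1 0 + 2 * of_real pi * \<i> * of_int n" "qs 1 = qs 0"
      using q0(2) q1(2) qs(2) by (simp_all add: pathstart_def pathfinish_def algebra_simps)
    then have "(q0 1 + q1 1 + qs 1) / 2 = (q0 0 + q1 0 + qs 0) / 2 + of_real (2 * of_int n * pi) * \<i>"
      by (simp add: field_simps)
    then show "pathfinish \<rho> = pathstart \<rho>"
      unfolding pathstart_def pathfinish_def \<rho>_def using exp_integer_2pi[of "of_int n"] by (simp only: exp_add) simp
    fix t :: real assume t: "t \<in> {0..1}"
    have "\<rho> t ^ 2 = exp (q0 t) * exp (q1 t) * exp (qs t)"
      unfolding \<rho>_def exp_add[symmetric] exp_double[symmetric] by (simp del: distrib_left_numeral)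
    also have "\<dots> = \<delta> t * (\<delta> t - 1) * (\<delta> t - s)"
    proof -
      have "\<delta> t = exp (q0 t)" using q0(3)[OF t] by (simp only: add_0)
      moreover have "\<delta> t - 1 = exp (q1 t)" using q1(3)[OF t] by (metis add_diff_cancel_left')
      moreover have "\<delta> t - s = exp (qs t)" using qs(3)[OF t] by (metis add_diff_cancel_left')
      ultimately show ?thesis by simp
    qed
    finally show "\<rho> t ^ 2 = reduced_cubic s (\<delta> t)" by (simp add: reduced_cubic_def)
  qed
  then show "\<exists>\<rho>. lifts_to_curve (reduced_cubic s) \<delta> \<rho>" by blast
qed

section \<open>Period relations along a smooth lifted loop\<close>

lemma reduced_cubic_holomorphic: "reduced_cubic s holomorphic_on D"
  unfolding reduced_cubic_def[abs_def] by (intro holomorphic_intros)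

lemma reduced_cubic_nonzero: "x \<in> - {0, 1, s} \<Longrightarrow> reduced_cubic s x \<noteq> 0"
  by (simp add: reduced_cubic_def)

lemma open_compl_branch_points: "open (- {0, 1, s :: complex})"
  by (simp add: open_Compl)

text \<open>A continuous derivative makes the integrands below continuous, so that the fundamental
  theorem and differentiation under the integral sign apply. Polynomial loops provide
  instances.\<close>

locale smooth_lifted_loop =
  fixes s :: complex and d d' \<rho> :: "real \<Rightarrow> complex"
  assumes der: "\<And>t. (d has_vector_derivative d' t) (at t)" and cont_d': "continuous_on UNIV d'"
    and loop: "d 1 = d 0" and avoid: "\<And>t. t \<in> {0..1} \<Longrightarrow> d t \<in> - {0, 1, s}"
    and lift: "lifts_to_curve (reduced_cubic s) d \<rho>"
begin

lemma lift_props: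
  shows cont_\<rho>: "continuous_on {0..1} \<rho>" and sq_\<rho>: "\<And>t. t \<in> {0..1} \<Longrightarrow> \<rho> t ^ 2 = reduced_cubic s (d t)"
    and \<rho>_closed: "\<rho> 1 = \<rho> 0"
  using lift by (auto simp: lifts_to_curve_def path_def pathstart_def pathfinish_def)

lemma \<rho>_nonzero: "t \<in> {0..1} \<Longrightarrow> \<rho> t \<noteq> 0"
  using sq_\<rho>[of t] reduced_cubic_nonzero[OF avoid[of t]] by auto

lemma cont_d: "continuous_on A d"
  by (meson continuous_at_imp_continuous_on der has_vector_derivative_continuous)

lemma vector_derivative_d: "t \<in> {0..1} \<Longrightarrow> vector_derivative d (at t within {0..1}) = d' t"
  using der by (intro vector_derivative_at_within_ivl) auto

lemma lift_integral_eq: "lift_integral d \<rho> = integral {0..1} (\<lambda>t. d' t / \<rho> t)"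
  unfolding lift_integral_def by (intro integral_cong) (simp add: vector_derivative_d)

lemma integrable_over_lift:
  "continuous_on {0..1} f \<Longrightarrow> (\<lambda>t. f t * (d' t / \<rho> t)) integrable_on {0..1}"
  by (intro integrable_continuous_real continuous_intros continuous_on_subset[OF cont_d'] cont_\<rho>)
     (auto simp: \<rho>_nonzero)

text \<open>The exact form is \<open>d (\<rho> / (\<lambda> - s))\<close>.\<close>

lemma exact_form_relation:
  "integral {0..1} (\<lambda>t. d t * (d' t / \<rho> t)) - s * integral {0..1} (\<lambda>t. d' t / \<rho> t) =
     2 * s * (s - 1) * integral {0..1} (\<lambda>t. d' t / (2 * (d t - s) * \<rho> t))"
proof -
  \<comment> \<open>The derivative of \<rho>/(\<lambda> - s) along the loop is half of (\<lambda> -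
    s) - s(s - 1)/(\<lambda> - s) times d\<lambda>/\<rho>. The last term is written with 2(\<lambda>
    - s)\<rho> in the denominator because 1/(2(\<lambda> - s)\<rho>) is the derivative of 1/\<rho>
    with respect to s.\<close>
  let ?f = "\<lambda>t. 1 / 2 * (d t * (d' t / \<rho> t) - s * (d' t / \<rho> t) - 2 * s * (s - 1) * (d' t / (2 * (d t - s) * \<rho> t)))"
  have "(?f has_integral (\<rho> 1 / (d 1 - s) - \<rho> 0 / (d 0 - s))) {0..1}"
  proof (rule fundamental_theorem_of_calculus[where f = "\<lambda>t. \<rho> t / (d t - s)"])
    fix t :: real assume t: "t \<in> {0..1}"
    have nz: "d t \<noteq> s" "\<rho> t \<noteq> 0" using avoid[OF t] \<rho>_nonzero[OF t] by auto
    have dd: "(d has_vector_derivative d' t) (at t within {0..1})"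
      using der by (rule has_vector_derivative_at_within)
    let ?P' = "(2 * d t - 1) * (d t - s) + d t * (d t - 1)"
    have "(reduced_cubic s has_field_derivative ?P') (at (d t))"
      unfolding reduced_cubic_def[abs_def] by (auto intro!: derivative_eq_intros simp: algebra_simps)
    then have "((reduced_cubic s \<circ> d) has_vector_derivative d' t * ?P') (at t within {0..1})"
      by (rule field_vector_diff_chain_within[OF dd has_field_derivative_at_within])
    moreover have "continuous (at t within {0..1}) \<rho>"
      using cont_\<rho> t by (simp add: continuous_on_eq_continuous_within)
    ultimately have "(\<rho> has_vector_derivative d' t * ?P' / (2 * \<rho> t)) (at t within {0..1})"
      by (rule sqrt_vector_derivative) (use t nz sq_\<rho> in auto)
    moreover have "((\<lambda>t. inverse (d t - s)) has_vector_derivative - d' t / (d t - s)\<^sup>2) (at t within {0..1})"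
    proof -
      have "((\<lambda>x. inverse (x - s)) has_field_derivative - (1 / (d t - s)\<^sup>2)) (at (d t) within d ` {0..1})"
        using nz by (auto intro!: derivative_eq_intros simp: power2_eq_square inverse_eq_divide)
      from field_vector_diff_chain_within[OF dd this] show ?thesis by (simp add: o_def)
    qed
    ultimately have *: "((\<lambda>t. \<rho> t * inverse (d t - s)) has_vector_derivative
        \<rho> t * (- d' t / (d t - s)\<^sup>2) + d' t * ?P' / (2 * \<rho> t) * inverse (d t - s)) (at t within {0..1})"
      by (rule has_vector_derivative_mult)
    have "\<rho> t * (- d' t / (d t - s)\<^sup>2) = - d' t / \<rho> t * (\<rho> t ^ 2 / (d t - s)\<^sup>2)"
      using nz by (simp add: power2_eq_square)
    also have "\<rho> t ^ 2 = d t * (d t - 1) * (d t - s)"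
      using sq_\<rho>[OF t] by (simp add: reduced_cubic_def)
    also have "d t * (d t - 1) * (d t - s) / (d t - s)\<^sup>2 = d t * (d t - 1) / (d t - s)"
      using nz by (simp add: power2_eq_square)
    finally have eq: "\<rho> t * (- d' t / (d t - s)\<^sup>2) = - d' t / \<rho> t * (d t * (d t - 1) / (d t - s))" .
    have "\<rho> t * (- d' t / (d t - s)\<^sup>2) + d' t * ?P' / (2 * \<rho> t) * inverse (d t - s) =
        d' t / (2 * \<rho> t) * ((?P' - 2 * (d t * (d t - 1))) / (d t - s))"
      unfolding eq using nz by (simp add: divide_simps) (simp add: algebra_simps)
    \<comment> \<open>The numerator is expanded in powers of \<lambda> - s; its linear term
      vanishes, which is why only two periods and the derivative of one of them occur.\<close>
    also have "?P' - 2 * (d t * (d t - 1)) = (d t - s) * (d t - s) - s * (s - 1)"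
      by (simp add: algebra_simps)
    also have "d' t / (2 * \<rho> t) * (((d t - s) * (d t - s) - s * (s - 1)) / (d t - s)) = ?f t"
      using nz by (simp add: divide_simps) (simp add: algebra_simps)
    finally show "((\<lambda>t. \<rho> t / (d t - s)) has_vector_derivative ?f t) (at t within {0..1})"
      using * by (simp only: divide_inverse)
  qed simp
  then have "integral {0..1} ?f = \<rho> 1 / (d 1 - s) - \<rho> 0 / (d 0 - s)" by (rule integral_unique)
  then have 0: "integral {0..1} ?f = 0" by (simp only: loop \<rho>_closed diff_self)
  have i1: "(\<lambda>t. d t * (d' t / \<rho> t)) integrable_on {0..1}"
    by (intro integrable_over_lift cont_d)
  have i2: "(\<lambda>t. d' t / \<rho> t) integrable_on {0..1}"
    using integrable_over_lift[of "\<lambda>_. 1"] by simp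
  have "(\<lambda>t. 1 / (2 * (d t - s)) * (d' t / \<rho> t)) integrable_on {0..1}"
    using avoid by (intro integrable_over_lift continuous_intros cont_d) auto
  then have i3: "(\<lambda>t. d' t / (2 * (d t - s) * \<rho> t)) integrable_on {0..1}" by simp
  have "integral {0..1} ?f = 1 / 2 * (integral {0..1} (\<lambda>t. d t * (d' t / \<rho> t)) - s * integral {0..1} (\<lambda>t. d' t / \<rho> t) -
     2 * s * (s - 1) * integral {0..1} (\<lambda>t. d' t / (2 * (d t - s) * \<rho> t)))"
    using i1 i2 i3 by (simp only: integral_mult_right integral_diff integrable_diff integrable_on_mult_right)
  with 0 show ?thesis by simp
qed



end


section \<open>The cycle lifted through the uniformization\<close>

context complex_lattice
begin

lemma deriv_weierstrass_p: "z \<notin> L \<Longrightarrow> deriv wp z = p_deriv z"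
  by (intro DERIV_imp_deriv weierstrass_p_derivative)

lemma weierstrass_p_open_preimage:
  assumes "z \<notin> L" "wp z + c \<in> B" "open B"
  obtains r where "r > 0" "ball z r \<subseteq> - L" "\<And>y. y \<in> ball z r \<Longrightarrow> wp y + c \<in> B"
proof -
  have "continuous_on (- L) (\<lambda>z. wp z + c)"
    by (intro continuous_intros continuous_at_imp_continuous_on ballI DERIV_isCont[OF weierstrass_p_derivative]) auto
  then have "open ((\<lambda>z. wp z + c) -` B \<inter> - L)"
    using open_compl_lattice assms(3) by (auto intro: continuous_open_preimage simp: Int_commute)
  moreover have "z \<in> (\<lambda>z. wp z + c) -` B \<inter> - L" using assms by auto
  ultimately obtain r where "r > 0" "ball z r \<subseteq> (\<lambda>z. wp z + c) -` B \<inter> - L"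
    using open_contains_ball by metis
  then show thesis using that[of r] by blast
qed

text \<open>Under \<lambda> = wp(z) + c the form d\<lambda>/(2\<rho>) is dz, so its integral
  \<open>Z\<close> should invert the uniformization along the loop. The set of times at which it
  does contains 0 and is closed and open. For openness, let \<open>\<Psi>\<close> be a local
  primitive of d\<lambda>/\<rho>: both \<open>\<Psi> (wp y + c) - 2 * y\<close> and
  \<open>\<Psi> (d t) - 2 * Z t\<close> are constant, with the same constant, and
  \<open>\<Psi>\<close> is injective near \<open>d u\<close> because its derivative does not
  vanish.\<close>

lemma lift_through_uniformization:
  assumes ode: "\<And>z. z \<notin> L \<Longrightarrow> (p_deriv z / 2)\<^sup>2 = reduced_cubic s (wp z + c)"
    and sl: "smooth_lifted_loop s d d' \<rho>"
    and z0: "Z 0 \<notin> L" "wp (Z 0) + c = d 0" "p_deriv (Z 0) / 2 = \<rho> 0"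
    and Z: "\<And>t. t \<in> {0..1} \<Longrightarrow> (Z has_vector_derivative d' t / (2 * \<rho> t)) (at t within {0..1})"
    and t: "t \<in> {0..1}"
  shows "Z t \<notin> L \<and> wp (Z t) + c = d t \<and> p_deriv (Z t) / 2 = \<rho> t"
proof -
  interpret smooth_lifted_loop s d d' \<rho> by (rule sl)
  have cZ: "continuous_on {0..1} Z"
    unfolding continuous_on_eq_continuous_within using Z has_vector_derivative_continuous by blast
  have cp: "isCont wp z" "isCont p_deriv z" if z: "z \<notin> L" for z
  proof -
    show "isCont wp z" by (rule DERIV_isCont[OF weierstrass_p_derivative[OF z]])
    have "wp holomorphic_on - L"
      using weierstrass_p_derivative open_compl_lattice by (auto simp: holomorphic_on_open)
    then have "deriv wp holomorphic_on - L" by (rule holomorphic_deriv[OF _ open_compl_lattice])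
    then have "p_deriv holomorphic_on - L" by (rule holomorphic_transform) (auto simp: deriv_weierstrass_p)
    then show "isCont p_deriv z"
      using z open_compl_lattice by (metis ComplI continuous_on_eq_continuous_at holomorphic_on_imp_continuous_on)
  qed
  define T where "T = {t \<in> {0..1}. Z t \<notin> L \<and> wp (Z t) + c = d t \<and> p_deriv (Z t) / 2 = \<rho> t}"
  have "closed T"
    unfolding closed_sequential_limits
  proof (intro allI impI, elim conjE)
    fix x l assume x: "\<forall>n. x n \<in> T" and l: "x \<longlonglongrightarrow> l"
    have l01: "l \<in> {0..1}" using x l by (intro closed_sequentially[OF closed_atLeastAtMost _ l]) (auto simp: T_def)
    have lim: "(\<lambda>n. f (x n)) \<longlonglongrightarrow> f l" if "continuous_on {0..1} f" for f :: "real \<Rightarrow> complex"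
      using that l l01 x by (intro continuous_on_tendsto_compose[OF that l]) (auto simp: T_def)
    have lZ: "(\<lambda>n. Z (x n)) \<longlonglongrightarrow> Z l" and ld: "(\<lambda>n. d (x n)) \<longlonglongrightarrow> d l" and l\<rho>: "(\<lambda>n. \<rho> (x n)) \<longlonglongrightarrow> \<rho> l"
      by (intro lim cZ cont_d cont_\<rho>)+
    have eqs: "Z (x n) \<notin> L" "wp (Z (x n)) = d (x n) - c" "p_deriv (Z (x n)) = 2 * \<rho> (x n)" for n
    proof -
      have "Z (x n) \<notin> L \<and> wp (Z (x n)) + c = d (x n) \<and> p_deriv (Z (x n)) / 2 = \<rho> (x n)"
        using x by (auto simp: T_def)
      then show "Z (x n) \<notin> L" "wp (Z (x n)) = d (x n) - c" "p_deriv (Z (x n)) = 2 * \<rho> (x n)"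
        by (auto simp: field_simps)
    qed
    \<comment> \<open>At a lattice point \<open>wp\<close> would tend to infinity along the
      sequence, whereas it equals \<open>d - c\<close>, which converges.\<close>
    have Zl: "Z l \<notin> L"
    proof
      assume "Z l \<in> L"
      then have "filterlim wp at_infinity (at (Z l))" by (rule weierstrass_p_pole)
      moreover have "filterlim (\<lambda>n. Z (x n)) (at (Z l)) sequentially"
        using lZ eqs(1) \<open>Z l \<in> L\<close> by (intro filterlim_atI) (auto intro!: always_eventually, metis)
      ultimately have "filterlim (\<lambda>n. wp (Z (x n))) at_infinity sequentially" by (rule filterlim_compose)
      moreover have "(\<lambda>n. wp (Z (x n))) \<longlonglongrightarrow> d l - c" unfolding eqs(2) by (intro tendsto_intros ld)
      ultimately show False using not_tendsto_and_filterlim_at_infinity sequentially_bot by blast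
    qed
    have "(\<lambda>n. wp (Z (x n))) \<longlonglongrightarrow> wp (Z l)" "(\<lambda>n. p_deriv (Z (x n))) \<longlonglongrightarrow> p_deriv (Z l)"
      using cp[OF Zl] lZ by (auto intro: isCont_tendsto_compose)
    then have "wp (Z l) = d l - c" "p_deriv (Z l) = 2 * \<rho> l"
      unfolding eqs(2,3) using LIMSEQ_unique tendsto_diff[OF ld tendsto_const] tendsto_mult[OF tendsto_const l\<rho>] by blast+
    then show "l \<in> T" using l01 Zl by (simp add: T_def)
  qed
  then have "closedin (top_of_set {0..1}) T"
    by (intro closed_subset) (auto simp: T_def)
  moreover have "openin (top_of_set {0..1}) T"
    unfolding openin_euclidean_subtopology_iff
  proof (intro conjI ballI)
    fix u assume u: "u \<in> T"
    then have u01: "u \<in> {0..1}" and Zu: "Z u \<notin> L" "wp (Z u) + c = d u" "p_deriv (Z u) / 2 = \<rho> u"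
      by (auto simp: T_def)
    obtain e where e: "e > 0" "ball (d u) e \<subseteq> - {0, 1, s}"
      using open_compl_branch_points avoid[OF u01] open_contains_ball by metis
    have nz: "reduced_cubic s x \<noteq> 0" if "x \<in> ball (d u) e" for x
      using reduced_cubic_nonzero e(2) that by blast
    obtain \<sigma> \<Psi> where \<sigma>: "\<sigma> holomorphic_on ball (d u) e" "\<And>x. x \<in> ball (d u) e \<Longrightarrow> \<sigma> x ^ 2 = reduced_cubic s x" "\<sigma> (d u) = \<rho> u"
      "\<And>x. x \<in> ball (d u) e \<Longrightarrow> (\<Psi> has_field_derivative 1 / \<sigma> x) (at x)"
      using local_branch_primitive[OF reduced_cubic_holomorphic nz sq_\<rho>[OF u01] e(1)] by metis
    have "\<exists>\<eta>>0. \<forall>t\<in>{0..1}. dist t u < \<eta> \<longrightarrow> d t \<in> ball (d u) e \<and> \<sigma> (d t) = \<rho> t"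
      by (rule lift_agrees_locally[OF cont_d cont_\<rho> sq_\<rho> \<sigma>(1) \<sigma>(2) \<sigma>(3) nz u01 e(1)])
    then obtain \<eta> where \<eta>: "\<eta> > 0" "\<forall>t\<in>{0..1}. dist t u < \<eta> \<longrightarrow> d t \<in> ball (d u) e \<and> \<sigma> (d t) = \<rho> t" by blast
    have \<sigma>nz: "\<sigma> x \<noteq> 0" if "x \<in> ball (d u) e" for x using \<sigma>(2)[OF that] nz[OF that] by auto
    have "\<Psi> holomorphic_on ball (d u) e" unfolding holomorphic_on_open[OF open_ball] using \<sigma>(4) by blast
    moreover have "deriv \<Psi> (d u) \<noteq> 0" using DERIV_imp_deriv[OF \<sigma>(4)[of "d u"]] \<sigma>nz[of "d u"] e(1) by simp
    ultimately obtain r where r: "r > 0" "ball (d u) r \<subseteq> ball (d u) e" "inj_on \<Psi> (ball (d u) r)"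
      using has_complex_derivative_locally_injective[of \<Psi> "ball (d u) e" "d u"] e(1) by auto
    obtain r' where r': "r' > 0" "ball (Z u) r' \<subseteq> - L" "\<And>y. y \<in> ball (Z u) r' \<Longrightarrow> wp y + c \<in> ball (d u) r"
      by (rule weierstrass_p_open_preimage[OF Zu(1), of c "ball (d u) r"]) (use Zu r in auto)
    have in_e: "wp y + c \<in> ball (d u) e" if "y \<in> ball (Z u) r'" for y using r'(3)[OF that] r(2) by blast
    have c\<sigma>: "continuous_on (ball (Z u) r') (\<lambda>y. \<sigma> (wp y + c))"
      using in_e r'(2) by (intro continuous_on_compose2[OF holomorphic_on_imp_continuous_on[OF \<sigma>(1)]] continuous_intros
        continuous_at_imp_continuous_on ballI cp(1)) auto
    \<comment> \<open>By the differential equation both sides square to the cubic, and at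
      \<open>Z u\<close> they lie on the same sheet.\<close>
    have \<sigma>p: "\<sigma> (wp y + c) = p_deriv y / 2" if "y \<in> ball (Z u) r'" for y
    proof (rule square_roots_agree[where X = "ball (Z u) r'" and x\<^sub>0 = "Z u" and a = "\<lambda>y. \<sigma> (wp y + c)" and b = "\<lambda>y. p_deriv y / 2"])
      show "continuous_on (ball (Z u) r') (\<lambda>y. p_deriv y / 2)"
        using r'(2) by (intro continuous_intros continuous_at_imp_continuous_on ballI cp(2)) auto
      show "(\<sigma> (wp y + c))\<^sup>2 = (p_deriv y / 2)\<^sup>2" if "y \<in> ball (Z u) r'" for y
        using \<sigma>(2)[OF in_e[OF that]] ode[of y] r'(2) that by auto
      show "p_deriv y / 2 \<noteq> 0" if "y \<in> ball (Z u) r'" for y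
      proof -
        have "(p_deriv y / 2)\<^sup>2 \<noteq> 0" using ode[of y] nz[OF in_e[OF that]] r'(2) that by auto
        then show ?thesis by auto
      qed
    qed (use that c\<sigma> Zu \<sigma>(3) r'(1) in auto)
    have "((\<lambda>y. \<Psi> (wp y + c) - 2 * y) has_field_derivative 0) (at y within ball (Z u) r')" if y: "y \<in> ball (Z u) r'" for y
    proof -
      have yL: "y \<notin> L" using r'(2) y by auto
      have "((\<lambda>y. wp y + c) has_field_derivative p_deriv y) (at y)"
        using DERIV_add[OF weierstrass_p_derivative[OF yL] DERIV_const[of c]] by simp
      from DERIV_chain2[OF \<sigma>(4)[OF in_e[OF y]] this]
      have "((\<lambda>y. \<Psi> (wp y + c) - 2 * y) has_field_derivative 1 / \<sigma> (wp y + c) * p_deriv y - 2 * 1) (at y)"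
        by (rule DERIV_diff[OF _ DERIV_cmult[OF DERIV_ident]])
      moreover have "1 / \<sigma> (wp y + c) * p_deriv y - 2 * 1 = 0"
        using \<sigma>p[OF y] \<sigma>nz[OF in_e[OF y]] by (simp add: field_simps)
      ultimately show ?thesis by (simp add: has_field_derivative_at_within)
    qed
    then have "\<exists>k. \<forall>y\<in>ball (Z u) r'. \<Psi> (wp y + c) - 2 * y = k"
      by (intro has_field_derivative_zero_constant convex_ball)
    then obtain k where k: "\<And>y. y \<in> ball (Z u) r' \<Longrightarrow> \<Psi> (wp y + c) - 2 * y = k" by blast
    let ?I = "{0..1} \<inter> ball u \<eta>"
    have I: "t \<in> {0..1}" "d t \<in> ball (d u) e" "\<sigma> (d t) = \<rho> t" if "t \<in> ?I" for t
      using \<eta>(2) that by (auto simp: dist_commute)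
    have "((\<lambda>t. \<Psi> (d t) - 2 * Z t) has_vector_derivative 0) (at t within ?I)" if t: "t \<in> ?I" for t
    proof -
      have dd: "(d has_vector_derivative d' t) (at t within ?I)" using der by (rule has_vector_derivative_at_within)
      have "((\<Psi> \<circ> d) has_vector_derivative d' t * (1 / \<sigma> (d t))) (at t within ?I)"
        by (rule field_vector_diff_chain_within[OF dd has_field_derivative_at_within[OF \<sigma>(4)[OF I(2)[OF t]]]])
      moreover have "(Z has_vector_derivative d' t / (2 * \<rho> t)) (at t within ?I)"
        by (rule has_vector_derivative_within_subset[OF Z[OF I(1)[OF t]]]) auto
      then have "((\<lambda>t. 2 * Z t) has_vector_derivative 2 * (d' t / (2 * \<rho> t))) (at t within ?I)"
        by (rule has_vector_derivative_mult_right)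
      ultimately have "((\<lambda>t. (\<Psi> \<circ> d) t - 2 * Z t) has_vector_derivative d' t * (1 / \<sigma> (d t)) - 2 * (d' t / (2 * \<rho> t))) (at t within ?I)"
        by (rule has_vector_derivative_diff)
      then show ?thesis using I(3)[OF t] by simp
    qed
    moreover have "convex ?I" by (intro convex_Int) auto
    ultimately obtain k' where k': "\<And>t. t \<in> ?I \<Longrightarrow> \<Psi> (d t) - 2 * Z t = k'"
      using has_vector_derivative_zero_constant[of ?I "\<lambda>t. \<Psi> (d t) - 2 * Z t"] by blast
    have kk: "k = k'" using k[of "Z u"] k'[of u] Zu r'(1) \<eta>(1) u01 by simp
    obtain \<epsilon>1 where \<epsilon>1: "\<epsilon>1 > 0" "\<And>t. t \<in> {0..1} \<Longrightarrow> dist t u < \<epsilon>1 \<Longrightarrow> dist (Z t) (Z u) < r'"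
      using cZ u01 r'(1) unfolding continuous_on_iff by metis
    obtain \<epsilon>2 where \<epsilon>2: "\<epsilon>2 > 0" "\<And>t. t \<in> {0..1} \<Longrightarrow> dist t u < \<epsilon>2 \<Longrightarrow> dist (d t) (d u) < r"
      using cont_d[of "{0..1}"] u01 r(1) unfolding continuous_on_iff by metis
    show "\<exists>\<epsilon>>0. \<forall>t\<in>{0..1}. dist t u < \<epsilon> \<longrightarrow> t \<in> T"
    proof (intro exI[of _ "min \<eta> (min \<epsilon>1 \<epsilon>2)"] conjI ballI impI)
      fix t assume t: "t \<in> {0..1}" "dist t u < min \<eta> (min \<epsilon>1 \<epsilon>2)"
      then have tI: "t \<in> ?I" by (auto simp: dist_commute)
      have Zt: "Z t \<in> ball (Z u) r'" and dt: "d t \<in> ball (d u) r" using \<epsilon>1(2)[of t] \<epsilon>2(2)[of t] t by (auto simp: dist_commute)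
      have "\<Psi> (wp (Z t) + c) = \<Psi> (d t)" using k[OF Zt] k'[OF tI] unfolding diff_eq_eq kk by simp
      then have eq: "wp (Z t) + c = d t" by (rule inj_onD[OF r(3) _ r'(3)[OF Zt] dt])
      have "p_deriv (Z t) / 2 = \<sigma> (wp (Z t) + c)" by (rule \<sigma>p[OF Zt, symmetric])
      also have "\<dots> = \<rho> t" unfolding eq by (rule I(3)[OF tI])
      finally have "p_deriv (Z t) / 2 = \<rho> t" .
      moreover have "Z t \<notin> L" using r'(2) Zt by blast
      ultimately show "t \<in> T" unfolding T_def using eq t(1) by blast
    qed (use \<eta>(1) \<epsilon>1(1) \<epsilon>2(1) in simp)
  qed (auto simp: T_def)
  moreover have "0 \<in> T" using z0 by (simp add: T_def)
  moreover have "connected {0..1::real}" by simp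
  ultimately have "T = {0..1}" unfolding connected_clopen by blast
  then have "t \<in> T" using t by (rule subst[OF sym])
  then show ?thesis unfolding T_def by blast
qed

text \<open>In the coordinate z the form \<lambda> d\<lambda>/(2\<rho>) becomes (wp + c) dz with
  primitive c z - \<zeta>(z). The lifted path runs from \<open>z0\<close> to
  \<open>z0 + \<omega>\<close>, so the quasi-period of \<zeta> gives the value.\<close>

lemma integral_over_uniformized_cycle:
  assumes ode: "\<And>z. z \<notin> L \<Longrightarrow> (deriv wp z / 2)\<^sup>2 = reduced_cubic s (wp z + c)"
    and sl: "smooth_lifted_loop s d d' \<rho>"
    and \<omega>: "\<omega> = integral {0..1} (\<lambda>t. d' t / \<rho> t) / 2" "\<omega> = \<omega>\<^sub>1 \<or> \<omega> = - \<omega>\<^sub>1"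
  shows "integral {0..1} (\<lambda>t. d t * (d' t / \<rho> t)) / 2 = c * \<omega> - 2 * \<zeta> (\<omega> / 2)"
proof -
  interpret smooth_lifted_loop s d d' \<rho> by (rule sl)
  have ode': "(p_deriv z / 2)\<^sup>2 = reduced_cubic s (wp z + c)" if "z \<notin> L" for z
    using ode[OF that] deriv_weierstrass_p[OF that] by simp
  obtain y where y: "y \<notin> L" "wp y = d 0 - c" using weierstrass_p_surj by blast
  have "(p_deriv y / 2)\<^sup>2 = (\<rho> 0)\<^sup>2" using ode'[OF y(1)] y(2) sq_\<rho>[of 0] by simp
  \<comment> \<open>Passing from y to -y keeps \<open>wp\<close> and changes the sheet, so a
    starting point over the given sheet exists.\<close>
  then have "p_deriv y / 2 = \<rho> 0 \<or> p_deriv (- y) / 2 = \<rho> 0" by (auto simp: power2_eq_iff p_deriv_minus)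
  then obtain z0 where z0: "z0 \<notin> L" "wp z0 + c = d 0" "p_deriv z0 / 2 = \<rho> 0"
    using y weierstrass_p_minus[of y] lattice_uminus_iff[of y] by (metis diff_add_cancel)
  have c_int: "continuous_on {0..1} (\<lambda>t. d' t / (2 * \<rho> t))"
    by (intro continuous_intros continuous_on_subset[OF cont_d'] cont_\<rho>) (auto simp: \<rho>_nonzero)
  define Z where "Z t = z0 + integral {0..t} (\<lambda>t. d' t / (2 * \<rho> t))" for t
  have Z: "(Z has_vector_derivative d' t / (2 * \<rho> t)) (at t within {0..1})" if "t \<in> {0..1}" for t
  proof -
    have "((\<lambda>t. z0 + integral {0..t} (\<lambda>t. d' t / (2 * \<rho> t))) has_vector_derivative 0 + d' t / (2 * \<rho> t)) (at t within {0..1})"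
      by (intro has_vector_derivative_add has_vector_derivative_const integral_has_vector_derivative[OF c_int that])
    then show ?thesis by (simp add: Z_def[abs_def])
  qed
  have Z0: "Z 0 = z0" by (simp add: Z_def)
  have lift_Z: "Z t \<notin> L \<and> wp (Z t) + c = d t \<and> p_deriv (Z t) / 2 = \<rho> t" if "t \<in> {0..1}" for t
    by (rule lift_through_uniformization[OF ode' sl _ _ _ Z that]) (use z0 Z0 in auto)
  have Z1: "Z 1 = z0 + \<omega>"
  proof -
    have "(\<lambda>t. d' t / (2 * \<rho> t)) = (\<lambda>t. 1 / 2 * (d' t / \<rho> t))" by auto
    then show ?thesis unfolding Z_def \<omega>(1) by (simp only: integral_mult_right) simp
  qed
  have "((\<lambda>t. d t * (d' t / (2 * \<rho> t))) has_integral (c * Z 1 - \<zeta> (Z 1)) - (c * Z 0 - \<zeta> (Z 0))) {0..1}"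
  proof (rule fundamental_theorem_of_calculus)
    fix t :: real assume t: "t \<in> {0..1}"
    note l = lift_Z[OF t]
    have "((\<lambda>z. c * z - \<zeta> z) has_field_derivative c * 1 - (- wp (Z t))) (at (Z t))"
      using l by (intro DERIV_diff[OF DERIV_cmult[OF DERIV_ident] weierstrass_zeta_derivative]) auto
    then have "(((\<lambda>z. c * z - \<zeta> z) \<circ> Z) has_vector_derivative d' t / (2 * \<rho> t) * (c * 1 - (- wp (Z t)))) (at t within {0..1})"
      using field_vector_diff_chain_within[OF Z[OF t] has_field_derivative_at_within] by blast
    moreover have "c * 1 - (- wp (Z t)) = d t" using l by (simp add: add.commute)
    ultimately show "((\<lambda>t. c * Z t - \<zeta> (Z t)) has_vector_derivative d t * (d' t / (2 * \<rho> t))) (at t within {0..1})"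
      by (simp add: o_def mult.commute)
  qed simp
  then have *: "integral {0..1} (\<lambda>t. d t * (d' t / (2 * \<rho> t))) = (c * Z 1 - \<zeta> (Z 1)) - (c * Z 0 - \<zeta> (Z 0))"
    by (rule integral_unique)
  have "(\<lambda>t. d t * (d' t / (2 * \<rho> t))) = (\<lambda>t. 1 / 2 * (d t * (d' t / \<rho> t)))" by auto
  then have "integral {0..1} (\<lambda>t. d t * (d' t / (2 * \<rho> t))) = integral {0..1} (\<lambda>t. d t * (d' t / \<rho> t)) / 2"
    by (simp only: integral_mult_right) simp
  with * have "integral {0..1} (\<lambda>t. d t * (d' t / \<rho> t)) / 2 = (c * Z 1 - \<zeta> (Z 1)) - (c * Z 0 - \<zeta> (Z 0))"
    by (rule trans[OF sym, rotated])
  moreover have "\<zeta> (z0 + \<omega>) - \<zeta> z0 = 2 * \<zeta> (\<omega> / 2)"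
    by (rule weierstrass_zeta_quasiperiodic[OF \<omega>(2) z0(1)])
  ultimately show ?thesis unfolding Z0 Z1 by (simp add: algebra_simps)
qed

end


text \<open>As \<open>s\<close> is closer to \<open>s\<^sub>0\<close> than \<open>x\<close> is, the
  quotient lies in the unit disc around 1. Its principal root is then holomorphic in
  \<open>s\<close>.\<close>

lemma Re_quotient_pos:
  fixes x s\<^sub>0 s :: complex
  assumes "dist s\<^sub>0 s < r" "r \<le> dist x s\<^sub>0"
  shows "Re ((x - s) / (x - s\<^sub>0)) > 0"
proof -
  have nz: "x \<noteq> s\<^sub>0" using assms zero_le_dist[of s\<^sub>0 s] by (metis dist_self leD order_le_less_trans)
  have "norm ((s - s\<^sub>0) / (x - s\<^sub>0)) < 1"
    using assms nz by (simp add: norm_divide dist_norm norm_minus_commute)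
  then have "Re ((s - s\<^sub>0) / (x - s\<^sub>0)) < 1"
    using complex_Re_le_cmod order_le_less_trans by blast
  moreover have "(x - s) / (x - s\<^sub>0) = 1 - (s - s\<^sub>0) / (x - s\<^sub>0)"
    using nz by (simp add: field_simps)
  ultimately show ?thesis by simp
qed

lemma has_field_derivative_csqrt_Re_pos:
  "Re z > 0 \<Longrightarrow> (csqrt has_field_derivative 1 / (2 * csqrt z)) (at z)"
  using has_field_derivative_csqrt[of z] by (simp add: complex_nonpos_Reals_iff inverse_eq_divide)

text \<open>One loop serves all nearby s. Only the factor \<lambda> - s of the cubic changes, so
  multiplying the given lift by the principal root of (\<lambda> - s)/(\<lambda> -
  \<open>s\<^sub>0\<close>) yields a lift that is continuous in the pair (s, t) and holomorphic in
  s.\<close>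

lemma period_family:
  assumes sl: "smooth_lifted_loop s\<^sub>0 d d' \<rho>" and r: "r > 0" "\<And>t. t \<in> {0..1} \<Longrightarrow> r \<le> dist (d t) s\<^sub>0"
  obtains \<rho>s where "\<And>s. s \<in> ball s\<^sub>0 r \<Longrightarrow> smooth_lifted_loop s d d' (\<rho>s s)"
    "\<And>s. s \<in> ball s\<^sub>0 r \<Longrightarrow> ((\<lambda>s. integral {0..1} (\<lambda>t. d' t / \<rho>s s t)) has_field_derivative
        integral {0..1} (\<lambda>t. d' t / (2 * (d t - s) * \<rho>s s t))) (at s)"
proof -
  interpret l0: smooth_lifted_loop s\<^sub>0 d d' \<rho> by (rule sl)
  define \<kappa> where "\<kappa> s t = csqrt ((d t - s) / (d t - s\<^sub>0))" for s t
  define \<rho>s where "\<rho>s s t = \<rho> t * \<kappa> s t" for s t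
  have Re: "Re ((d t - s) / (d t - s\<^sub>0)) > 0" if "s \<in> ball s\<^sub>0 r" "t \<in> {0..1}" for s t
    using that r(2) by (intro Re_quotient_pos[where r = r]) auto
  have nz: "d t - s\<^sub>0 \<noteq> 0" "d t - s \<noteq> 0" "\<kappa> s t \<noteq> 0" if "s \<in> ball s\<^sub>0 r" "t \<in> {0..1}" for s t
  proof -
    show "d t - s\<^sub>0 \<noteq> 0" using r(2)[OF that(2)] r(1) by auto
    show "d t - s \<noteq> 0" "\<kappa> s t \<noteq> 0" using Re[OF that] by (auto simp: \<kappa>_def)
  qed
  have \<kappa>2: "\<kappa> s t ^ 2 * (d t - s\<^sub>0) = d t - s" if "s \<in> ball s\<^sub>0 r" "t \<in> {0..1}" for s t
    using nz[OF that] by (simp add: \<kappa>_def)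
  have cont_\<kappa>: "continuous_on (ball s\<^sub>0 r \<times> {0..1}) (\<lambda>x. \<kappa> (fst x) (snd x))"
  proof -
    have "continuous_on {z. Re z > 0} csqrt"
      by (intro continuous_at_imp_continuous_on ballI DERIV_isCont[OF has_field_derivative_csqrt_Re_pos]) auto
    then show ?thesis unfolding \<kappa>_def
      by (rule continuous_on_compose2)
        (use Re nz(1) in \<open>auto intro!: continuous_intros continuous_on_compose2[OF l0.cont_d[of UNIV]] simp del: Re_divide\<close>)
  qed
  have sl': "smooth_lifted_loop s d d' (\<rho>s s)" if s: "s \<in> ball s\<^sub>0 r" for s
  proof
    show "(d has_vector_derivative d' t) (at t)" for t by (rule l0.der)
    show "continuous_on UNIV d'" "d 1 = d 0" by (rule l0.cont_d' l0.loop)+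
    show "d t \<in> - {0, 1, s}" if "t \<in> {0..1}" for t using l0.avoid[OF that] nz[OF s that] by auto
    have "continuous_on {0..1} (\<lambda>t. \<kappa> (fst (s, t)) (snd (s, t)))"
      by (rule continuous_on_compose2[OF cont_\<kappa>]) (use s in \<open>auto intro!: continuous_intros\<close>)
    then have "continuous_on {0..1} (\<lambda>t. \<kappa> s t)" by simp
    then have "continuous_on {0..1} (\<rho>s s)" unfolding \<rho>s_def by (intro continuous_intros l0.cont_\<rho>)
    moreover have "\<rho>s s 1 = \<rho>s s 0" by (simp add: \<rho>s_def \<kappa>_def l0.loop l0.\<rho>_closed)
    moreover have "\<rho>s s t ^ 2 = reduced_cubic s (d t)" if t: "t \<in> {0..1}" for t
      using l0.sq_\<rho>[OF t] \<kappa>2[OF s t] by (simp add: \<rho>s_def power_mult_distrib reduced_cubic_def mult_ac)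
    ultimately show "lifts_to_curve (reduced_cubic s) d (\<rho>s s)"
      by (simp add: lifts_to_curve_def path_def pathstart_def pathfinish_def)
  qed
  show thesis
  proof (rule that[OF sl'])
    fix s assume s: "s \<in> ball s\<^sub>0 r"
    have "((\<lambda>s. integral (cbox 0 1) (\<lambda>t. d' t / \<rho>s s t)) has_field_derivative
        integral (cbox 0 1) (\<lambda>t. d' t / (2 * (d t - s) * \<rho>s s t))) (at s within ball s\<^sub>0 r)"
    proof (rule leibniz_rule_field_derivative[OF _ _ _ s convex_ball])
      fix s t assume s: "s \<in> ball s\<^sub>0 r" and t: "t \<in> cbox (0::real) 1"
      then have t01: "t \<in> {0..1}" by simp
      note n = nz[OF s t01] l0.\<rho>_nonzero[OF t01]
      have "((\<lambda>s. (d t - s) / (d t - s\<^sub>0)) has_field_derivative (0 - 1) / (d t - s\<^sub>0)) (at s)"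
        by (intro DERIV_cdivide DERIV_diff DERIV_const DERIV_ident)
      from DERIV_chain2[OF has_field_derivative_csqrt_Re_pos[OF Re[OF s t01]] this]
      have \<kappa>': "((\<lambda>s. \<kappa> s t) has_field_derivative 1 / (2 * \<kappa> s t) * ((0 - 1) / (d t - s\<^sub>0))) (at s)"
        unfolding \<kappa>_def .
      have "((\<lambda>s. d' t / \<rho> t * inverse (\<kappa> s t)) has_field_derivative
         d' t / \<rho> t * - (inverse (\<kappa> s t) * (1 / (2 * \<kappa> s t) * ((0 - 1) / (d t - s\<^sub>0))) * inverse (\<kappa> s t))) (at s)"
        by (intro DERIV_cmult DERIV_inverse'[OF \<kappa>'] n)
      moreover have "d' t / \<rho> t * - (inverse (\<kappa> s t) * (1 / (2 * \<kappa> s t) * ((0 - 1) / (d t - s\<^sub>0))) * inverse (\<kappa> s t)) =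
          d' t / (2 * (\<kappa> s t ^ 2 * (d t - s\<^sub>0)) * (\<rho> t * \<kappa> s t))"
        using n by (simp add: field_simps power2_eq_square)
      ultimately have "((\<lambda>s. d' t / \<rho> t * inverse (\<kappa> s t)) has_field_derivative d' t / (2 * (d t - s) * \<rho>s s t)) (at s)"
        unfolding \<kappa>2[OF s t01] \<rho>s_def by simp
      then show "((\<lambda>s. d' t / \<rho>s s t) has_field_derivative d' t / (2 * (d t - s) * \<rho>s s t)) (at s within ball s\<^sub>0 r)"
        by (simp add: \<rho>s_def divide_inverse has_field_derivative_at_within mult_ac)
    next
      fix s assume "s \<in> ball s\<^sub>0 r"
      from smooth_lifted_loop.integrable_over_lift[OF sl'[OF this], of "\<lambda>_. 1"]
      show "(\<lambda>t. d' t / \<rho>s s t) integrable_on cbox 0 1" by simp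
    next
      show "continuous_on (ball s\<^sub>0 r \<times> cbox 0 1) (\<lambda>(s, t). d' t / (2 * (d t - s) * \<rho>s s t))"
      proof -
        let ?X = "ball s\<^sub>0 r \<times> {0..1::real}"
        have sub: "snd ` ?X \<subseteq> {0..1}" by auto
        have c1: "continuous_on ?X (\<lambda>x. d (snd x))"
          by (rule continuous_on_compose2[OF l0.cont_d continuous_on_snd[OF continuous_on_id] subset_UNIV])
        have c2: "continuous_on ?X (\<lambda>x. d' (snd x))"
          by (rule continuous_on_compose2[OF l0.cont_d' continuous_on_snd[OF continuous_on_id] subset_UNIV])
        have c3: "continuous_on ?X (\<lambda>x. \<rho> (snd x))"
          by (rule continuous_on_compose2[OF l0.cont_\<rho> continuous_on_snd[OF continuous_on_id] sub])
        have nz': "2 * (d (snd x) - fst x) * (\<rho> (snd x) * \<kappa> (fst x) (snd x)) \<noteq> 0" if "x \<in> ?X" for x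
          using nz(2,3)[of "fst x" "snd x"] l0.\<rho>_nonzero[of "snd x"] that by (simp add: mem_Times_iff)
        have "continuous_on ?X (\<lambda>x. d' (snd x) / (2 * (d (snd x) - fst x) * (\<rho> (snd x) * \<kappa> (fst x) (snd x))))"
          by (intro continuous_on_divide continuous_on_mult continuous_on_diff continuous_on_const continuous_on_fst
             continuous_on_id c1 c2 c3 cont_\<kappa> ballI nz')
        then show ?thesis by (simp add: \<rho>s_def split_beta)
      qed
    qed
    then show "((\<lambda>s. integral {0..1} (\<lambda>t. d' t / \<rho>s s t)) has_field_derivative
        integral {0..1} (\<lambda>t. d' t / (2 * (d t - s) * \<rho>s s t))) (at s)"
      using s by (simp add: at_within_open[OF _ open_ball])
  qed auto
qed

text \<open>\<open>F\<close> is a holomorphic substitute, up to sign, for the period over \<delta>: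
  the same integral along a polynomial loop homotopic to \<delta>. Its differential equation
  combines \<open>exact_form_relation\<close> with the uniformized value of the integral of
  \<lambda> d\<lambda>/\<rho>. It has no zeros because F/2 is, up to sign, a generator of a
  lattice.\<close>

lemma reduced_period:
  assumes s0: "s\<^sub>0 \<noteq> 0" "s\<^sub>0 \<noteq> 1" and \<delta>: "encircles_cut \<delta> 0 1 {s\<^sub>0}"
    and unif: "\<forall>\<^sub>F s in nhds s\<^sub>0. uniformizing_periods s (\<omega>\<^sub>1_bar s \<delta>) (\<omega>\<^sub>2 s)"
  obtains r F F' where "r > 0" "\<And>s. s \<in> ball s\<^sub>0 r \<Longrightarrow> s \<noteq> 0 \<and> s \<noteq> 1 \<and>
     (F has_field_derivative F' s) (at s) \<and> F s \<noteq> 0 \<and> (cycle_period (reduced_cubic s) \<delta>)\<^sup>2 = (F s)\<^sup>2 \<and>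
     2 * s * (s - 1) * F' s = (I_bar s (\<omega>\<^sub>1_bar s \<delta>) (\<omega>\<^sub>2 s) - s) * F s \<and>
     (\<exists>\<rho>. lifts_to_curve (reduced_cubic s) \<delta> \<rho>)"
proof -
  note ec = encircled_cut_lifts[OF \<delta>]
  have path: "path \<delta>" using ec(3) by (rule valid_path_imp_path)
  have "compact (path_image \<delta>)" using path by (rule compact_path_image)
  then obtain e where e: "e > 0" "(\<Union>x\<in>path_image \<delta>. ball x e) \<subseteq> - {0, 1, s\<^sub>0}"
    using compact_subset_open_imp_ball_epsilon_subset[OF _ open_compl_branch_points ec(2)] by metis
  have far: "dist (\<delta> t) x \<ge> e" if "t \<in> {0..1}" "x \<in> {0, 1, s\<^sub>0}" for t x
  proof (rule ccontr)
    assume "\<not> e \<le> dist (\<delta> t) x"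
    then have "x \<in> ball (\<delta> t) e" by simp
    moreover have "\<delta> t \<in> path_image \<delta>" using that(1) by (auto simp: path_image_def)
    ultimately have "x \<in> - {0, 1, s\<^sub>0}" using e(2) by blast
    then show False using that(2) by blast
  qed
  obtain d where d: "polynomial_function d" "pathstart d = pathstart \<delta>" "pathfinish d = pathfinish \<delta>"
     "\<And>t. t \<in> {0..1} \<Longrightarrow> norm (d t - \<delta> t) < e / 4"
    using path_approx_polynomial_function[OF path, of "e / 4"] e(1) by auto
  obtain d' where d': "polynomial_function d'" "\<And>t. (d has_vector_derivative d' t) (at t)"
    using has_vector_derivative_polynomial_function[OF d(1)] by metis
  have vd: "valid_path d" using d(1) by (rule valid_path_polynomial_function)
  \<comment> \<open>The loop \<delta> keeps distance e from 0, 1 and \<open>s\<^sub>0\<close>, hence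
    more than e/2 from a point \<open>s\<close> within e/4 of \<open>s\<^sub>0\<close>. The
    approximation error e/4 is smaller, so the segments from \<delta> to \<open>d\<close> avoid all
    excluded points, simultaneously for all such \<open>s\<close>.\<close>
  have hom: "homotopic_loops (- {0, 1, s}) \<delta> d" if s: "s \<in> ball s\<^sub>0 (e / 4)" for s
  proof (rule homotopic_loops_nearby_explicit[OF path valid_path_imp_path[OF vd] ec(4)])
    show "pathfinish d = pathstart d" using d(2,3) ec(4) by simp
    fix t x assume t: "t \<in> {0..1::real}" and "x \<notin> - {0, 1, s}"
    then have "x \<in> {0, 1, s\<^sub>0} \<or> x = s" by auto
    then have "norm (\<delta> t - x) \<ge> e / 2"
    proof
      assume "x \<in> {0, 1, s\<^sub>0}"
      then show ?thesis using far[OF t] e(1) by (force simp: dist_norm)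
    next
      assume "x = s"
      then show ?thesis using far[OF t, of s\<^sub>0] dist_triangle[of "\<delta> t" s\<^sub>0 s] s e(1) by (simp add: dist_norm norm_minus_commute)
    qed
    then show "norm (d t - \<delta> t) < norm (\<delta> t - x)" using d(4)[OF t] e(1) by simp
  qed
  obtain \<rho>\<delta> where "lifts_to_curve (reduced_cubic s\<^sub>0) \<delta> \<rho>\<delta>" using ec(1) by blast
  moreover have "homotopic_loops (- {0, 1, s\<^sub>0}) \<delta> d" by (rule hom) (use e(1) in simp)
  ultimately obtain \<rho> where \<rho>: "lifts_to_curve (reduced_cubic s\<^sub>0) d \<rho>"
    using cycle_period_homotopic(1)[OF ec(3) vd _ _ open_compl_branch_points reduced_cubic_holomorphic reduced_cubic_nonzero]
    by blast
  have far_d: "e / 4 \<le> dist (d t) x" if "t \<in> {0..1}" "x \<in> {0, 1, s\<^sub>0}" for t x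
    using far[OF that] d(4)[OF that(1)] dist_triangle[of "\<delta> t" x "d t"] e(1) by (simp add: dist_norm norm_minus_commute)
  have sl: "smooth_lifted_loop s\<^sub>0 d d' \<rho>"
  proof
    show "continuous_on UNIV d'" using d'(1) by (rule continuous_on_polymonial_function)
    show "d 1 = d 0" using d(2,3) ec(4) by (simp add: pathstart_def pathfinish_def)
    show "d t \<in> - {0, 1, s\<^sub>0}" if "t \<in> {0..1}" for t
      using far_d[OF that] e(1) by fastforce
  qed (use d' \<rho> in auto)
  obtain \<rho>s where \<rho>s: "\<And>s. s \<in> ball s\<^sub>0 (e / 4) \<Longrightarrow> smooth_lifted_loop s d d' (\<rho>s s)"
    "\<And>s. s \<in> ball s\<^sub>0 (e / 4) \<Longrightarrow> ((\<lambda>s. integral {0..1} (\<lambda>t. d' t / \<rho>s s t)) has_field_derivative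
        integral {0..1} (\<lambda>t. d' t / (2 * (d t - s) * \<rho>s s t))) (at s)"
    by (rule period_family[OF sl, of "e / 4"]) (use e(1) far_d in auto)
  define F where "F s = integral {0..1} (\<lambda>t. d' t / \<rho>s s t)" for s
  define F' where "F' s = integral {0..1} (\<lambda>t. d' t / (2 * (d t - s) * \<rho>s s t))" for s
  obtain r1 where r1: "r1 > 0" "\<And>s. dist s s\<^sub>0 < r1 \<Longrightarrow> uniformizing_periods s (\<omega>\<^sub>1_bar s \<delta>) (\<omega>\<^sub>2 s)"
    using unif unfolding eventually_nhds_metric by metis
  define r where "r = Min {e / 4, r1, dist s\<^sub>0 0, dist s\<^sub>0 1}"
  have r: "r > 0" "r \<le> e / 4" "r \<le> r1" "r \<le> dist s\<^sub>0 0" "r \<le> dist s\<^sub>0 1"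
    using e(1) r1(1) s0 by (auto simp: r_def)
  show thesis
  proof (rule that[OF r(1)])
    fix s assume s: "s \<in> ball s\<^sub>0 r"
    then have s': "s \<in> ball s\<^sub>0 (e / 4)" and s1: "dist s s\<^sub>0 < r1" and sn: "s \<noteq> 0" "s \<noteq> 1"
      using r by (auto simp: dist_commute)
    interpret l: smooth_lifted_loop s d d' "\<rho>s s" by (rule \<rho>s(1)[OF s'])
    have hom': "homotopic_loops (- {0, 1, s}) d \<delta>" using hom[OF s'] by (rule homotopic_loops_sym)
    note ch = cycle_period_homotopic[OF vd ec(3) hom' l.lift open_compl_branch_points reduced_cubic_holomorphic reduced_cubic_nonzero]
    have cp: "(cycle_period (reduced_cubic s) \<delta>)\<^sup>2 = (F s)\<^sup>2"
    proof -
      have "(cycle_period (reduced_cubic s) d)\<^sup>2 = (lift_integral d (\<rho>s s))\<^sup>2"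
        by (rule cycle_period_square[OF l.lift]) (use reduced_cubic_nonzero l.avoid in blast)
      then show ?thesis using ch(2) by (simp add: l.lift_integral_eq F_def)
    qed
    define w where "w = \<omega>\<^sub>1_bar s \<delta>"
    have up: "uniformizing_periods s w (\<omega>\<^sub>2 s)" using r1(2)[OF s1] by (simp add: w_def)
    then interpret W: complex_lattice w "\<omega>\<^sub>2 s" by unfold_locales (simp add: uniformizing_periods_def)
    have "(F s / 2)\<^sup>2 = w\<^sup>2" using cp by (simp add: w_def \<omega>\<^sub>1_bar_def power_divide)
    then have Fw: "F s / 2 = w \<or> F s / 2 = - w" by (simp add: power2_eq_iff)
    then have Fnz: "F s \<noteq> 0" using W.period_nonzero by auto
    let ?c = "(s + 1) / 3"
    let ?J = "integral {0..1} (\<lambda>t. d t * (d' t / \<rho>s s t))"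
    have "?J / 2 = ?c * (F s / 2) - 2 * weierstrass_zeta w (\<omega>\<^sub>2 s) (F s / 2 / 2)"
      by (rule W.integral_over_uniformized_cycle[OF _ \<rho>s(1)[OF s'] _ Fw]) (use up in \<open>auto simp: uniformizing_periods_def F_def\<close>)
    \<comment> \<open>Both signs of F/2 give the same quotient of \<zeta> by the period, since
      \<zeta> is odd.\<close>
    also have "2 * weierstrass_zeta w (\<omega>\<^sub>2 s) (F s / 2 / 2) = 2 * weierstrass_zeta w (\<omega>\<^sub>2 s) (w / 2) / w * (F s / 2)"
      using Fw
    proof
      assume "F s / 2 = w"
      then show ?thesis using W.period_nonzero by simp
    next
      assume *: "F s / 2 = - w"
      have "weierstrass_zeta w (\<omega>\<^sub>2 s) (- w / 2) = - weierstrass_zeta w (\<omega>\<^sub>2 s) (w / 2)"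
        using W.weierstrass_zeta_minus[of "w / 2"] by simp
      then show ?thesis unfolding * using W.period_nonzero by simp
    qed
    finally have "?J = I_bar s w (\<omega>\<^sub>2 s) * F s" by (simp add: I_bar_def algebra_simps)
    then have rel: "2 * s * (s - 1) * F' s = (I_bar s w (\<omega>\<^sub>2 s) - s) * F s"
      using l.exact_form_relation by (simp add: F_def F'_def algebra_simps)
    show "s \<noteq> 0 \<and> s \<noteq> 1 \<and>
     (F has_field_derivative F' s) (at s) \<and> F s \<noteq> 0 \<and> (cycle_period (reduced_cubic s) \<delta>)\<^sup>2 = (F s)\<^sup>2 \<and>
     2 * s * (s - 1) * F' s = (I_bar s (\<omega>\<^sub>1_bar s \<delta>) (\<omega>\<^sub>2 s) - s) * F s \<and>
     (\<exists>\<rho>. lifts_to_curve (reduced_cubic s) \<delta> \<rho>)"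
    proof (intro conjI)
      show "(F has_field_derivative F' s) (at s)" using \<rho>s(2)[OF s'] unfolding F_def[abs_def] F'_def .
      show "2 * s * (s - 1) * F' s = (I_bar s (\<omega>\<^sub>1_bar s \<delta>) (\<omega>\<^sub>2 s) - s) * F s" using rel unfolding w_def .
    qed (rule sn Fnz cp ch(1))+
  qed
qed

section \<open>The matrices\<close>

text \<open>When v moves, so do the excluded point \<open>cr v\<close> and the loop
  \<open>f v o \<gamma>\<close>. The compact image of the homotopy at \<open>v\<^sub>0\<close> has a
  distance \<epsilon> from the excluded points. It stays admissible while \<open>cr v\<close> moves
  by less than \<epsilon>/2, and uniform continuity keeps the loop within \<epsilon>/2 of its old
  position, where a straight-line homotopy works.\<close>

lemma homotopic_loops_stable:
  fixes f :: "'v::euclidean_space \<Rightarrow> complex \<Rightarrow> complex" and cr :: "'v \<Rightarrow> complex"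
  assumes e: "e > 0" and c: "continuous_on (cball v\<^sub>0 e \<times> {0..1}) (\<lambda>(v, t). f v (\<gamma> t))"
    and cr: "(cr \<longlongrightarrow> cr v\<^sub>0) (nhds v\<^sub>0)"
    and hom: "homotopic_loops (- {0, 1, cr v\<^sub>0}) (f v\<^sub>0 \<circ> \<gamma>) \<delta>" and loop: "pathfinish \<gamma> = pathstart \<gamma>"
  shows "\<forall>\<^sub>F v in nhds v\<^sub>0. homotopic_loops (- {0, 1, cr v}) \<delta> (f v \<circ> \<gamma>)"
proof -
  obtain H where H: "continuous_on ({0..1::real} \<times> {0..1}) H" "H \<in> ({0..1} \<times> {0..1}) \<rightarrow> - {0, 1, cr v\<^sub>0}"
     "\<forall>x \<in> {0..1}. H (0,x) = (f v\<^sub>0 \<circ> \<gamma>) x" "\<forall>x \<in> {0..1}. H (1,x) = \<delta> x"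
     "\<forall>t \<in> {0..1}. pathfinish (H \<circ> Pair t) = pathstart (H \<circ> Pair t)"
    using hom unfolding homotopic_loops by blast
  let ?K = "H ` ({0..1} \<times> {0..1})"
  have "compact ?K" by (intro compact_continuous_image H compact_Times) auto
  then obtain \<epsilon> where \<epsilon>: "\<epsilon> > 0" "(\<Union>x\<in>?K. ball x \<epsilon>) \<subseteq> - {0, 1, cr v\<^sub>0}"
    using compact_subset_open_imp_ball_epsilon_subset[OF _ open_compl_branch_points] H(2) by (metis image_subset_iff_funcset)
  have far: "dist x y \<ge> \<epsilon>" if "x \<in> ?K" "y \<in> {0, 1, cr v\<^sub>0}" for x y
  proof (rule ccontr)
    assume "\<not> \<epsilon> \<le> dist x y"
    then have "y \<in> ball x \<epsilon>" by simp
    then have "y \<in> - {0, 1, cr v\<^sub>0}" using \<epsilon>(2) that(1) by blast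
    then show False using that(2) by blast
  qed
  have far': "dist x y \<ge> \<epsilon> / 2" if "x \<in> ?K" "y \<in> {0, 1, s}" "dist s (cr v\<^sub>0) < \<epsilon> / 2" for x y s
  proof (cases "y = s")
    case True
    then show ?thesis
      using far[OF that(1), of "cr v\<^sub>0"] dist_triangle[of x "cr v\<^sub>0" s] that(3) by simp
  next
    case False
    then show ?thesis using far[OF that(1), of y] that(2) \<epsilon>(1) by auto
  qed
  have "uniformly_continuous_on (cball v\<^sub>0 e \<times> {0..1}) (\<lambda>(v, t). f v (\<gamma> t))"
    by (rule compact_uniformly_continuous[OF c]) (intro compact_Times, auto)
  then obtain d where d: "d > 0" "\<And>p q. p \<in> cball v\<^sub>0 e \<times> {0..1} \<Longrightarrow> q \<in> cball v\<^sub>0 e \<times> {0..1} \<Longrightarrow> dist q p < d \<Longrightarrow>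
     dist ((\<lambda>(v, t). f v (\<gamma> t)) q) ((\<lambda>(v, t). f v (\<gamma> t)) p) < \<epsilon> / 2"
    unfolding uniformly_continuous_on_def using half_gt_zero[OF \<epsilon>(1)] by metis
  have path: "path (f v \<circ> \<gamma>)" if "v \<in> cball v\<^sub>0 e" for v
  proof -
    have "continuous_on {0..1} (\<lambda>t. (\<lambda>(v, t). f v (\<gamma> t)) (v, t))"
      by (rule continuous_on_compose2[OF c]) (use that in \<open>auto intro!: continuous_intros\<close>)
    then show ?thesis by (simp add: path_def o_def)
  qed
  have "\<forall>\<^sub>F v in nhds v\<^sub>0. dist (cr v) (cr v\<^sub>0) < \<epsilon> / 2" using cr \<epsilon>(1) by (intro tendstoD) auto
  moreover have "\<forall>\<^sub>F v in nhds v\<^sub>0. v \<in> ball v\<^sub>0 (min d e)"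
    using e d(1) by (intro eventually_nhds_in_open) auto
  ultimately show ?thesis
  proof eventually_elim
    case (elim v)
    have v: "v \<in> cball v\<^sub>0 e" "v\<^sub>0 \<in> cball v\<^sub>0 e" "dist v v\<^sub>0 < d" using elim e by (auto simp: dist_commute)
    have "?K \<subseteq> - {0, 1, cr v}"
    proof
      fix x assume "x \<in> ?K"
      from far'[OF this _ elim(1)] show "x \<in> - {0, 1, cr v}" using \<epsilon>(1) by fastforce
    qed
    then have "H \<in> ({0..1} \<times> {0..1}) \<rightarrow> - {0, 1, cr v}" by blast
    then have "homotopic_loops (- {0, 1, cr v}) (f v\<^sub>0 \<circ> \<gamma>) \<delta>"
      unfolding homotopic_loops using H(1,3,4,5) by blast
    then have 1: "homotopic_loops (- {0, 1, cr v}) \<delta> (f v\<^sub>0 \<circ> \<gamma>)" by (rule homotopic_loops_sym)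
    have "homotopic_loops (- {0, 1, cr v}) (f v\<^sub>0 \<circ> \<gamma>) (f v \<circ> \<gamma>)"
    proof (rule homotopic_loops_nearby_explicit[OF path[OF v(2)] path[OF v(1)]])
      show "pathfinish (f v\<^sub>0 \<circ> \<gamma>) = pathstart (f v\<^sub>0 \<circ> \<gamma>)" "pathfinish (f v \<circ> \<gamma>) = pathstart (f v \<circ> \<gamma>)"
        using loop by (simp_all add: pathstart_compose pathfinish_compose)
      fix t x assume t: "t \<in> {0..1::real}" and x: "x \<notin> - {0, 1, cr v}"
      have "dist (v, t) (v\<^sub>0, t) < d" using v(3) by (simp add: dist_Pair_Pair)
      then have "dist (f v (\<gamma> t)) (f v\<^sub>0 (\<gamma> t)) < \<epsilon> / 2" using d(2)[of "(v\<^sub>0, t)" "(v, t)"] v t by simp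
      moreover have "f v\<^sub>0 (\<gamma> t) \<in> ?K" using H(3) t by (force intro: image_eqI[of _ _ "(0, t)"])
      then have "\<epsilon> / 2 \<le> dist (f v\<^sub>0 (\<gamma> t)) x" using far' x elim(1) by blast
      ultimately show "norm ((f v \<circ> \<gamma>) t - (f v\<^sub>0 \<circ> \<gamma>) t) < norm ((f v\<^sub>0 \<circ> \<gamma>) t - x)"
        by (simp add: dist_norm)
    qed
    with 1 show ?case by (rule homotopic_loops_trans)
  qed
qed

lemma eventually_distinct_coordinates:
  assumes "inj (($) (v\<^sub>0 :: complex ^ 'n))"
  shows "\<forall>\<^sub>F v in nhds v\<^sub>0. inj (($) v)"
proof -
  have "\<forall>\<^sub>F v in nhds v\<^sub>0. v $ i \<noteq> v $ j" if "i \<noteq> j" for i j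
  proof -
    have "((\<lambda>v. v $ i - v $ j) \<longlongrightarrow> v\<^sub>0 $ i - v\<^sub>0 $ j) (nhds v\<^sub>0)" by (intro tendsto_intros filterlim_ident)
    moreover have "v\<^sub>0 $ i - v\<^sub>0 $ j \<noteq> 0" using assms that by (auto simp: inj_on_def)
    ultimately have "\<forall>\<^sub>F v in nhds v\<^sub>0. v $ i - v $ j \<noteq> 0" by (rule tendsto_imp_eventually_ne)
    then show ?thesis by eventually_elim simp
  qed
  then have "\<forall>\<^sub>F v in nhds v\<^sub>0. \<forall>i j. i \<noteq> j \<longrightarrow> v $ i \<noteq> v $ j"
    by (intro eventually_all_finite) (auto intro: eventually_mono)
  then show ?thesis by eventually_elim (auto simp: inj_on_def)
qed

text \<open>The metric coefficient of index j is 2/(Q \<Delta>), with \<Delta> the product of the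
  differences \<open>v $ j - v $ k\<close>; only one factor of \<Delta> involves
  \<open>v $ i\<close>. Half the logarithmic derivative of the coefficient is therefore (1/(v_j -
  v_i) - l)/2, and W multiplies it by v_j - v_i and the ratio of roots.\<close>

lemma W_matrix_entry:
  fixes v :: "complex ^ 'n"
  assumes U: "open U" "v \<in> U" and dist: "inj (($) v)" and ij: "i \<noteq> j"
    and Q: "\<And>w. w \<in> U \<Longrightarrow> (\<Omega>\<^sub>1 \<gamma> w)\<^sup>2 = Q w" "Q v \<noteq> 0"
    and R: "sqrt_branch U (metric_coeff \<gamma> j) (R j)"
    and l: "((\<lambda>z. Q (\<chi> k. if k = i then z else v $ k)) has_field_derivative l * Q v) (at (v $ i))"
  shows "W_matrix R v $ i $ j = R j v / R i v * ((1 - (v $ j - v $ i) * l) / 2)"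
proof -
  define u where "u z = (\<chi> k. if k = i then z else v $ k)" for z
  have uv: "u (v $ i) = v" by (simp add: u_def vec_eq_iff)
  have cu: "continuous_on UNIV u"
    unfolding u_def
  proof (rule continuous_on_vec_lambda)
    show "continuous_on UNIV (\<lambda>z. if k = i then z else v $ k)" for k
      by (cases "k = i") auto
  qed
  then have "open (u -` U)" using U(1) by (rule open_vimage[rotated])
  then have ev: "\<forall>\<^sub>F z in nhds (v $ i). u z \<in> U"
    using eventually_nhds_in_open[of "u -` U" "v $ i"] U(2) uv by simp
  have dvj: "v $ j - v $ k \<noteq> 0" if "k \<noteq> j" for k using dist that by (auto simp: inj_on_def)
  define K where "K = (\<Prod>k\<in>UNIV - {j} - {i}. v $ j - v $ k)"
  have K: "K \<noteq> 0" unfolding K_def using dvj by (auto simp: prod_zero_iff)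
  have prod: "(\<Prod>k\<in>UNIV - {j}. u z $ j - u z $ k) = (v $ j - z) * K" for z
    using ij unfolding K_def u_def by (subst prod.remove[of _ i]) (auto intro!: prod.cong)
  have mc: "metric_coeff \<gamma> j (u z) = 2 / (Q (u z) * ((v $ j - z) * K))" if "u z \<in> U" for z
    unfolding metric_coeff_def Q(1)[OF that] prod ..
  have nz: "Q v * ((v $ j - v $ i) * K) \<noteq> 0" using Q(2) K dvj[of i] ij by auto
  let ?q' = "(0 * (Q v * ((v $ j - v $ i) * K)) - 2 * (l * Q v * ((v $ j - v $ i) * K) + ((0 - 1) * K) * Q v)) / (Q v * ((v $ j - v $ i) * K))\<^sup>2"
  have "((\<lambda>z. 2 / (Q (u z) * ((v $ j - z) * K))) has_field_derivative ?q') (at (v $ i))"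
  proof -
    have d: "((\<lambda>z. Q (u z) * ((v $ j - z) * K)) has_field_derivative l * Q v * ((v $ j - v $ i) * K) + ((0 - 1) * K) * Q (u (v $ i))) (at (v $ i))"
      unfolding u_def by (intro DERIV_mult l DERIV_cmult_right DERIV_diff DERIV_const DERIV_ident)
    show ?thesis
      by (rule DERIV_cong[OF DERIV_quotient[OF DERIV_const[of 2] d]]) (use nz in \<open>auto simp: uv power2_eq_square mult_ac\<close>)
  qed
  moreover have "\<forall>\<^sub>F z in nhds (v $ i). (R j (u z))\<^sup>2 = 2 / (Q (u z) * ((v $ j - z) * K))"
    using ev by eventually_elim (use R mc in \<open>simp add: sqrt_branch_def\<close>)
  moreover have Rv: "(R j v)\<^sup>2 = 2 / (Q v * ((v $ j - v $ i) * K))"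
    using R mc[of "v $ i"] U(2) by (simp add: sqrt_branch_def uv)
  then have Rnz: "R j v \<noteq> 0" using nz by auto
  moreover have "isCont (\<lambda>z. R j (u z)) (v $ i)"
  proof -
    have "isCont (R j) (u (v $ i))" using R U uv by (auto simp: sqrt_branch_def continuous_on_eq_continuous_at)
    moreover have "isCont u (v $ i)" using cu by (simp add: continuous_on_eq_continuous_at)
    ultimately show ?thesis by (rule isCont_o2[rotated])
  qed
  ultimately have "((\<lambda>z. R j (u z)) has_field_derivative ?q' / (2 * R j (u (v $ i)))) (at (v $ i))"
    by (intro sqrt_field_derivative) (auto simp: uv)
  then have "partial_deriv i (R j) v = ?q' / (2 * R j v)"
    unfolding partial_deriv_def u_def[symmetric] uv by (rule DERIV_imp_deriv)
  also have "?q' = (R j v)\<^sup>2 * (1 / (v $ j - v $ i) - l)"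
    unfolding Rv using nz by (simp add: divide_simps power2_eq_square) (simp add: algebra_simps)
  also have "(R j v)\<^sup>2 * (1 / (v $ j - v $ i) - l) / (2 * R j v) = R j v * (1 / (v $ j - v $ i) - l) / 2"
    using Rnz by (simp add: power2_eq_square)
  finally have "partial_deriv i (R j) v = R j v * (1 / (v $ j - v $ i) - l) / 2" .
  then show ?thesis using ij dvj[of i] by (simp add: W_matrix_def divide_simps) (simp add: algebra_simps)
qed


text \<open>The hypothesis on \<rho> says that the squared factors are the quotients of the metric
  coefficients by that of index \<open>k\<close>. One continuous root is extracted on the
  contractible set and multiplied by these factors; it cancels in every entry of W, so all signs are
  controlled by \<rho>.\<close>

lemma W_matrix_from_ratios:
  fixes U :: "(complex ^ 'n) set" and \<rho> :: "'n \<Rightarrow> complex ^ 'n \<Rightarrow> complex" and k :: 'n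
  defines "\<Delta> \<equiv> \<lambda>i v. \<Prod>j\<in>UNIV - {i}. v $ i - v $ j"
  assumes U: "open U" "contractible U" and inj: "\<And>v. v \<in> U \<Longrightarrow> inj (($) v)"
    and Q: "continuous_on U Q" "\<And>v. v \<in> U \<Longrightarrow> Q v \<noteq> 0" "\<And>v. v \<in> U \<Longrightarrow> (\<Omega>\<^sub>1 \<gamma> v)\<^sup>2 = Q v"
    and \<rho>: "\<And>i. continuous_on U (\<rho> i)" "\<And>v i. v \<in> U \<Longrightarrow> (\<rho> i v)\<^sup>2 * \<Delta> i v = \<Delta> k v"
    and l: "\<And>v i. v \<in> U \<Longrightarrow>
      ((\<lambda>z. Q (\<chi> k. if k = i then z else v $ k)) has_field_derivative l i v * Q v) (at (v $ i))"
  shows "\<exists>R. (\<forall>i. sqrt_branch U (metric_coeff \<gamma> i) (R i)) \<and>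
    (\<forall>v\<in>U. \<forall>i j. i \<noteq> j \<longrightarrow>
      W_matrix R v $ i $ j = \<rho> j v / \<rho> i v * ((1 - (v $ j - v $ i) * l i v) / 2))"
proof -
  have \<Delta>: "\<Delta> i v \<noteq> 0" if "v \<in> U" for i v
    using inj[OF that] by (auto simp: \<Delta>_def prod_zero_iff inj_on_def)
  have mc: "metric_coeff \<gamma> i v = 2 / (Q v * \<Delta> i v)" if "v \<in> U" for i v
    by (simp add: metric_coeff_def \<Delta>_def Q(3)[OF that])
  define G where "G v = 2 / (Q v * \<Delta> k v)" for v
  have "continuous_on U G"
    using \<Delta> Q(2) unfolding G_def \<Delta>_def by (intro continuous_intros Q(1)) auto
  moreover have nz: "G v \<noteq> 0" if "v \<in> U" for v
    using \<Delta>[OF that] Q(2)[OF that] by (simp add: G_def)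
  ultimately obtain R1 where R1: "continuous_on U R1" "\<And>v. v \<in> U \<Longrightarrow> G v = (R1 v)\<^sup>2"
    using continuous_sqrt_on_contractible[OF _ U(2)] by metis
  define R where "R i v = R1 v * \<rho> i v" for i v
  have RB: "sqrt_branch U (metric_coeff \<gamma> i) (R i)" for i
    unfolding sqrt_branch_def
  proof (intro conjI ballI)
    show "continuous_on U (R i)" unfolding R_def by (intro continuous_intros R1 \<rho>)
    fix v assume v: "v \<in> U"
    have "(\<rho> i v)\<^sup>2 = \<Delta> k v / \<Delta> i v" using \<rho>(2)[OF v, of i] \<Delta>[OF v] by (simp add: eq_divide_eq)
    then show "(R i v)\<^sup>2 = metric_coeff \<gamma> i v"
      unfolding R_def power_mult_distrib R1(2)[OF v, symmetric] G_def mc[OF v] using \<Delta>[OF v] Q(2)[OF v] by simp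
  qed
  show ?thesis
  proof (intro exI[of _ R] conjI allI ballI impI RB)
    fix v i j assume v: "v \<in> U" and ij: "(i::'n) \<noteq> j"
    have "W_matrix R v $ i $ j = R j v / R i v * ((1 - (v $ j - v $ i) * l i v) / 2)"
      by (rule W_matrix_entry[where Q = Q and R = R and \<gamma> = \<gamma> and l = "l i v", OF U(1) v inj[OF v] ij Q(3) Q(2)[OF v] RB l[OF v]])
    moreover have "R1 v \<noteq> 0" using R1(2)[OF v] nz[OF v] by auto
    ultimately show "W_matrix R v $ i $ j = \<rho> j v / \<rho> i v * ((1 - (v $ j - v $ i) * l i v) / 2)"
      by (simp add: R_def)
  qed
qed
lemma cycle_period_homotopic_change:
  assumes \<gamma>: "valid_path \<gamma>" "pathfinish \<gamma> = pathstart \<gamma>" "path_image \<gamma> \<subseteq> T" and f: "open T" "f holomorphic_on T"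
    and m: "continuous_on (path_image \<gamma>) m" "\<And>x. x \<in> path_image \<gamma> \<Longrightarrow> m x \<noteq> 0"
    and Q: "\<And>x. x \<in> path_image \<gamma> \<Longrightarrow> reduced_cubic s (f x) * (m x)\<^sup>2 = P x"
    and k: "\<And>x. x \<in> path_image \<gamma> \<Longrightarrow> deriv f x * m x = k"
    and \<delta>: "valid_path \<delta>" and hom: "homotopic_loops (- {0, 1, s}) \<delta> (f \<circ> \<gamma>)"
    and \<rho>: "lifts_to_curve (reduced_cubic s) \<delta> \<rho>"
  shows "(cycle_period (reduced_cubic s) \<delta>)\<^sup>2 = k\<^sup>2 * (cycle_period P \<gamma>)\<^sup>2"
proof -
  have vp: "valid_path (f \<circ> \<gamma>)" by (rule valid_path_compose_holomorphic[OF \<gamma>(1) f(2,1) \<gamma>(3)])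
  note ch = cycle_period_homotopic[OF \<delta> vp hom \<rho> open_compl_branch_points reduced_cubic_holomorphic reduced_cubic_nonzero]
  obtain \<rho>' where \<rho>': "lifts_to_curve (reduced_cubic s) (f \<circ> \<gamma>) \<rho>'" using ch(1) by blast
  have "f x \<in> - {0, 1, s}" if "x \<in> path_image \<gamma>" for x
    using homotopic_loops_imp_subset[OF hom] that by (auto simp: path_image_compose)
  then have "(cycle_period (reduced_cubic s) (f \<circ> \<gamma>))\<^sup>2 = k\<^sup>2 * (cycle_period P \<gamma>)\<^sup>2"
    by (intro cycle_period_change_of_variable[OF \<gamma>(1,3) f m Q _ k \<gamma>(2) \<rho>'] reduced_cubic_nonzero) auto
  with ch(2) show ?thesis by simp
qed


text \<open>Periods are products and quotients of differences and of \<open>F\<close>; in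
  logarithmic form their derivatives simply add. Nonvanishing is included so that the rule for
  quotients is closed.\<close>

definition has_log_derivative :: "(complex \<Rightarrow> complex) \<Rightarrow> complex \<Rightarrow> complex \<Rightarrow> bool" where
  "has_log_derivative f l x \<longleftrightarrow> f x \<noteq> 0 \<and> (f has_field_derivative l * f x) (at x)"

lemma has_log_derivative_mult:
  "has_log_derivative f l x \<Longrightarrow> has_log_derivative g m x \<Longrightarrow> has_log_derivative (\<lambda>z. f z * g z) (l + m) x"
  by (auto simp: has_log_derivative_def algebra_simps intro!: derivative_eq_intros)

lemma has_log_derivative_divide:
  "has_log_derivative f l x \<Longrightarrow> has_log_derivative g m x \<Longrightarrow> has_log_derivative (\<lambda>z. f z / g z) (l - m) x"
  by (auto simp: has_log_derivative_def field_simps intro!: derivative_eq_intros)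

lemma has_log_derivative_minus:
  "has_log_derivative f l x \<Longrightarrow> has_log_derivative (\<lambda>z. - f z) l x"
  by (auto simp: has_log_derivative_def intro!: derivative_eq_intros)

lemma has_log_derivative_square:
  "has_log_derivative f l x \<Longrightarrow> has_log_derivative (\<lambda>z. (f z)\<^sup>2) (2 * l) x"
  using has_log_derivative_mult[of f l x f l] by (simp add: power2_eq_square)

lemma has_log_derivative_compose:
  assumes "has_log_derivative f l x" "(F has_field_derivative D) (at (f x))" "F (f x) \<noteq> 0"
  shows "has_log_derivative (\<lambda>z. F (f z)) (D / F (f x) * f x * l) x"
  using DERIV_chain2[of F D f x "l * f x"] assms by (auto simp: has_log_derivative_def mult_ac)

lemma has_log_derivative_coordinates:
  assumes "(v :: complex ^ 'n) $ a \<noteq> v $ b"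
  shows "has_log_derivative (\<lambda>z. (\<chi> k. if k = i then z else v $ k) $ a - (\<chi> k. if k = i then z else v $ k) $ b)
    (((if a = i then 1 else 0) - (if b = i then 1 else 0)) / (v $ a - v $ b)) (v $ i)"
proof -
  have "((\<lambda>z. if c = i then z else v $ c) has_field_derivative (if c = i then 1 else 0)) (at (v $ i))" for c
    by (cases "c = i") simp_all
  then have "((\<lambda>z. (if a = i then z else v $ a) - (if b = i then z else v $ b)) has_field_derivative
      (if a = i then 1 else 0) - (if b = i then 1 else 0)) (at (v $ i))"
    by (intro DERIV_diff)
  moreover have "(if c = i then v $ i else v $ c) = v $ c" for c by simp
  ultimately show ?thesis using assms by (simp add: has_log_derivative_def)
qed

section \<open>The algebra of the matrix entries\<close>

lemma vector_4 [simp]: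
  "(vector [w, x, y, z] :: 'a::zero ^ 4) $ 1 = w"
  "(vector [w, x, y, z] :: 'a::zero ^ 4) $ 2 = x"
  "(vector [w, x, y, z] :: 'a::zero ^ 4) $ 3 = y"
  "(vector [w, x, y, z] :: 'a::zero ^ 4) $ 4 = z"
  unfolding vector_def by simp_all

lemma prod_Diff_4:
  fixes f :: "4 \<Rightarrow> complex"
  shows "prod f (UNIV - {1}) = f 2 * f 3 * f 4" "prod f (UNIV - {2}) = f 1 * f 3 * f 4"
    "prod f (UNIV - {3}) = f 1 * f 2 * f 4" "prod f (UNIV - {4}) = f 1 * f 2 * f 3"
proof -
  have "UNIV - {1} = {2, 3, 4::4}" "UNIV - {2} = {1, 3, 4::4}" "UNIV - {3} = {1, 2, 4::4}" "UNIV - {4} = {1, 2, 3::4}"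
    unfolding UNIV_4 by auto
  then show "prod f (UNIV - {1}) = f 2 * f 3 * f 4" "prod f (UNIV - {2}) = f 1 * f 3 * f 4"
    "prod f (UNIV - {3}) = f 1 * f 2 * f 4" "prod f (UNIV - {4}) = f 1 * f 2 * f 3"
    by (simp_all add: mult_ac)
qed

lemma prod_Diff_3:
  fixes f :: "3 \<Rightarrow> complex"
  shows "prod f (UNIV - {1}) = f 2 * f 3" "prod f (UNIV - {2}) = f 1 * f 3" "prod f (UNIV - {3}) = f 1 * f 2"
proof -
  have "UNIV - {1} = {2, 3::3}" "UNIV - {2} = {1, 3::3}" "UNIV - {3} = {1, 2::3}"
    unfolding UNIV_3 by auto
  then show "prod f (UNIV - {1}) = f 2 * f 3" "prod f (UNIV - {2}) = f 1 * f 3" "prod f (UNIV - {3}) = f 1 * f 2"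
    by (simp_all add: mult_ac)
qed

text \<open>Here \<open>p, q, x, y, z, w\<close> are the differences \<open>v\<^sub>2 - v\<^sub>1\<close>, \<open>v\<^sub>4 - v\<^sub>3\<close>, \<open>v\<^sub>3 - v\<^sub>1\<close>, \<open>v\<^sub>4 - v\<^sub>2\<close>, \<open>v\<^sub>3 - v\<^sub>2\<close>, \<open>v\<^sub>4 - v\<^sub>1\<close>,
  and \<open>J = (I - s) / (s - 1)\<close>.\<close>

lemma matrix4_brackets:
  fixes p q x y z w s J :: complex
  assumes nz: "p \<noteq> 0" "q \<noteq> 0" "x \<noteq> 0" "y \<noteq> 0"
    and y: "y = x + q - p" and z: "z = x - p" and w: "w = x + q" and s: "s = x * y / (p * q)"
  defines "I \<equiv> s + J * (s - 1)"
  shows "(1 - p * (J * (1 / p - 1 / x) + 1 / p)) / 2 = - (J * z) / (2 * x)"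
    "(1 - x * (J * (1 / p - 1 / x) + 1 / p)) / 2 = - ((J + 1) * z) / (2 * p)"
    "(1 - w * (J * (1 / p - 1 / x) + 1 / p)) / 2 = - (q * I) / (2 * x)"
    "(1 + p * (J * (- 1 / y - 1 / p) - 1 / p)) / 2 = - (J * w) / (2 * y)"
    "(1 - z * (J * (- 1 / y - 1 / p) - 1 / p)) / 2 = q * I / (2 * y)"
    "(1 - y * (J * (- 1 / y - 1 / p) - 1 / p)) / 2 = (J + 1) * w / (2 * p)"
    "(1 + x * (J * (1 / x + 1 / q) + 1 / q)) / 2 = (J + 1) * w / (2 * q)"
    "(1 + z * (J * (1 / x + 1 / q) + 1 / q)) / 2 = p * I / (2 * x)"
    "(1 - q * (J * (1 / x + 1 / q) + 1 / q)) / 2 = - (J * w) / (2 * x)"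
    "(1 + w * (J * (1 / y - 1 / q) - 1 / q)) / 2 = - (p * I) / (2 * y)"
    "(1 + y * (J * (1 / y - 1 / q) - 1 / q)) / 2 = - ((J + 1) * z) / (2 * q)"
    "(1 + q * (J * (1 / y - 1 / q) - 1 / q)) / 2 = - (J * z) / (2 * y)"
proof -
  \<comment> \<open>The companion of s = x y/(p q). It gives I = (x y + J w z)/(p q), free of s, so
    that the identities become rational ones in the differences.\<close>
  have "s - 1 = w * z / (p * q)" unfolding s w z y using nz by (simp add: divide_simps) (simp add: algebra_simps)
  then have I: "I = (x * y + J * w * z) / (p * q)" unfolding I_def s by (simp add: add_divide_distrib)
  have qI: "q * I = (x * y + J * w * z) / p" "p * I = (x * y + J * w * z) / q" unfolding I using nz by simp_all
  show "(1 - p * (J * (1 / p - 1 / x) + 1 / p)) / 2 = - (J * z) / (2 * x)"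
    "(1 - x * (J * (1 / p - 1 / x) + 1 / p)) / 2 = - ((J + 1) * z) / (2 * p)"
    "(1 - w * (J * (1 / p - 1 / x) + 1 / p)) / 2 = - (q * I) / (2 * x)"
    "(1 + p * (J * (- 1 / y - 1 / p) - 1 / p)) / 2 = - (J * w) / (2 * y)"
    "(1 - z * (J * (- 1 / y - 1 / p) - 1 / p)) / 2 = q * I / (2 * y)"
    "(1 - y * (J * (- 1 / y - 1 / p) - 1 / p)) / 2 = (J + 1) * w / (2 * p)"
    "(1 + x * (J * (1 / x + 1 / q) + 1 / q)) / 2 = (J + 1) * w / (2 * q)"
    "(1 + z * (J * (1 / x + 1 / q) + 1 / q)) / 2 = p * I / (2 * x)"
    "(1 - q * (J * (1 / x + 1 / q) + 1 / q)) / 2 = - (J * w) / (2 * x)"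
    "(1 + w * (J * (1 / y - 1 / q) - 1 / q)) / 2 = - (p * I) / (2 * y)"
    "(1 + y * (J * (1 / y - 1 / q) - 1 / q)) / 2 = - ((J + 1) * z) / (2 * q)"
    "(1 + q * (J * (1 / y - 1 / q) - 1 / q)) / 2 = - (J * z) / (2 * y)"
    unfolding qI w z by (simp_all add: divide_simps nz, (simp_all add: y algebra_simps)?)
qed

text \<open>The values of \<rho> are forced by the first row: since I - s = J(s - 1) and I - 1 = (J
  + 1)(s - 1), solving the entries (1,2), (1,3), (1,4) for -c, b, -a gives exactly these formulas.
  The sign of \<open>A\<close> is then forced by the entry (2,3), which evaluates to C I/(2 s B) and
  has to equal -I/(2A).\<close>

lemma matrix4_entries:
  fixes p q x y z w s J A B C :: complex
  assumes nz: "p \<noteq> 0" "q \<noteq> 0" "x \<noteq> 0" "z \<noteq> 0" "s \<noteq> 0" "s \<noteq> 1" "B \<noteq> 0" "C \<noteq> 0"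
    and y: "y = s * p * q / x" and w: "w = (s - 1) * p * q / z"
    and A: "A = - (s * B / C)" and B2: "B\<^sup>2 = s - 1" and C2: "C\<^sup>2 = s * (1 - s)"
    and I: "I = s + J * (s - 1)"
    and \<rho>: "\<rho>\<^sub>2 = (s - 1) * x / (z * C)" "\<rho>\<^sub>3 = w / (q * B)" "\<rho>\<^sub>4 = x / (q * A)"
  shows "\<rho>\<^sub>2 * (- (J * z) / (2 * x)) = - ((I - s) / (2 * C))"
    "\<rho>\<^sub>3 * (- ((J + 1) * z) / (2 * p)) = - ((I - 1) / (2 * B))"
    "\<rho>\<^sub>4 * (- (q * I) / (2 * x)) = - (I / (2 * A))"
    "1 / \<rho>\<^sub>2 * (- (J * w) / (2 * y)) = (I - s) / (2 * C)"
    "\<rho>\<^sub>3 / \<rho>\<^sub>2 * (q * I / (2 * y)) = - (I / (2 * A))"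
    "\<rho>\<^sub>4 / \<rho>\<^sub>2 * ((J + 1) * w / (2 * p)) = (I - 1) / (2 * B)"
    "1 / \<rho>\<^sub>3 * ((J + 1) * w / (2 * q)) = (I - 1) / (2 * B)"
    "\<rho>\<^sub>2 / \<rho>\<^sub>3 * (p * I / (2 * x)) = I / (2 * A)"
    "\<rho>\<^sub>4 / \<rho>\<^sub>3 * (- (J * w) / (2 * x)) = - ((I - s) / (2 * C))"
    "1 / \<rho>\<^sub>4 * (- (p * I) / (2 * y)) = I / (2 * A)"
    "\<rho>\<^sub>2 / \<rho>\<^sub>4 * (- ((J + 1) * z) / (2 * q)) = - ((I - 1) / (2 * B))"
    "\<rho>\<^sub>3 / \<rho>\<^sub>4 * (- (J * z) / (2 * y)) = (I - s) / (2 * C)"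
proof -
  have s1: "s = 1 + B * B" using B2 by (simp add: power2_eq_square)
  have "1 - s = - (B * B)" by (simp add: s1)
  then have CC: "C * C = - (s * (B * B))" using C2 by (simp add: power2_eq_square)
  have e: "I - s = J * (B * B)" "I - 1 = (J + 1) * (B * B)" by (simp_all add: I s1 algebra_simps)
  have s1': "s - 1 = B * B" by (simp add: s1)
  have w': "w = B * B * p * q / z" unfolding w s1' ..
  \<comment> \<open>Everything is rewritten in B and C with s - 1 = B B, so that the only relation
    left for the polynomial identities is \<open>CC\<close>.\<close>
  have \<rho>': "\<rho>\<^sub>2 = B * B * x / (z * C)" "\<rho>\<^sub>3 = B * p / z" "\<rho>\<^sub>4 = - (x * C / (q * s * B))"
    unfolding \<rho> w' A s1' using nz by simp_all
  have A': "I / (2 * A) = - (I * C / (2 * s * B))"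
    unfolding A using nz by simp
  note defs = A' \<rho>' y w' s1' e
  show "\<rho>\<^sub>2 * (- (J * z) / (2 * x)) = - ((I - s) / (2 * C))"
    "\<rho>\<^sub>3 * (- ((J + 1) * z) / (2 * p)) = - ((I - 1) / (2 * B))"
    "\<rho>\<^sub>4 * (- (q * I) / (2 * x)) = - (I / (2 * A))"
    "1 / \<rho>\<^sub>2 * (- (J * w) / (2 * y)) = (I - s) / (2 * C)"
    "\<rho>\<^sub>3 / \<rho>\<^sub>2 * (q * I / (2 * y)) = - (I / (2 * A))"
    "\<rho>\<^sub>4 / \<rho>\<^sub>2 * ((J + 1) * w / (2 * p)) = (I - 1) / (2 * B)"
    "1 / \<rho>\<^sub>3 * ((J + 1) * w / (2 * q)) = (I - 1) / (2 * B)"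
    "\<rho>\<^sub>2 / \<rho>\<^sub>3 * (p * I / (2 * x)) = I / (2 * A)"
    "\<rho>\<^sub>4 / \<rho>\<^sub>3 * (- (J * w) / (2 * x)) = - ((I - s) / (2 * C))"
    "1 / \<rho>\<^sub>4 * (- (p * I) / (2 * y)) = I / (2 * A)"
    "\<rho>\<^sub>2 / \<rho>\<^sub>4 * (- ((J + 1) * z) / (2 * q)) = - ((I - 1) / (2 * B))"
    "\<rho>\<^sub>3 / \<rho>\<^sub>4 * (- (J * z) / (2 * y)) = (I - s) / (2 * C)"
    unfolding defs by (simp_all add: divide_simps nz) (use CC in algebra)+
qed


text \<open>Formally the four-point brackets with the fourth point at infinity: y/q and w/q become 1
  and the reciprocals of y, q, w disappear.\<close>

lemma matrix3_brackets:
  fixes p x z s J :: complex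
  assumes nz: "p \<noteq> 0" "x \<noteq> 0" and z: "z = x - p" and s: "s = x / p"
  defines "I \<equiv> s + J * (s - 1)"
  shows "(1 - p * (J * (1 / p - 1 / x) + 1 / p)) / 2 = - (J * z) / (2 * x)"
    "(1 - x * (J * (1 / p - 1 / x) + 1 / p)) / 2 = - ((J + 1) * z) / (2 * p)"
    "(1 + p * (J * (- 1 / p) - 1 / p)) / 2 = - J / 2"
    "(1 - z * (J * (- 1 / p) - 1 / p)) / 2 = I / 2"
    "(1 + x * (J * (1 / x))) / 2 = (J + 1) / 2"
    "(1 + z * (J * (1 / x))) / 2 = p * I / (2 * x)"
  unfolding I_def z s by (simp_all add: divide_simps nz, (simp_all add: algebra_simps)?)

text \<open>The factors are the four-point ones in the limit: (s - 1) x/(z C) reduces to s/C and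
  w/(q B) to 1/B.\<close>

lemma matrix3_entries:
  fixes p x z s J A B C :: complex
  assumes nz: "p \<noteq> 0" "s \<noteq> 0" "s \<noteq> 1" "B \<noteq> 0" "C \<noteq> 0"
    and x: "x = s * p" and z: "z = (s - 1) * p"
    and A: "A = - (s * B / C)" and B2: "B\<^sup>2 = s - 1" and C2: "C\<^sup>2 = s * (1 - s)"
    and I: "I = s + J * (s - 1)"
    and \<rho>: "\<rho>\<^sub>2 = s / C" "\<rho>\<^sub>3 = 1 / B"
  shows "\<rho>\<^sub>2 * (- (J * z) / (2 * x)) = - ((I - s) / (2 * C))"
    "\<rho>\<^sub>3 * (- ((J + 1) * z) / (2 * p)) = - ((I - 1) / (2 * B))"
    "1 / \<rho>\<^sub>2 * (- J / 2) = (I - s) / (2 * C)"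
    "\<rho>\<^sub>3 / \<rho>\<^sub>2 * (I / 2) = - (I / (2 * A))"
    "1 / \<rho>\<^sub>3 * ((J + 1) / 2) = (I - 1) / (2 * B)"
    "\<rho>\<^sub>2 / \<rho>\<^sub>3 * (p * I / (2 * x)) = I / (2 * A)"
proof -
  have s1: "s = 1 + B * B" using B2 by (simp add: power2_eq_square)
  have "1 - s = - (B * B)" by (simp add: s1)
  then have CC: "C * C = - (s * (B * B))" using C2 by (simp add: power2_eq_square)
  have e: "I - s = J * (B * B)" "I - 1 = (J + 1) * (B * B)" by (simp_all add: I s1 algebra_simps)
  have s1': "s - 1 = B * B" by (simp add: s1)
  have A': "I / (2 * A) = - (I * C / (2 * s * B))"
    unfolding A using nz by simp
  note defs = A' \<rho> x z s1' e
  show "\<rho>\<^sub>2 * (- (J * z) / (2 * x)) = - ((I - s) / (2 * C))"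
    "\<rho>\<^sub>3 * (- ((J + 1) * z) / (2 * p)) = - ((I - 1) / (2 * B))"
    "1 / \<rho>\<^sub>2 * (- J / 2) = (I - s) / (2 * C)"
    "\<rho>\<^sub>3 / \<rho>\<^sub>2 * (I / 2) = - (I / (2 * A))"
    "1 / \<rho>\<^sub>3 * ((J + 1) / 2) = (I - 1) / (2 * B)"
    "\<rho>\<^sub>2 / \<rho>\<^sub>3 * (p * I / (2 * x)) = I / (2 * A)"
    unfolding defs by (simp_all add: divide_simps nz) (use CC in algebra)+
qed

section \<open>Periods of the given curves in terms of the reduced period\<close>

lemma prod_UNIV_3: "prod f (UNIV :: 3 set) = f 1 * f 2 * (f 3 :: complex)"
  unfolding UNIV_3 by (simp add: mult_ac)

lemma prod_UNIV_4: "prod f (UNIV :: 4 set) = f 1 * f 2 * f 3 * (f 4 :: complex)"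
  unfolding UNIV_4 by (simp add: mult_ac)

lemma moebius_derivative:
  fixes a b p x y :: complex
  assumes p: "p \<noteq> 0" and x: "b - x \<noteq> 0"
  shows "((\<lambda>x. (x - a) * y / (p * (b - x))) has_field_derivative y * (b - a) / (p * (b - x)\<^sup>2)) (at x)"
proof -
  have "((\<lambda>x. (x - a) * y) has_field_derivative (1 - 0) * y) (at x)"
    by (intro DERIV_cmult_right DERIV_diff DERIV_ident DERIV_const)
  moreover have "((\<lambda>x. p * (b - x)) has_field_derivative p * (0 - 1)) (at x)"
    by (intro DERIV_cmult DERIV_diff DERIV_ident DERIV_const)
  ultimately have d: "((\<lambda>x. (x - a) * y / (p * (b - x))) has_field_derivative
      ((1 - 0) * y * (p * (b - x)) - (x - a) * y * (p * (0 - 1))) / ((p * (b - x)) * (p * (b - x)))) (at x)"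
    using p x by (intro DERIV_divide) auto
  have "(1 - 0) * y * (p * (b - x)) - (x - a) * y * (p * (0 - 1)) = p * (y * (b - a))"
    by (simp add: algebra_simps)
  then show ?thesis using d p by (simp add: power2_eq_square mult_ac)
qed

text \<open>Keeps of the reduced curve only its squared period, the differential equation of
  \<open>F\<close> and the branches of the roots. \<open>I\<close> is abstract here, so the matrix
  computations are independent of the Weierstrass functions.\<close>

locale period_data =
  fixes s\<^sub>0 :: complex and r :: real and \<delta> :: "real \<Rightarrow> complex" and F F' I A B C :: "complex \<Rightarrow> complex"
  assumes \<delta>: "valid_path \<delta>"
    and period: "\<And>s. s \<in> ball s\<^sub>0 r \<Longrightarrow> s \<noteq> 0 \<and> s \<noteq> 1 \<and>
     (F has_field_derivative F' s) (at s) \<and> F s \<noteq> 0 \<and> (cycle_period (reduced_cubic s) \<delta>)\<^sup>2 = (F s)\<^sup>2 \<and>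
     2 * s * (s - 1) * F' s = (I s - s) * F s \<and>
     (\<exists>\<rho>. lifts_to_curve (reduced_cubic s) \<delta> \<rho>)"
    and r: "r > 0"
    and B: "continuous_on (ball s\<^sub>0 r) B" "\<And>s. s \<in> ball s\<^sub>0 r \<Longrightarrow> (B s)\<^sup>2 = s - 1"
    and C: "continuous_on (ball s\<^sub>0 r) C" "\<And>s. s \<in> ball s\<^sub>0 r \<Longrightarrow> (C s)\<^sup>2 = s * (1 - s)"
    and A: "\<And>s. A s = - (s * B s / C s)"
begin

lemma BC_nonzero: "s \<in> ball s\<^sub>0 r \<Longrightarrow> B s \<noteq> 0" "s \<in> ball s\<^sub>0 r \<Longrightarrow> C s \<noteq> 0"
  using B(2)[of s] C(2)[of s] period[of s] by auto

lemma F_continuous: "continuous_on (ball s\<^sub>0 r) F"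
  using period by (intro continuous_at_imp_continuous_on ballI DERIV_isCont) blast

text \<open>The differential equation of \<open>F\<close> read as d log F / d log s = (I - s)/(2(s -
  1)).\<close>

lemma log_derivative_F:
  assumes s: "f x \<in> ball s\<^sub>0 r" and f: "has_log_derivative f l x"
  shows "has_log_derivative (\<lambda>z. F (f z)) ((I (f x) - f x) / (f x - 1) * l / 2) x"
proof -
  note p = period[OF s]
  have *: "has_log_derivative (\<lambda>z. F (f z)) (F' (f x) / F (f x) * f x * l) x"
    using p by (intro has_log_derivative_compose[OF f]) auto
  have eq: "F' (f x) / F (f x) * f x = (I (f x) - f x) / (f x - 1) / 2"
    using p by (simp add: divide_simps) (simp add: algebra_simps)
  show ?thesis using * unfolding eq by (simp only: times_divide_eq_left)
qed

text \<open>The map \<open>normalize4 v\<close> has its pole at \<open>v $ 4\<close>, so the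
  neighbourhood of \<open>v\<^sub>0\<close> is first shrunk until this point stays off the cycle.
  Stability of the homotopy then allows the change of variable for every v in the neighbourhood with
  the one fixed loop \<delta>.\<close>

lemma genus_one_4:
  fixes v\<^sub>0 :: "complex ^ 4"
  assumes inj: "inj (($) v\<^sub>0)" and cr0: "cross_ratio4 v\<^sub>0 = s\<^sub>0"
    and \<gamma>: "valid_path \<gamma>" "pathfinish \<gamma> = pathstart \<gamma>" "v\<^sub>0 $ 4 \<notin> path_image \<gamma>"
    and hom: "homotopic_loops (- {0, 1, s\<^sub>0}) (normalize4 v\<^sub>0 \<circ> \<gamma>) \<delta>"
  obtains e where "e > 0" "\<And>v. v \<in> ball v\<^sub>0 e \<Longrightarrow> inj (($) v) \<and> cross_ratio4 v \<in> ball s\<^sub>0 r \<and>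
     (\<Omega>\<^sub>1 \<gamma> v)\<^sup>2 = - ((F (cross_ratio4 v))\<^sup>2 / ((v $ 2 - v $ 1) * (v $ 4 - v $ 3)))"
proof -
  have ne: "v $ i \<noteq> v $ j" if "inj (($) v)" "i \<noteq> j" for v :: "complex ^ 4" and i j
    using that by (auto simp: inj_on_def)
  have cg: "continuous_on {0..1} \<gamma>" using valid_path_imp_path[OF \<gamma>(1)] by (simp add: path_def)
  have "open (- path_image \<gamma>)" using closed_path_image[OF valid_path_imp_path[OF \<gamma>(1)]] by (simp add: open_Compl)
  moreover have "((\<lambda>v. v $ 4) \<longlongrightarrow> v\<^sub>0 $ 4) (nhds v\<^sub>0)" by (intro tendsto_intros filterlim_ident)
  ultimately have ev4: "\<forall>\<^sub>F v in nhds v\<^sub>0. v $ 4 \<in> - path_image \<gamma>"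
    using \<gamma>(3) by (intro topological_tendstoD) auto
  have "\<forall>\<^sub>F v in nhds v\<^sub>0. inj (($) v) \<and> v $ 4 \<in> - path_image \<gamma>"
    using eventually_distinct_coordinates[OF inj] ev4 by (rule eventually_conj)
  then obtain e1 where e1: "e1 > 0" "\<And>v. dist v v\<^sub>0 \<le> e1 \<Longrightarrow> inj (($) v) \<and> v $ 4 \<in> - path_image \<gamma>"
    unfolding eventually_nhds_metric_le by metis
  have c: "continuous_on (cball v\<^sub>0 e1 \<times> {0..1}) (\<lambda>(v, t). normalize4 v (\<gamma> t))"
  proof -
    have "continuous_on (cball v\<^sub>0 e1 \<times> {0..1}) (\<lambda>x. \<gamma> (snd x))"
      by (rule continuous_on_compose2[OF cg continuous_on_snd[OF continuous_on_id]]) auto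
    moreover have "fst x $ 2 - fst x $ 1 \<noteq> 0" "fst x $ 4 - \<gamma> (snd x) \<noteq> 0" if "x \<in> cball v\<^sub>0 e1 \<times> {0..1}" for x
    proof -
      have "inj (($) (fst x))" "fst x $ 4 \<in> - path_image \<gamma>"
        using e1(2)[of "fst x"] that by (auto simp: dist_commute)
      moreover have "\<gamma> (snd x) \<in> path_image \<gamma>" using that by (auto simp: path_image_def)
      ultimately show "fst x $ 2 - fst x $ 1 \<noteq> 0" "fst x $ 4 - \<gamma> (snd x) \<noteq> 0"
        using ne[of "fst x" 2 1] by auto
    qed
    ultimately have "continuous_on (cball v\<^sub>0 e1 \<times> {0..1}) (\<lambda>x. normalize4 (fst x) (\<gamma> (snd x)))"
      unfolding normalize4_def by (intro continuous_intros) auto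
    then show ?thesis by (simp add: split_beta)
  qed
  have cr: "(cross_ratio4 \<longlongrightarrow> cross_ratio4 v\<^sub>0) (nhds v\<^sub>0)"
    unfolding cross_ratio4_def using ne[OF inj] by (intro tendsto_intros filterlim_ident) auto
  have "\<forall>\<^sub>F v in nhds v\<^sub>0. cross_ratio4 v \<in> ball s\<^sub>0 r"
    using cr r cr0 by (intro topological_tendstoD) auto
  moreover have "\<forall>\<^sub>F v in nhds v\<^sub>0. homotopic_loops (- {0, 1, cross_ratio4 v}) \<delta> (normalize4 v \<circ> \<gamma>)"
    by (rule homotopic_loops_stable[OF e1(1) c cr _ \<gamma>(2)]) (use hom cr0 in simp)
  ultimately have "\<forall>\<^sub>F v in nhds v\<^sub>0. cross_ratio4 v \<in> ball s\<^sub>0 r \<and>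
      homotopic_loops (- {0, 1, cross_ratio4 v}) \<delta> (normalize4 v \<circ> \<gamma>)"
    by (rule eventually_conj)
  then obtain e2 where e2: "e2 > 0" "\<And>v. dist v v\<^sub>0 < e2 \<Longrightarrow> cross_ratio4 v \<in> ball s\<^sub>0 r \<and>
      homotopic_loops (- {0, 1, cross_ratio4 v}) \<delta> (normalize4 v \<circ> \<gamma>)"
    unfolding eventually_nhds_metric by metis
  show thesis
  proof (rule that[of "min e1 e2"])
    fix v assume v: "v \<in> ball v\<^sub>0 (min e1 e2)"
    define s where "s = cross_ratio4 v"
    have v1: "inj (($) v)" "v $ 4 \<in> - path_image \<gamma>" using e1(2)[of v] v by (auto simp: dist_commute)
    have s: "s \<in> ball s\<^sub>0 r" and hom': "homotopic_loops (- {0, 1, s}) \<delta> (normalize4 v \<circ> \<gamma>)"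
      using e2(2)[of v] v by (auto simp: s_def dist_commute)
    note nz = ne[OF v1(1)]
    let ?p = "v $ 2 - v $ 1" and ?q = "v $ 4 - v $ 3" and ?y = "v $ 4 - v $ 2" and ?w = "v $ 4 - v $ 1"
    have nzs: "?p \<noteq> 0" "?q \<noteq> 0" "?y \<noteq> 0" "?w \<noteq> 0" using nz by auto
    \<comment> \<open>Normalizes the multiplier so that the cubic at \<open>normalize4 v x\<close>
      times its square is exactly the quartic. The minus sign comes from x - v_4 = -(v_4 -
      x).\<close>
    define \<kappa> where "\<kappa> = csqrt (- (?y\<^sup>2 * ?w\<^sup>2 / (?p ^ 3 * ?q)))"
    have \<kappa>2: "\<kappa>\<^sup>2 = - (?y\<^sup>2 * ?w\<^sup>2 / (?p ^ 3 * ?q))" by (simp add: \<kappa>_def)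
    have \<kappa>: "\<kappa> \<noteq> 0" using \<kappa>2 nzs by auto
    define k where "k = ?y * ?w / (?p * \<kappa>)"
    have "(cycle_period (reduced_cubic s) \<delta>)\<^sup>2 = k\<^sup>2 * (cycle_period (\<lambda>x. \<Prod>i\<in>UNIV. (x - v $ i)) \<gamma>)\<^sup>2"
    proof (rule cycle_period_homotopic_change[where T = "- {v $ 4}" and f = "normalize4 v" and m = "\<lambda>x. (v $ 4 - x)\<^sup>2 / \<kappa>"])
      show "path_image \<gamma> \<subseteq> - {v $ 4}" using v1(2) by auto
      show "open (- {v $ 4})" by (simp add: open_Compl)
      show "normalize4 v holomorphic_on - {v $ 4}"
        unfolding normalize4_def[abs_def] using nzs by (intro holomorphic_intros) auto
      show "continuous_on (path_image \<gamma>) (\<lambda>x. (v $ 4 - x)\<^sup>2 / \<kappa>)" using \<kappa> by (intro continuous_intros) simp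
      fix x assume "x \<in> path_image \<gamma>"
      then have x: "v $ 4 - x \<noteq> 0" using v1(2) by auto
      show "(v $ 4 - x)\<^sup>2 / \<kappa> \<noteq> 0" using x \<kappa> by simp
      have n0: "normalize4 v x = (x - v $ 1) * ?y / (?p * (v $ 4 - x))" by (simp add: normalize4_def)
      have n1: "normalize4 v x - 1 = (x - v $ 2) * ?w / (?p * (v $ 4 - x))"
        unfolding n0 using nzs x by (simp add: divide_simps) (simp add: algebra_simps)
      have ns: "normalize4 v x - s = (x - v $ 3) * ?y * ?w / (?p * (v $ 4 - x) * ?q)"
        unfolding n0 s_def cross_ratio4_def using nzs x by (simp add: divide_simps) (simp add: algebra_simps)
      have "reduced_cubic s (normalize4 v x) * ((v $ 4 - x)\<^sup>2 / \<kappa>)\<^sup>2 =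
          ((x - v $ 1) * ?y / (?p * (v $ 4 - x))) * ((x - v $ 2) * ?w / (?p * (v $ 4 - x))) *
          ((x - v $ 3) * ?y * ?w / (?p * (v $ 4 - x) * ?q)) * ((v $ 4 - x) ^ 4 / \<kappa>\<^sup>2)"
        unfolding reduced_cubic_def n1 ns unfolding n0 by (simp add: power_divide flip: power_mult)
      also have "\<dots> = (x - v $ 1) * (x - v $ 2) * (x - v $ 3) * (- (v $ 4 - x))"
      proof -
        have "(a * y / (p * t)) * (b * w / (p * t)) * (c * y * w / (p * t * q)) * (t ^ 4 / - (y\<^sup>2 * w\<^sup>2 / (p ^ 3 * q))) = a * b * c * (- t)"
          if "y \<noteq> 0" "p \<noteq> 0" "t \<noteq> 0" "w \<noteq> 0" "q \<noteq> 0" for a b c y p t w q :: complex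
          using that by (simp add: power_numeral_reduce)
        from this[OF nzs(3,1) x nzs(4,2)] show ?thesis unfolding \<kappa>2 .
      qed
      also have "\<dots> = (\<Prod>i\<in>UNIV. (x - v $ i))" by (simp add: prod_UNIV_4)
      finally show "reduced_cubic s (normalize4 v x) * ((v $ 4 - x)\<^sup>2 / \<kappa>)\<^sup>2 = (\<Prod>i\<in>UNIV. (x - v $ i))" .
      have "(normalize4 v has_field_derivative ?y * ?w / (?p * (v $ 4 - x)\<^sup>2)) (at x)"
        unfolding normalize4_def[abs_def] by (rule moebius_derivative[OF nzs(1) x])
      then show "deriv (normalize4 v) x * ((v $ 4 - x)\<^sup>2 / \<kappa>) = k"
        using x by (simp add: DERIV_imp_deriv k_def)
    next
      show "lifts_to_curve (reduced_cubic s) \<delta> (SOME \<rho>. lifts_to_curve (reduced_cubic s) \<delta> \<rho>)"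
        using period[OF s] by (metis someI_ex)
    qed (use \<gamma> \<delta> hom' in auto)
    \<comment> \<open>The numerators of the derivative cancel against \<kappa>^2; this is the origin
      of the factor (v_2 - v_1)(v_4 - v_3) and of its sign.\<close>
    moreover have "k\<^sup>2 = - (?p * ?q)"
    proof -
      have "y\<^sup>2 * w\<^sup>2 / (p\<^sup>2 * - (y\<^sup>2 * w\<^sup>2 / (p ^ 3 * q))) = - (p * q)"
        if "y \<noteq> 0" "w \<noteq> 0" "p \<noteq> 0" "q \<noteq> 0" for y w p q :: complex
        using that by (simp add: power_numeral_reduce)
      from this[OF nzs(3,4,1,2)] show ?thesis unfolding k_def power_divide power_mult_distrib \<kappa>2 .
    qed
    ultimately have "(F s)\<^sup>2 = - (?p * ?q) * (\<Omega>\<^sub>1 \<gamma> v)\<^sup>2"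
      using period[OF s] by (simp add: \<Omega>\<^sub>1_def)
    then have "(\<Omega>\<^sub>1 \<gamma> v)\<^sup>2 = - ((F s)\<^sup>2 / (?p * ?q))" using nzs by simp
    then show "inj (($) v) \<and> cross_ratio4 v \<in> ball s\<^sub>0 r \<and>
     (\<Omega>\<^sub>1 \<gamma> v)\<^sup>2 = - ((F (cross_ratio4 v))\<^sup>2 / ((v $ 2 - v $ 1) * (v $ 4 - v $ 3)))"
      using v1 s by (simp add: s_def)
  qed (use e1 e2 in auto)
qed

text \<open>With the fourth branch point at infinity the map is affine, the multiplier is a constant
  \<kappa> with \<kappa>^2 = p^3 for p = u_2 - u_1, and the squared scale factor is p.\<close>

lemma genus_one_3:
  fixes u\<^sub>0 :: "complex ^ 3"
  assumes inj: "inj (($) u\<^sub>0)" and cr0: "cross_ratio3 u\<^sub>0 = s\<^sub>0"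
    and \<gamma>: "valid_path \<gamma>" "pathfinish \<gamma> = pathstart \<gamma>"
    and hom: "homotopic_loops (- {0, 1, s\<^sub>0}) (normalize3 u\<^sub>0 \<circ> \<gamma>) \<delta>"
  obtains e where "e > 0" "\<And>u. u \<in> ball u\<^sub>0 e \<Longrightarrow> inj (($) u) \<and> cross_ratio3 u \<in> ball s\<^sub>0 r \<and>
     (\<Omega>\<^sub>1 \<gamma> u)\<^sup>2 = (F (cross_ratio3 u))\<^sup>2 / (u $ 2 - u $ 1)"
proof -
  have ne: "v $ i \<noteq> v $ j" if "inj (($) v)" "i \<noteq> j" for v :: "complex ^ 3" and i j
    using that by (auto simp: inj_on_def)
  have cg: "continuous_on {0..1} \<gamma>" using valid_path_imp_path[OF \<gamma>(1)] by (simp add: path_def)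
  obtain e1 where e1: "e1 > 0" "\<And>v. dist v u\<^sub>0 \<le> e1 \<Longrightarrow> inj (($) v)"
    using eventually_distinct_coordinates[OF inj] unfolding eventually_nhds_metric_le by metis
  have c: "continuous_on (cball u\<^sub>0 e1 \<times> {0..1}) (\<lambda>(v, t). normalize3 v (\<gamma> t))"
  proof -
    have "continuous_on (cball u\<^sub>0 e1 \<times> {0..1}) (\<lambda>x. \<gamma> (snd x))"
      by (rule continuous_on_compose2[OF cg continuous_on_snd[OF continuous_on_id]]) auto
    moreover have nz: "fst x $ 2 - fst x $ 1 \<noteq> 0" if "x \<in> cball u\<^sub>0 e1 \<times> {0..1}" for x
      using e1(2)[of "fst x"] that ne[of "fst x" 2 1] by (auto simp: dist_commute)
    ultimately have "continuous_on (cball u\<^sub>0 e1 \<times> {0..1}) (\<lambda>x. normalize3 (fst x) (\<gamma> (snd x)))"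
      unfolding normalize3_def by (intro continuous_intros ballI nz)
    then show ?thesis by (simp add: split_beta)
  qed
  have cr: "(cross_ratio3 \<longlongrightarrow> cross_ratio3 u\<^sub>0) (nhds u\<^sub>0)"
    unfolding cross_ratio3_def using ne[OF inj] by (intro tendsto_intros filterlim_ident) auto
  have "\<forall>\<^sub>F v in nhds u\<^sub>0. cross_ratio3 v \<in> ball s\<^sub>0 r"
    using cr r cr0 by (intro topological_tendstoD) auto
  moreover have "\<forall>\<^sub>F v in nhds u\<^sub>0. homotopic_loops (- {0, 1, cross_ratio3 v}) \<delta> (normalize3 v \<circ> \<gamma>)"
    by (rule homotopic_loops_stable[OF e1(1) c cr _ \<gamma>(2)]) (use hom cr0 in simp)
  ultimately have "\<forall>\<^sub>F v in nhds u\<^sub>0. cross_ratio3 v \<in> ball s\<^sub>0 r \<and>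
      homotopic_loops (- {0, 1, cross_ratio3 v}) \<delta> (normalize3 v \<circ> \<gamma>)"
    by (rule eventually_conj)
  then obtain e2 where e2: "e2 > 0" "\<And>v. dist v u\<^sub>0 < e2 \<Longrightarrow> cross_ratio3 v \<in> ball s\<^sub>0 r \<and>
      homotopic_loops (- {0, 1, cross_ratio3 v}) \<delta> (normalize3 v \<circ> \<gamma>)"
    unfolding eventually_nhds_metric by metis
  show thesis
  proof (rule that[of "min e1 e2"])
    fix v assume v: "v \<in> ball u\<^sub>0 (min e1 e2)"
    define s where "s = cross_ratio3 v"
    have v1: "inj (($) v)" using e1(2)[of v] v by (auto simp: dist_commute)
    have s: "s \<in> ball s\<^sub>0 r" and hom': "homotopic_loops (- {0, 1, s}) \<delta> (normalize3 v \<circ> \<gamma>)"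
      using e2(2)[of v] v by (auto simp: s_def dist_commute)
    let ?p = "v $ 2 - v $ 1"
    have p: "?p \<noteq> 0" using ne[OF v1, of 2 1] by auto
    define \<kappa> where "\<kappa> = csqrt (?p ^ 3)"
    have \<kappa>2: "\<kappa>\<^sup>2 = ?p ^ 3" by (simp add: \<kappa>_def)
    have \<kappa>: "\<kappa> \<noteq> 0" using \<kappa>2 p by auto
    have "(cycle_period (reduced_cubic s) \<delta>)\<^sup>2 = (\<kappa> / ?p)\<^sup>2 * (cycle_period (\<lambda>x. \<Prod>i\<in>UNIV. (x - v $ i)) \<gamma>)\<^sup>2"
    proof (rule cycle_period_homotopic_change[where T = UNIV and f = "normalize3 v" and m = "\<lambda>x. \<kappa>"])
      show "normalize3 v holomorphic_on UNIV"
        unfolding normalize3_def[abs_def] using p by (intro holomorphic_intros) auto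
      fix x assume "x \<in> path_image \<gamma>"
      have n1: "normalize3 v x - 1 = (x - v $ 2) / ?p" and ns: "normalize3 v x - s = (x - v $ 3) / ?p"
        unfolding normalize3_def s_def cross_ratio3_def using p by (simp_all add: divide_simps)
      have "reduced_cubic s (normalize3 v x) * \<kappa>\<^sup>2 = (x - v $ 1) * (x - v $ 2) * (x - v $ 3)"
      proof -
        have "a / c * (b / c) * (d / c) * c ^ 3 = a * b * d" if "c \<noteq> 0" for a b c d :: complex
          using that by (simp add: power3_eq_cube)
        from this[OF p] show ?thesis unfolding reduced_cubic_def n1 ns \<kappa>2 unfolding normalize3_def .
      qed
      also have "\<dots> = (\<Prod>i\<in>UNIV. (x - v $ i))" by (simp add: prod_UNIV_3)
      finally show "reduced_cubic s (normalize3 v x) * \<kappa>\<^sup>2 = (\<Prod>i\<in>UNIV. (x - v $ i))" .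
      have "(normalize3 v has_field_derivative (1 - 0) / ?p) (at x)"
        unfolding normalize3_def[abs_def] by (intro DERIV_cdivide DERIV_diff DERIV_ident DERIV_const)
      then show "deriv (normalize3 v) x * \<kappa> = \<kappa> / ?p"
        by (simp add: DERIV_imp_deriv)
    next
      show "lifts_to_curve (reduced_cubic s) \<delta> (SOME \<rho>. lifts_to_curve (reduced_cubic s) \<delta> \<rho>)"
        using period[OF s] by (metis someI_ex)
    qed (use \<gamma> \<delta> hom' \<kappa> in auto)
    moreover have "(\<kappa> / ?p)\<^sup>2 = ?p"
      unfolding power_divide \<kappa>2 using p by (simp add: power2_eq_square power3_eq_cube)
    ultimately have "(F s)\<^sup>2 = ?p * (\<Omega>\<^sub>1 \<gamma> v)\<^sup>2"
      using period[OF s] by (simp add: \<Omega>\<^sub>1_def)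
    then have "(\<Omega>\<^sub>1 \<gamma> v)\<^sup>2 = (F s)\<^sup>2 / ?p" using p by simp
    then show "inj (($) v) \<and> cross_ratio3 v \<in> ball s\<^sub>0 r \<and>
     (\<Omega>\<^sub>1 \<gamma> v)\<^sup>2 = (F (cross_ratio3 v))\<^sup>2 / (v $ 2 - v $ 1)"
      using v1 s by (simp add: s_def)
  qed (use e1 e2 in auto)
qed

end

text \<open>The factors beside the squares are the products of v_i - v_j over j different from i,
  for i = 2, 3, 4, and the right-hand side is the product for i = 1. So this is the condition on
  \<rho> in \<open>W_matrix_from_ratios\<close> with k = 1.\<close>

lemma matrix4_squares:
  fixes p q x y z w s A B C :: complex
  assumes nz: "p \<noteq> 0" "q \<noteq> 0" "x \<noteq> 0" "z \<noteq> 0" "s \<noteq> 0" "s \<noteq> 1" "B \<noteq> 0" "C \<noteq> 0"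
    and y: "y = s * p * q / x" and w: "w = (s - 1) * p * q / z"
    and A: "A = - (s * B / C)" and B2: "B\<^sup>2 = s - 1" and C2: "C\<^sup>2 = s * (1 - s)"
    and \<rho>: "\<rho>\<^sub>2 = (s - 1) * x / (z * C)" "\<rho>\<^sub>3 = w / (q * B)" "\<rho>\<^sub>4 = x / (q * A)"
  shows "\<rho>\<^sub>2\<^sup>2 * (p * z * y) = - (p * x * w)" "\<rho>\<^sub>3\<^sup>2 * (- (x * z * q)) = - (p * x * w)"
    "\<rho>\<^sub>4\<^sup>2 * (w * y * q) = - (p * x * w)"
proof -
  have s1: "s - 1 = B * B" using B2 by (simp add: power2_eq_square)
  have "1 - s = - (B * B)" using s1 by (simp add: algebra_simps)
  then have CC: "C * C = - (s * (B * B))" using C2 by (simp add: power2_eq_square)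
  have w': "w = B * B * p * q / z" unfolding w s1 ..
  have \<rho>': "\<rho>\<^sub>2 = B * B * x / (z * C)" "\<rho>\<^sub>3 = B * p / z" "\<rho>\<^sub>4 = - (x * C / (q * s * B))"
    unfolding \<rho> w' A s1 using nz by simp_all
  note defs = \<rho>' y w' power2_eq_square
  show "\<rho>\<^sub>2\<^sup>2 * (p * z * y) = - (p * x * w)"
    unfolding defs by (simp add: divide_simps nz) (use CC in algebra)
  show "\<rho>\<^sub>3\<^sup>2 * (- (x * z * q)) = - (p * x * w)"
    unfolding defs by (simp add: divide_simps nz)
  show "\<rho>\<^sub>4\<^sup>2 * (w * y * q) = - (p * x * w)"
    unfolding defs by (simp add: divide_simps nz) (use CC in algebra)
qed

lemma matrix3_squares:
  fixes p x z s A B C :: complex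
  assumes nz: "p \<noteq> 0" "s \<noteq> 0" "s \<noteq> 1" "B \<noteq> 0" "C \<noteq> 0"
    and x: "x = s * p" and z: "z = (s - 1) * p" and B2: "B\<^sup>2 = s - 1" and C2: "C\<^sup>2 = s * (1 - s)"
    and \<rho>: "\<rho>\<^sub>2 = s / C" "\<rho>\<^sub>3 = 1 / B"
  shows "\<rho>\<^sub>2\<^sup>2 * (- (p * z)) = p * x" "\<rho>\<^sub>3\<^sup>2 * (x * z) = p * x"
proof -
  have s1: "s - 1 = B * B" using B2 by (simp add: power2_eq_square)
  have "1 - s = - (B * B)" using s1 by (simp add: algebra_simps)
  then have CC: "C * C = - (s * (B * B))" using C2 by (simp add: power2_eq_square)
  note defs = \<rho> x z s1 power2_eq_square
  show "\<rho>\<^sub>2\<^sup>2 * (- (p * z)) = p * x"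
    unfolding defs by (simp add: divide_simps nz) (use CC in algebra)
  show "\<rho>\<^sub>3\<^sup>2 * (x * z) = p * x"
    unfolding defs by (simp add: divide_simps nz)
qed

text \<open>The formulas for the cross ratio and for the cross ratio minus 1, solved for v_4 - v_2
  and v_4 - v_1, the differences that the algebraic lemmas eliminate.\<close>

lemma cross_ratio4_relations:
  fixes v :: "complex ^ 4"
  assumes "inj (($) v)"
  defines "s \<equiv> cross_ratio4 v"
  shows "v $ 4 - v $ 2 = s * (v $ 2 - v $ 1) * (v $ 4 - v $ 3) / (v $ 3 - v $ 1)"
    "v $ 4 - v $ 1 = (s - 1) * (v $ 2 - v $ 1) * (v $ 4 - v $ 3) / (v $ 3 - v $ 2)"
proof -
  have ne: "v $ i \<noteq> v $ j" if "i \<noteq> j" for i j using assms(1) that by (auto simp: inj_on_def)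
  have nz: "v $ 2 - v $ 1 \<noteq> 0" "v $ 4 - v $ 3 \<noteq> 0" "v $ 3 - v $ 1 \<noteq> 0" "v $ 3 - v $ 2 \<noteq> 0" using ne by auto
  have s: "s * ((v $ 2 - v $ 1) * (v $ 4 - v $ 3)) = (v $ 3 - v $ 1) * (v $ 4 - v $ 2)"
    unfolding s_def cross_ratio4_def using nz by simp
  then show "v $ 4 - v $ 2 = s * (v $ 2 - v $ 1) * (v $ 4 - v $ 3) / (v $ 3 - v $ 1)"
    using nz by (simp add: mult.assoc)
  have "(s - 1) * ((v $ 2 - v $ 1) * (v $ 4 - v $ 3)) = s * ((v $ 2 - v $ 1) * (v $ 4 - v $ 3)) - (v $ 2 - v $ 1) * (v $ 4 - v $ 3)"
    by (simp only: left_diff_distrib[of s 1] mult_1)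
  also have "\<dots> = (v $ 3 - v $ 2) * (v $ 4 - v $ 1)"
    unfolding s by (simp add: algebra_simps)
  finally have "(s - 1) * ((v $ 2 - v $ 1) * (v $ 4 - v $ 3)) = (v $ 3 - v $ 2) * (v $ 4 - v $ 1)" .
  then show "v $ 4 - v $ 1 = (s - 1) * (v $ 2 - v $ 1) * (v $ 4 - v $ 3) / (v $ 3 - v $ 2)"
    using nz by (simp add: mult.assoc)
qed

section \<open>The two matrices\<close>

context period_data
begin

lemma W_matrix_4:
  fixes v\<^sub>0 :: "complex ^ 4"
  assumes inj: "inj (($) v\<^sub>0)" and cr0: "cross_ratio4 v\<^sub>0 = s\<^sub>0"
    and \<gamma>: "valid_path \<gamma>" "pathfinish \<gamma> = pathstart \<gamma>" "v\<^sub>0 $ 4 \<notin> path_image \<gamma>"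
    and hom: "homotopic_loops (- {0, 1, s\<^sub>0}) (normalize4 v\<^sub>0 \<circ> \<gamma>) \<delta>"
  defines "a \<equiv> \<lambda>s. I s / (2 * A s)" and "b \<equiv> \<lambda>s. - ((I s - 1) / (2 * B s))" and "c \<equiv> \<lambda>s. (I s - s) / (2 * C s)"
  shows "\<exists>U R. open U \<and> v\<^sub>0 \<in> U \<and> cross_ratio4 ` U \<subseteq> ball s\<^sub>0 r \<and>
            (\<forall>i. sqrt_branch U (metric_coeff \<gamma> i) (R i)) \<and>
            (\<forall>v\<in>U. let s = cross_ratio4 v in
               W_matrix R v = vector [vector [  0 , -c s,  b s, -a s],
                                      vector [ c s,   0 , -a s, -b s],
                                      vector [-b s,  a s,   0 , -c s],
                                      vector [ a s,  b s,  c s,   0 ]])"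
proof -
  obtain e where e: "e > 0" "\<And>v. v \<in> ball v\<^sub>0 e \<Longrightarrow> inj (($) v) \<and> cross_ratio4 v \<in> ball s\<^sub>0 r \<and>
     (\<Omega>\<^sub>1 \<gamma> v)\<^sup>2 = - ((F (cross_ratio4 v))\<^sup>2 / ((v $ 2 - v $ 1) * (v $ 4 - v $ 3)))"
    using genus_one_4[OF inj cr0 \<gamma> hom] by metis
  define U where "U = ball v\<^sub>0 e"
  define Q where "Q w = - ((F (cross_ratio4 w))\<^sup>2 / ((w $ 2 - w $ 1) * (w $ 4 - w $ 3)))" for w :: "complex ^ 4"
  have Uinj: "inj (($) v)" and Ucr: "cross_ratio4 v \<in> ball s\<^sub>0 r" and UQ: "(\<Omega>\<^sub>1 \<gamma> v)\<^sup>2 = Q v" if "v \<in> U" for v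
    using e(2)[of v] that by (auto simp: U_def Q_def)
  have ne: "v $ i - v $ j \<noteq> 0" if "v \<in> U" "i \<noteq> j" for v i j
    using Uinj[OF that(1)] that(2) by (auto simp: inj_on_def)
  have Qnz: "Q v \<noteq> 0" if "v \<in> U" for v
    using period[OF Ucr[OF that]] ne[OF that, of 2 1] ne[OF that, of 4 3] by (simp add: Q_def)
  have ccr: "continuous_on U cross_ratio4"
    unfolding cross_ratio4_def by (intro continuous_intros ballI) (use ne in simp)
  have cF: "continuous_on U (\<lambda>v. F (cross_ratio4 v))" "continuous_on U (\<lambda>v. B (cross_ratio4 v))" "continuous_on U (\<lambda>v. C (cross_ratio4 v))"
    using Ucr by (auto intro!: continuous_on_compose2[OF F_continuous ccr] continuous_on_compose2[OF B(1) ccr] continuous_on_compose2[OF C(1) ccr])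
  have cQ: "continuous_on U Q"
    unfolding Q_def by (intro continuous_intros cF ballI) (use ne in simp)
  define \<rho>2 where "\<rho>2 w = (cross_ratio4 w - 1) * (w $ 3 - w $ 1) / ((w $ 3 - w $ 2) * C (cross_ratio4 w))" for w :: "complex ^ 4"
  define \<rho>3 where "\<rho>3 w = (w $ 4 - w $ 1) / ((w $ 4 - w $ 3) * B (cross_ratio4 w))" for w :: "complex ^ 4"
  define \<rho>4 where "\<rho>4 w = (w $ 3 - w $ 1) / ((w $ 4 - w $ 3) * A (cross_ratio4 w))" for w :: "complex ^ 4"
  define \<rho> where "\<rho> i w = (if i = 1 then 1 else if i = 2 then \<rho>2 w else if i = 3 then \<rho>3 w else \<rho>4 w)" for i :: 4 and w
  have \<rho>s: "\<rho> 1 w = 1" "\<rho> 2 w = \<rho>2 w" "\<rho> 3 w = \<rho>3 w" "\<rho> 4 w = \<rho>4 w" for w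
    by (simp_all add: \<rho>_def)
  have BCnz: "B (cross_ratio4 v) \<noteq> 0" "C (cross_ratio4 v) \<noteq> 0" "cross_ratio4 v \<noteq> 0" "cross_ratio4 v \<noteq> 1" "A (cross_ratio4 v) \<noteq> 0" if "v \<in> U" for v
    using BC_nonzero Ucr[OF that] period[OF Ucr[OF that]] by (auto simp: A)
  have c\<rho>: "continuous_on U (\<rho> i)" for i
  proof -
    have "continuous_on U \<rho>2" unfolding \<rho>2_def
      by (intro continuous_intros cF ccr ballI) (use ne BCnz in simp)
    moreover have "continuous_on U \<rho>3" unfolding \<rho>3_def
      by (intro continuous_intros cF ccr ballI) (use ne BCnz in simp)
    moreover have "continuous_on U (\<lambda>w. A (cross_ratio4 w))" unfolding A
      by (intro continuous_intros cF ccr ballI) (use BCnz in simp)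
    then have "continuous_on U \<rho>4" unfolding \<rho>4_def
      by (intro continuous_intros ballI) (use ne BCnz in simp_all)
    ultimately show ?thesis
      by (cases "i = 1"; cases "i = 2"; cases "i = 3") (simp_all add: \<rho>_def[abs_def])
  qed
  have squares: "(\<rho> i v)\<^sup>2 * (\<Prod>j\<in>UNIV - {i}. (v $ i - v $ j)) = (\<Prod>j\<in>UNIV - {1}. (v $ 1 - v $ j))"
    if v: "v \<in> U" for i v
  proof -
    note sq = matrix4_squares[OF ne[OF v, of 2 1] ne[OF v, of 4 3] ne[OF v, of 3 1] ne[OF v, of 3 2] BCnz(3,4,1,2)[OF v]
      cross_ratio4_relations[OF Uinj[OF v]] A B(2)[OF Ucr[OF v]] C(2)[OF Ucr[OF v]] \<rho>2_def \<rho>3_def \<rho>4_def, simplified]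
    have *: "(v $ 1 - v $ 2) * (v $ 1 - v $ 3) * (v $ 1 - v $ 4) = - ((v $ 2 - v $ 1) * (v $ 3 - v $ 1) * (v $ 4 - v $ 1))"
      "(v $ 2 - v $ 1) * (v $ 2 - v $ 3) * (v $ 2 - v $ 4) = (v $ 2 - v $ 1) * (v $ 3 - v $ 2) * (v $ 4 - v $ 2)"
      "(v $ 3 - v $ 1) * (v $ 3 - v $ 2) * (v $ 3 - v $ 4) = - ((v $ 3 - v $ 1) * (v $ 3 - v $ 2) * (v $ 4 - v $ 3))"
      by (simp_all add: algebra_simps)
    have "\<forall>i. (\<rho> i v)\<^sup>2 * (\<Prod>j\<in>UNIV - {i}. (v $ i - v $ j)) = (\<Prod>j\<in>UNIV - {1}. (v $ 1 - v $ j))"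
      unfolding forall_4 prod_Diff_4 \<rho>s * using sq by simp
    then show ?thesis by blast
  qed
  \<comment> \<open>The logarithmic derivative of v_j - v_k with respect to v_i.\<close>
  define ev where "ev v i j k = ((if j = i then 1 else 0) - (if k = i then 1 else 0)) / (v $ j - v $ k)"
    for v :: "complex ^ 4" and i j k
  define J where "J s = (I s - s) / (s - 1)" for s
  \<comment> \<open>Up to a constant factor Q is F(s)^2 divided by (v_2 - v_1)(v_4 - v_3). The
    square cancels the 2 in the logarithmic derivative of \<open>F\<close>, leaving J times that of
    s, minus that of the denominator.\<close>
  define l where "l i v = J (cross_ratio4 v) * (ev v i 3 1 + ev v i 4 2 - (ev v i 2 1 + ev v i 4 3)) - (ev v i 2 1 + ev v i 4 3)" for i v
  have upd: "(\<chi> k. if k = i then v $ i else v $ k) = v" for v :: "complex ^ 4" and i by (simp add: vec_eq_iff)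
  have dl: "((\<lambda>t. Q (\<chi> k. if k = i then t else v $ k)) has_field_derivative l i v * Q v) (at (v $ i))"
    if v: "v \<in> U" for i v
  proof -
    let ?u = "\<lambda>t. \<chi> k. if k = i then t else v $ k"
    have d: "has_log_derivative (\<lambda>t. ?u t $ j - ?u t $ k) (ev v i j k) (v $ i)" if "j \<noteq> k" for j k
      unfolding ev_def by (rule has_log_derivative_coordinates) (use ne[OF v that] in simp)
    have "has_log_derivative (\<lambda>t. cross_ratio4 (?u t)) (ev v i 3 1 + ev v i 4 2 - (ev v i 2 1 + ev v i 4 3)) (v $ i)"
      unfolding cross_ratio4_def by (intro has_log_derivative_divide has_log_derivative_mult d) simp_all
    then have "has_log_derivative (\<lambda>t. F (cross_ratio4 (?u t))) (J (cross_ratio4 (?u (v $ i))) * (ev v i 3 1 + ev v i 4 2 - (ev v i 2 1 + ev v i 4 3)) / 2) (v $ i)"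
      unfolding J_def by (intro log_derivative_F) (use Ucr[OF v] upd in simp)
    then have "has_log_derivative (\<lambda>t. Q (?u t)) (2 * (J (cross_ratio4 v) * (ev v i 3 1 + ev v i 4 2 - (ev v i 2 1 + ev v i 4 3)) / 2) - (ev v i 2 1 + ev v i 4 3)) (v $ i)"
      unfolding Q_def upd by (intro has_log_derivative_minus has_log_derivative_divide has_log_derivative_square has_log_derivative_mult d) simp_all
    then show ?thesis unfolding has_log_derivative_def upd by (simp add: l_def)
  qed
  have "open U" "contractible U" by (simp_all add: U_def convex_imp_contractible)
  then have "\<exists>R. (\<forall>i. sqrt_branch U (metric_coeff \<gamma> i) (R i)) \<and> (\<forall>v\<in>U. \<forall>i j. i \<noteq> j \<longrightarrow>
      W_matrix R v $ i $ j = \<rho> j v / \<rho> i v * ((1 - (v $ j - v $ i) * l i v) / 2))"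
    by (rule W_matrix_from_ratios[where Q = Q, OF _ _ Uinj cQ Qnz UQ c\<rho> squares dl])
  then obtain R where RB: "\<forall>i. sqrt_branch U (metric_coeff \<gamma> i) (R i)"
    and E: "\<forall>v\<in>U. \<forall>i j. i \<noteq> j \<longrightarrow>
      W_matrix R v $ i $ j = \<rho> j v / \<rho> i v * ((1 - (v $ j - v $ i) * l i v) / 2)"
    by (elim exE conjE)
  have main: "W_matrix R v = vector [vector [  0 , -c s,  b s, -a s],
                                      vector [ c s,   0 , -a s, -b s],
                                      vector [-b s,  a s,   0 , -c s],
                                      vector [ a s,  b s,  c s,   0 ]]"
    if v: "v \<in> U" and s: "s = cross_ratio4 v" for v s
  proof -
    define p q x y z w where "p = v $ 2 - v $ 1" and "q = v $ 4 - v $ 3" and "x = v $ 3 - v $ 1"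
      and "y = v $ 4 - v $ 2" and "z = v $ 3 - v $ 2" and "w = v $ 4 - v $ 1"
    note ds = p_def q_def x_def y_def z_def w_def
    have nz: "p \<noteq> 0" "q \<noteq> 0" "x \<noteq> 0" "y \<noteq> 0" "z \<noteq> 0" "w \<noteq> 0" unfolding ds by (intro ne[OF v]; simp)+
    have s1: "s \<noteq> 0" "s \<noteq> 1" using BCnz[OF v] s by auto
    have IJ: "I s = s + J s * (s - 1)" using s1 by (simp add: J_def)
    have l: "l 1 v = J s * (1 / p - 1 / x) + 1 / p" "l 2 v = J s * (- 1 / y - 1 / p) - 1 / p"
      "l 3 v = J s * (1 / x + 1 / q) + 1 / q" "l 4 v = J s * (1 / y - 1 / q) - 1 / q"
      by (simp_all add: l_def ev_def ds s)
    \<comment> \<open>Below the diagonal v_j - v_i is the negative of one of the six named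
      differences, so the brackets there carry a plus sign.\<close>
    have flip: "1 - (v $ 1 - v $ 2) * X = 1 + p * X" "1 - (v $ 1 - v $ 3) * X = 1 + x * X" "1 - (v $ 1 - v $ 4) * X = 1 + w * X"
      "1 - (v $ 2 - v $ 3) * X = 1 + z * X" "1 - (v $ 2 - v $ 4) * X = 1 + y * X" "1 - (v $ 3 - v $ 4) * X = 1 + q * X" for X
      by (simp_all add: ds algebra_simps)
    have sxy: "s = x * y / (p * q)" unfolding s ds cross_ratio4_def ..
    have br: "(1 - p * l 1 v) / 2 = - (J s * z) / (2 * x)"
        "(1 - x * l 1 v) / 2 = - ((J s + 1) * z) / (2 * p)"
        "(1 - w * l 1 v) / 2 = - (q * I s) / (2 * x)"
        "(1 + p * l 2 v) / 2 = - (J s * w) / (2 * y)"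
        "(1 - z * l 2 v) / 2 = q * I s / (2 * y)"
        "(1 - y * l 2 v) / 2 = (J s + 1) * w / (2 * p)"
        "(1 + x * l 3 v) / 2 = (J s + 1) * w / (2 * q)"
        "(1 + z * l 3 v) / 2 = p * I s / (2 * x)"
        "(1 - q * l 3 v) / 2 = - (J s * w) / (2 * x)"
        "(1 + w * l 4 v) / 2 = - (p * I s) / (2 * y)"
        "(1 + y * l 4 v) / 2 = - ((J s + 1) * z) / (2 * q)"
        "(1 + q * l 4 v) / 2 = - (J s * z) / (2 * y)"
      unfolding l IJ by (rule matrix4_brackets[OF nz(1-4) _ _ _ sxy]; simp add: ds)+
    note en = matrix4_entries[OF nz(1,2,3,5) s1 _ _ _ _ A B(2) C(2) IJ,
      of y w "\<rho>2 v" "\<rho>3 v" "\<rho>4 v"]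
    have hyps: "B s \<noteq> 0" "C s \<noteq> 0" "y = s * p * q / x" "w = (s - 1) * p * q / z" "s \<in> ball s\<^sub>0 r"
      "\<rho>2 v = (s - 1) * x / (z * C s)" "\<rho>3 v = w / (q * B s)" "\<rho>4 v = x / (q * A s)"
      using BCnz[OF v] Ucr[OF v] cross_ratio4_relations[OF Uinj[OF v]] by (simp_all add: s ds \<rho>2_def \<rho>3_def \<rho>4_def)
    note en' = en[OF hyps(1-5,5-8)]
    note simps = flip ds[symmetric] br \<rho>s div_by_1
    have W: "W_matrix R v $ 1 $ 2 = - c s" "W_matrix R v $ 1 $ 3 = b s" "W_matrix R v $ 1 $ 4 = - a s"
      "W_matrix R v $ 2 $ 1 = c s" "W_matrix R v $ 2 $ 3 = - a s" "W_matrix R v $ 2 $ 4 = - b s"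
      "W_matrix R v $ 3 $ 1 = - b s" "W_matrix R v $ 3 $ 2 = a s" "W_matrix R v $ 3 $ 4 = - c s"
      "W_matrix R v $ 4 $ 1 = a s" "W_matrix R v $ 4 $ 2 = b s" "W_matrix R v $ 4 $ 3 = c s"
      unfolding a_def b_def c_def minus_minus
      by (subst E[rule_format, OF v], simp, simp only: simps, rule en')+
    have "W_matrix R v $ i $ i = 0" for i by (simp add: W_matrix_def)
    with W show ?thesis by (simp add: vec_eq_iff forall_4)
  qed
  show ?thesis
  proof (intro exI[of _ U] exI[of _ R] conjI allI ballI)
    show "open U" "v\<^sub>0 \<in> U" using e(1) by (auto simp: U_def)
    show "cross_ratio4 ` U \<subseteq> ball s\<^sub>0 r" using Ucr by blast
  qed (use RB main in \<open>auto simp: Let_def\<close>)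
qed


text \<open>The four-point argument with the fourth point at infinity: Q keeps the single
  denominator u_2 - u_1, and the multipliers of the root become functions of s alone.\<close>

lemma W_matrix_3:
  fixes u\<^sub>0 :: "complex ^ 3"
  assumes inj: "inj (($) u\<^sub>0)" and cr0: "cross_ratio3 u\<^sub>0 = s\<^sub>0"
    and \<gamma>: "valid_path \<gamma>" "pathfinish \<gamma> = pathstart \<gamma>"
    and hom: "homotopic_loops (- {0, 1, s\<^sub>0}) (normalize3 u\<^sub>0 \<circ> \<gamma>) \<delta>"
  defines "a \<equiv> \<lambda>s. I s / (2 * A s)" and "b \<equiv> \<lambda>s. - ((I s - 1) / (2 * B s))" and "c \<equiv> \<lambda>s. (I s - s) / (2 * C s)"
  shows "\<exists>U R. open U \<and> u\<^sub>0 \<in> U \<and> cross_ratio3 ` U \<subseteq> ball s\<^sub>0 r \<and>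
            (\<forall>i. sqrt_branch U (metric_coeff \<gamma> i) (R i)) \<and>
            (\<forall>u\<in>U. let s = cross_ratio3 u in
               W_matrix R u = vector [vector [  0 , -c s,  b s],
                                      vector [ c s,   0 , -a s],
                                      vector [-b s,  a s,   0 ]])"
proof -
  obtain e where e: "e > 0" "\<And>v. v \<in> ball u\<^sub>0 e \<Longrightarrow> inj (($) v) \<and> cross_ratio3 v \<in> ball s\<^sub>0 r \<and>
     (\<Omega>\<^sub>1 \<gamma> v)\<^sup>2 = (F (cross_ratio3 v))\<^sup>2 / (v $ 2 - v $ 1)"
    using genus_one_3[OF inj cr0 \<gamma> hom] by metis
  define U where "U = ball u\<^sub>0 e"
  define Q where "Q w = (F (cross_ratio3 w))\<^sup>2 / (w $ 2 - w $ 1)" for w :: "complex ^ 3"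
  have Uinj: "inj (($) v)" and Ucr: "cross_ratio3 v \<in> ball s\<^sub>0 r" and UQ: "(\<Omega>\<^sub>1 \<gamma> v)\<^sup>2 = Q v" if "v \<in> U" for v
    using e(2)[of v] that by (auto simp: U_def Q_def)
  have ne: "v $ i - v $ j \<noteq> 0" if "v \<in> U" "i \<noteq> j" for v i j
    using Uinj[OF that(1)] that(2) by (auto simp: inj_on_def)
  have Qnz: "Q v \<noteq> 0" if "v \<in> U" for v
    using period[OF Ucr[OF that]] ne[OF that, of 2 1] by (simp add: Q_def)
  have ccr: "continuous_on U cross_ratio3"
    unfolding cross_ratio3_def by (intro continuous_intros ballI) (use ne in simp)
  have cF: "continuous_on U (\<lambda>v. F (cross_ratio3 v))" "continuous_on U (\<lambda>v. B (cross_ratio3 v))" "continuous_on U (\<lambda>v. C (cross_ratio3 v))"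
    using Ucr by (auto intro!: continuous_on_compose2[OF F_continuous ccr] continuous_on_compose2[OF B(1) ccr] continuous_on_compose2[OF C(1) ccr])
  have cQ: "continuous_on U Q"
    unfolding Q_def by (intro continuous_intros cF ballI) (use ne in simp)
  define \<rho>2 where "\<rho>2 w = cross_ratio3 w / C (cross_ratio3 w)" for w :: "complex ^ 3"
  define \<rho>3 where "\<rho>3 w = 1 / B (cross_ratio3 w)" for w :: "complex ^ 3"
  define \<rho> where "\<rho> i w = (if i = 1 then 1 else if i = 2 then \<rho>2 w else \<rho>3 w)" for i :: 3 and w
  have \<rho>s: "\<rho> 1 w = 1" "\<rho> 2 w = \<rho>2 w" "\<rho> 3 w = \<rho>3 w" for w
    by (simp_all add: \<rho>_def)
  have BCnz: "B (cross_ratio3 v) \<noteq> 0" "C (cross_ratio3 v) \<noteq> 0" "cross_ratio3 v \<noteq> 0" "cross_ratio3 v \<noteq> 1" if "v \<in> U" for v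
    using BC_nonzero Ucr[OF that] period[OF Ucr[OF that]] by auto
  have c\<rho>: "continuous_on U (\<rho> i)" for i
  proof -
    have "continuous_on U \<rho>2" unfolding \<rho>2_def
      by (intro continuous_intros cF ccr ballI) (use BCnz in simp)
    moreover have "continuous_on U \<rho>3" unfolding \<rho>3_def
      by (intro continuous_intros cF ccr ballI) (use BCnz in simp)
    ultimately show ?thesis
      by (cases "i = 1"; cases "i = 2") (simp_all add: \<rho>_def[abs_def])
  qed
  have rel: "v $ 3 - v $ 1 = cross_ratio3 v * (v $ 2 - v $ 1)" "v $ 3 - v $ 2 = (cross_ratio3 v - 1) * (v $ 2 - v $ 1)"
    if v: "v \<in> U" for v
  proof -
    show 1: "v $ 3 - v $ 1 = cross_ratio3 v * (v $ 2 - v $ 1)"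
      using ne[OF v, of 2 1] by (simp add: cross_ratio3_def)
    have "(cross_ratio3 v - 1) * (v $ 2 - v $ 1) = cross_ratio3 v * (v $ 2 - v $ 1) - (v $ 2 - v $ 1)"
      by (simp only: left_diff_distrib[of _ 1] mult_1)
    then show "v $ 3 - v $ 2 = (cross_ratio3 v - 1) * (v $ 2 - v $ 1)"
      unfolding 1[symmetric] by simp
  qed
  have squares: "(\<rho> i v)\<^sup>2 * (\<Prod>j\<in>UNIV - {i}. (v $ i - v $ j)) = (\<Prod>j\<in>UNIV - {1}. (v $ 1 - v $ j))"
    if v: "v \<in> U" for i v
  proof -
    note sq = matrix3_squares[OF ne[OF v, of 2 1] BCnz(3,4,1,2)[OF v] rel[OF v]
      B(2)[OF Ucr[OF v]] C(2)[OF Ucr[OF v]] \<rho>2_def \<rho>3_def, simplified]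
    have *: "(v $ 1 - v $ 2) * (v $ 1 - v $ 3) = (v $ 2 - v $ 1) * (v $ 3 - v $ 1)"
      "(v $ 2 - v $ 1) * (v $ 2 - v $ 3) = - ((v $ 2 - v $ 1) * (v $ 3 - v $ 2))"
      by (simp_all add: algebra_simps)
    have "\<forall>i. (\<rho> i v)\<^sup>2 * (\<Prod>j\<in>UNIV - {i}. (v $ i - v $ j)) = (\<Prod>j\<in>UNIV - {1}. (v $ 1 - v $ j))"
      unfolding forall_3 prod_Diff_3 \<rho>s * using sq by simp
    then show ?thesis by blast
  qed
  define ev where "ev v i j k = ((if j = i then 1 else 0) - (if k = i then 1 else 0)) / (v $ j - v $ k)"
    for v :: "complex ^ 3" and i j k
  define J where "J s = (I s - s) / (s - 1)" for s
  define l where "l i v = J (cross_ratio3 v) * (ev v i 3 1 - ev v i 2 1) - ev v i 2 1" for i v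
  have upd: "(\<chi> k. if k = i then v $ i else v $ k) = v" for v :: "complex ^ 3" and i by (simp add: vec_eq_iff)
  have dl: "((\<lambda>t. Q (\<chi> k. if k = i then t else v $ k)) has_field_derivative l i v * Q v) (at (v $ i))"
    if v: "v \<in> U" for i v
  proof -
    let ?u = "\<lambda>t. \<chi> k. if k = i then t else v $ k"
    have d: "has_log_derivative (\<lambda>t. ?u t $ j - ?u t $ k) (ev v i j k) (v $ i)" if "j \<noteq> k" for j k
      unfolding ev_def by (rule has_log_derivative_coordinates) (use ne[OF v that] in simp)
    have "has_log_derivative (\<lambda>t. cross_ratio3 (?u t)) (ev v i 3 1 - ev v i 2 1) (v $ i)"
      unfolding cross_ratio3_def by (intro has_log_derivative_divide d) simp_all
    then have "has_log_derivative (\<lambda>t. F (cross_ratio3 (?u t))) (J (cross_ratio3 (?u (v $ i))) * (ev v i 3 1 - ev v i 2 1) / 2) (v $ i)"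
      unfolding J_def by (intro log_derivative_F) (use Ucr[OF v] upd in simp)
    then have "has_log_derivative (\<lambda>t. Q (?u t)) (2 * (J (cross_ratio3 v) * (ev v i 3 1 - ev v i 2 1) / 2) - ev v i 2 1) (v $ i)"
      unfolding Q_def upd by (intro has_log_derivative_divide has_log_derivative_square d) simp_all
    then show ?thesis unfolding has_log_derivative_def upd by (simp add: l_def)
  qed
  have "open U" "contractible U" by (simp_all add: U_def convex_imp_contractible)
  then have "\<exists>R. (\<forall>i. sqrt_branch U (metric_coeff \<gamma> i) (R i)) \<and> (\<forall>v\<in>U. \<forall>i j. i \<noteq> j \<longrightarrow>
      W_matrix R v $ i $ j = \<rho> j v / \<rho> i v * ((1 - (v $ j - v $ i) * l i v) / 2))"
    by (rule W_matrix_from_ratios[where Q = Q, OF _ _ Uinj cQ Qnz UQ c\<rho> squares dl])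
  then obtain R where RB: "\<forall>i. sqrt_branch U (metric_coeff \<gamma> i) (R i)"
    and E: "\<forall>v\<in>U. \<forall>i j. i \<noteq> j \<longrightarrow>
      W_matrix R v $ i $ j = \<rho> j v / \<rho> i v * ((1 - (v $ j - v $ i) * l i v) / 2)"
    by (elim exE conjE)
  have main: "W_matrix R v = vector [vector [  0 , -c s,  b s],
                                      vector [ c s,   0 , -a s],
                                      vector [-b s,  a s,   0 ]]"
    if v: "v \<in> U" and s: "s = cross_ratio3 v" for v s
  proof -
    define p x z where "p = v $ 2 - v $ 1" and "x = v $ 3 - v $ 1" and "z = v $ 3 - v $ 2"
    note ds = p_def x_def z_def
    have nz: "p \<noteq> 0" "x \<noteq> 0" unfolding ds by (intro ne[OF v]; simp)+
    have s1: "s \<noteq> 0" "s \<noteq> 1" using BCnz[OF v] s by auto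
    have IJ: "I s = s + J s * (s - 1)" using s1 by (simp add: J_def)
    have l: "l 1 v = J s * (1 / p - 1 / x) + 1 / p" "l 2 v = J s * (- 1 / p) - 1 / p" "l 3 v = J s * (1 / x)"
      by (simp_all add: l_def ev_def ds s)
    have flip: "1 - (v $ 1 - v $ 2) * X = 1 + p * X" "1 - (v $ 1 - v $ 3) * X = 1 + x * X"
      "1 - (v $ 2 - v $ 3) * X = 1 + z * X" for X
      by (simp_all add: ds algebra_simps)
    have sx: "s = x / p" unfolding s ds cross_ratio3_def ..
    have br: "(1 - p * l 1 v) / 2 = - (J s * z) / (2 * x)"
        "(1 - x * l 1 v) / 2 = - ((J s + 1) * z) / (2 * p)"
        "(1 + p * l 2 v) / 2 = - J s / 2"
        "(1 - z * l 2 v) / 2 = I s / 2"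
        "(1 + x * l 3 v) / 2 = (J s + 1) / 2"
        "(1 + z * l 3 v) / 2 = p * I s / (2 * x)"
      unfolding l IJ by (rule matrix3_brackets[OF nz _ sx]; simp add: ds)+
    note en = matrix3_entries[OF nz(1) s1 _ _ _ _ A B(2) C(2) IJ, of x z "\<rho>2 v" "\<rho>3 v"]
    have hyps: "B s \<noteq> 0" "C s \<noteq> 0" "x = s * p" "z = (s - 1) * p" "s \<in> ball s\<^sub>0 r"
      "\<rho>2 v = s / C s" "\<rho>3 v = 1 / B s"
      using BCnz[OF v] Ucr[OF v] rel[OF v] by (simp_all add: s ds \<rho>2_def \<rho>3_def)
    note en' = en[OF hyps(1-5,5-7)]
    note simps = flip ds[symmetric] br \<rho>s div_by_1
    have W: "W_matrix R v $ 1 $ 2 = - c s" "W_matrix R v $ 1 $ 3 = b s"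
      "W_matrix R v $ 2 $ 1 = c s" "W_matrix R v $ 2 $ 3 = - a s"
      "W_matrix R v $ 3 $ 1 = - b s" "W_matrix R v $ 3 $ 2 = a s"
      unfolding a_def b_def c_def minus_minus
      by (subst E[rule_format, OF v], simp, simp only: simps, rule en')+
    have "W_matrix R v $ i $ i = 0" for i by (simp add: W_matrix_def)
    with W show ?thesis by (simp add: vec_eq_iff forall_3)
  qed
  show ?thesis
  proof (intro exI[of _ U] exI[of _ R] conjI allI ballI)
    show "open U" "u\<^sub>0 \<in> U" using e(1) by (auto simp: U_def)
    show "cross_ratio3 ` U \<subseteq> ball s\<^sub>0 r" using Ucr by blast
  qed (use RB main in \<open>auto simp: Let_def\<close>)
qed

end

theorem proposition4:
  fixes s\<^sub>0 :: complex and \<delta> :: "real \<Rightarrow> complex" and \<omega>\<^sub>2 :: "complex \<Rightarrow> complex"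
  assumes "s\<^sub>0 \<noteq> 0" and "s\<^sub>0 \<noteq> 1"
    and "encircles_cut \<delta> 0 1 {s\<^sub>0}"
    and "\<forall>\<^sub>F s in nhds s\<^sub>0. uniformizing_periods s (\<omega>\<^sub>1_bar s \<delta>) (\<omega>\<^sub>2 s)"
  shows "\<exists>S A B C. open S \<and> s\<^sub>0 \<in> S \<and>
    sqrt_branch S (\<lambda>s. - s) A \<and> sqrt_branch S (\<lambda>s. s - 1) B \<and> sqrt_branch S (\<lambda>s. s * (1 - s)) C \<and>
    (let I = (\<lambda>s. I_bar s (\<omega>\<^sub>1_bar s \<delta>) (\<omega>\<^sub>2 s));
         a = (\<lambda>s. I s / (2 * A s));
         b = (\<lambda>s. - ((I s - 1) / (2 * B s)));
         c = (\<lambda>s. (I s - s) / (2 * C s))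
     in
      (\<forall>\<gamma> (v\<^sub>0 :: complex ^ 4).
         inj (($) v\<^sub>0) \<and> cross_ratio4 v\<^sub>0 = s\<^sub>0 \<and>
         encircles_cut \<gamma> (v\<^sub>0 $ 1) (v\<^sub>0 $ 2) {v\<^sub>0 $ 3, v\<^sub>0 $ 4} \<and>
         corresponds_via (normalize4 v\<^sub>0) s\<^sub>0 \<gamma> \<delta> \<longrightarrow>
         (\<exists>U R. open U \<and> v\<^sub>0 \<in> U \<and> cross_ratio4 ` U \<subseteq> S \<and>
            (\<forall>i. sqrt_branch U (metric_coeff \<gamma> i) (R i)) \<and>
            (\<forall>v\<in>U. let s = cross_ratio4 v in
               W_matrix R v = vector [vector [  0 , -c s,  b s, -a s],
                                      vector [ c s,   0 , -a s, -b s],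
                                      vector [-b s,  a s,   0 , -c s],
                                      vector [ a s,  b s,  c s,   0 ]]))) \<and>
      (\<forall>\<gamma> (u\<^sub>0 :: complex ^ 3).
         inj (($) u\<^sub>0) \<and> cross_ratio3 u\<^sub>0 = s\<^sub>0 \<and>
         encircles_cut \<gamma> (u\<^sub>0 $ 1) (u\<^sub>0 $ 2) {u\<^sub>0 $ 3} \<and>
         corresponds_via (normalize3 u\<^sub>0) s\<^sub>0 \<gamma> \<delta> \<longrightarrow>
         (\<exists>U R. open U \<and> u\<^sub>0 \<in> U \<and> cross_ratio3 ` U \<subseteq> S \<and>
            (\<forall>i. sqrt_branch U (metric_coeff \<gamma> i) (R i)) \<and>
            (\<forall>u\<in>U. let s = cross_ratio3 u in
               W_matrix R u = vector [vector [  0 , -c s,  b s],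
                                      vector [ c s,   0 , -a s],
                                      vector [-b s,  a s,   0 ]]))))"
proof -
  obtain r F F' where r: "r > 0" and period: "\<And>s. s \<in> ball s\<^sub>0 r \<Longrightarrow> s \<noteq> 0 \<and> s \<noteq> 1 \<and>
     (F has_field_derivative F' s) (at s) \<and> F s \<noteq> 0 \<and> (cycle_period (reduced_cubic s) \<delta>)\<^sup>2 = (F s)\<^sup>2 \<and>
     2 * s * (s - 1) * F' s = (I_bar s (\<omega>\<^sub>1_bar s \<delta>) (\<omega>\<^sub>2 s) - s) * F s \<and>
     (\<exists>\<rho>. lifts_to_curve (reduced_cubic s) \<delta> \<rho>)"
    using reduced_period[OF assms] by metis
  let ?S = "ball s\<^sub>0 r"
  have S: "contractible ?S" by (simp add: convex_imp_contractible)
  have "continuous_on ?S (\<lambda>s. s - 1)" "\<And>s. s \<in> ?S \<Longrightarrow> s - 1 \<noteq> 0"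
    using period by (auto intro!: continuous_intros)
  from continuous_sqrt_on_contractible[OF this(1) S this(2)]
  obtain B where B: "continuous_on ?S B" "\<And>s. s \<in> ?S \<Longrightarrow> s - 1 = (B s)\<^sup>2" by metis
  have "continuous_on ?S (\<lambda>s. s * (1 - s))" "\<And>s. s \<in> ?S \<Longrightarrow> s * (1 - s) \<noteq> 0"
    using period by (auto intro!: continuous_intros)
  from continuous_sqrt_on_contractible[OF this(1) S this(2)]
  obtain C where C: "continuous_on ?S C" "\<And>s. s \<in> ?S \<Longrightarrow> s * (1 - s) = (C s)\<^sup>2" by metis
  \<comment> \<open>Defined from B and C instead of being chosen as a third independent root, which
    would fix it only up to sign. The same A, B, C then serve both matrices.\<close>
  define A where "A s = - (s * B s / C s)" for s
  interpret period_data s\<^sub>0 r \<delta> F F' "\<lambda>s. I_bar s (\<omega>\<^sub>1_bar s \<delta>) (\<omega>\<^sub>2 s)" A B C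
    using period r B C encircled_cut_lifts(3)[OF assms(3)] by unfold_locales (auto simp: A_def)
  have "continuous_on ?S A" unfolding A_def[abs_def]
    using BC_nonzero by (intro continuous_intros B C) auto
  moreover have "(A s)\<^sup>2 = - s" if s: "s \<in> ?S" for s
  proof -
    have "(A s)\<^sup>2 = s\<^sup>2 * (s - 1) / (s * (1 - s))"
      by (simp add: A_def power_divide power_mult_distrib B(2)[OF s] C(2)[OF s])
    also have "\<dots> = - s" using period[OF s] by (simp add: divide_simps power2_eq_square) (simp add: algebra_simps)
    finally show ?thesis .
  qed
  ultimately have SA: "sqrt_branch ?S (\<lambda>s. - s) A" by (simp add: sqrt_branch_def)
  have SB: "sqrt_branch ?S (\<lambda>s. s - 1) B" and SC: "sqrt_branch ?S (\<lambda>s. s * (1 - s)) C"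
    using B C by (simp_all add: sqrt_branch_def)
  have avoid: "x \<notin> path_image \<gamma>" if "encircles_cut \<gamma> y z E" "x \<in> E" for \<gamma> x y z E
    using that outside_no_overlap[of "path_image \<gamma>"] unfolding encircles_cut_def by blast
  have paths: "valid_path \<gamma>" "pathfinish \<gamma> = pathstart \<gamma>" if "encircles_cut \<gamma> y z E" for \<gamma> y z E
    using that by (auto simp: encircles_cut_def)
  show ?thesis
    unfolding Let_def
    apply (rule exI[of _ ?S], rule exI[of _ A], rule exI[of _ B], rule exI[of _ C])
    apply (intro conjI allI impI SA SB SC open_ball; (elim conjE)?)
    subgoal using r by simp
    subgoal premises prems for \<gamma> v\<^sub>0
      by (rule W_matrix_4[OF prems(1,2) paths[OF prems(3)] avoid[OF prems(3)] prems(4)[unfolded corresponds_via_def], unfolded Let_def]) simp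
    subgoal premises prems for \<gamma> u\<^sub>0
      by (rule W_matrix_3[OF prems(1,2) paths[OF prems(3)] prems(4)[unfolded corresponds_via_def], unfolded Let_def])
    done
qed

end
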